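(* Let $a,b\ge 1$ be integers and let $\varepsilon$ be a word with $a$ letters $+$ and $b-1$ letters $-$. In the web space $\mathrm{Hom}(\varepsilon,\,-^b+^{a+1})$, $$\big(P_{-^b+^a,\;\varepsilon-}\otimes \mathrm{id}_+\big)\circ\big(\mathrm{id}_\varepsilon\otimes \mathrm{cup}\big)=\sum_{i=1}^{b}\sum_{j=0}^{a}\frac{[b-i+1]\,[b+j+1]}{[b]\,[a+b+1]}\;E_{i,j}\circ P_{-^{b-1}+^a,\;\varepsilon},$$ where $P_{t,s}$ denotes the (non-segregated) $\mathfrak{sl}(3)$ clasp from the word $s$ to the word $t$, $\mathrm{cup}\in\mathrm{Hom}(\emptyset,-+)$ is the single arc, and $E_{i,j}\in \mathrm{Hom}(-^{b-1}+^a,-^b+^{a+1})$ are the webs described in the context.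
   Context: Ground field $K=\mathbb{C}(q^{1/2})$; $[n]=\frac{q^{n/2}-q^{-n/2}}{q^{1/2}-q^{-1/2}}$. Webs. An $\mathfrak{sl}(3)$ web in a rectangle is a planar oriented graph (possibly with closed oriented loops without vertices), up to isotopy, all of whose interior vertices are trivalent and are either sources or sinks, and whose univalent vertices lie on the bottom and top sides of the rectangle. For words $s,t$ in the letters $+,-$, $\mathrm{Hom}(s,t)$ is the $K$-vector space spanned by webs whose bottom endpoints read $s$ and whose top endpoints read $t$ (left to right), where $+$ means that the strand there is oriented upward and $-$ downward, modulo the local relations: (1) a closed loop (either orientation) may be removed with factor $[3]$; (2) a bigon (two parallel edges between two vertices, with one outer leg at each vertex) equals $-[2]$ times the single oriented strand; (3) a square face with its four outer legs equals the sum of the two planar, orientation-compatible ways of joining the four legs by two disjoint arcs. Composition $w\circ v$ stacks $w$ on top of $v$; $\otimes$ is horizontal juxtaposition; $\mathrm{id}_s$ is the web of vertical strands. Resolved crossings. A transverse crossing of two oriented arcs is turned into a piece of web ("an $H$") as follows: the two incoming half-edges are joined at a new sink, the two outgoing half-edges at a new source, and an edge oriented from the source to the sink is added. (This is planar whenever the two incoming half-edges are adjacent, which is always the case for transverse crossings.) Clasps. The weight of a word with $a$ letters $+$ and $b$ letters $-$ is $(a,b)$, meaning $a\lambda_1+b\lambda_2$. The partial order on weights is generated by $(a,b)\succ(a+1,b-2)$ and $(a,b)\succ(a-2,b+1)$. The clasp $P_s\in\mathrm{Hom}(s,s)$ is the unique nonzero idempotent such that $w\circ P_s=0$ for all $w\in\mathrm{Hom}(s,t)$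 and $P_s\circ w'=0$ for all $w'\in\mathrm{Hom}(t,s)$ whenever the weight of $t$ is strictly less than that of $s$. If $s,t$ are words of the same weight, the non-segregated clasp $P_{t,s}\in\mathrm{Hom}(s,t)$ is obtained from $P_s$ by attaching on top a sequence of resolved crossings of adjacent strands of opposite sign which transforms the word $s$ into $t$; the result does not depend on the chosen sequence, and $P_{s,s}=P_s$. The webs $E_{i,j}$ ($1\le i\le b$, $0\le j\le a$). Draw from left to right vertical strands $v_1,\dots,v_{b-1}$ oriented downward and $u_1,\dots,u_a$ oriented upward. Add an oriented arc which starts at the top of the rectangle immediately to the right of $v_{b-i}$ (so it is the $(b-i+1)$-st top endpoint), goes down, then goes to the right crossing exactly the strands $v_{b-i+1},\dots,v_{b-1}$ and $u_1,\dots,u_j$ once each in this order, and then goes up, ending at the top immediately to the right of the top endpoint of $u_j$ (so it is the $(b+j+1)$-st top endpoint). $E_{i,j}$ is the web obtained by replacing each of the $i-1+j$ crossings by an $H$, that is, by joining the two incoming half-edges of the crossing at a new sink and its two outgoing half-edges at a new source, and adding an edge oriented from the source to the sink. (For $i=1,j=0$ it is a U-turn at the top together with vertical strands.) *)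

theory Defs
  imports
    "HOL-Computational_Algebra.Polynomial"
    "HOL-Computational_Algebra.Fraction_Field"
    "HOL-Library.Poly_Mapping"
    Complex_Main
begin

section \<open>The ground field\<close>

text \<open>\<open>\<complex>(q\<^sup>1\<^sup>/\<^sup>2)\<close> is the field of rational functions in the indeterminate
  \<open>q_half\<close>, which stands for \<open>q\<^sup>1\<^sup>/\<^sup>2\<close>.\<close>

type_synonym scalar = "complex poly fract"

definition q_half :: scalar where
  "q_half = Fract [:0, 1:] 1"

definition qint :: "nat \<Rightarrow> scalar" where
  "qint n = (q_half ^ n - inverse q_half ^ n) / (q_half - inverse q_half)"


section \<open>Webs\<close>

datatype sign = Plus | Minus

instantiation sign :: uminus
begin
fun uminus_sign :: "sign \<Rightarrow> sign" where
  "- Plus = Minus"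
| "- Minus = Plus"
instance ..
end

type_synonym word = "sign list"

text \<open>A web is drawn in generic position with respect to the height function of the rectangle:
  going upwards one meets, one at a time, local minima and maxima of edges and trivalent vertices,
  and each vertex has its three legs pointing up or down in the pattern 2--1 or 1--2 (each vertex
  can be rotated into these positions). \<open>Cup x\<close> and \<open>Cap x\<close> have the endpoints \<open>x, -x\<close>, from left to
  right. With \<open>Plus\<close> meaning upward, \<open>Merge Plus\<close> and \<open>Split Plus\<close> are sinks, \<open>Merge Minus\<close>
  and \<open>Split Minus\<close> are sources; no other trivalent vertices are allowed. Closed loops without
  vertices are made of cups and caps.\<close>

datatype elem = Cup sign | Cap sign | Merge sign | Split sign

fun elem_bot :: "elem \<Rightarrow> word" where
  "elem_bot (Cup x) = []"
| "elem_bot (Cap x) = [x, - x]"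
| "elem_bot (Merge x) = [x, x]"
| "elem_bot (Split x) = [x]"

fun elem_top :: "elem \<Rightarrow> word" where
  "elem_top (Cup x) = [x, - x]"
| "elem_top (Cap x) = []"
| "elem_top (Merge x) = [- x]"
| "elem_top (Split x) = [- x, - x]"

text \<open>A slice \<open>(u, g, v)\<close> is a horizontal strip that contains \<open>g\<close> with vertical strands \<open>u\<close> on its left
  and \<open>v\<close> on its right. Lists of slices are read from bottom to top.\<close>

type_synonym slice = "word \<times> elem \<times> word"

fun slice_bot :: "slice \<Rightarrow> word" where
  "slice_bot (u, g, v) = u @ elem_bot g @ v"

fun slice_top :: "slice \<Rightarrow> word" where
  "slice_top (u, g, v) = u @ elem_top g @ v"

fun chained :: "word \<Rightarrow> slice list \<Rightarrow> bool" where
  "chained s [] \<longleftrightarrow> True"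
| "chained s (l # ls) \<longleftrightarrow> slice_bot l = s \<and> chained (slice_top l) ls"

fun end_word :: "word \<Rightarrow> slice list \<Rightarrow> word" where
  "end_word s [] = s"
| "end_word s (l # ls) = end_word (slice_top l) ls"

typedef web = "{(s, ls). chained s ls}"
  by (rule exI[of _ "([], [])"]) simp

definition bot_word :: "web \<Rightarrow> word" where
  "bot_word w = fst (Rep_web w)"

definition slices :: "web \<Rightarrow> slice list" where
  "slices w = snd (Rep_web w)"

definition top_word :: "web \<Rightarrow> word" where
  "top_word w = end_word (bot_word w) (slices w)"

definition id_web :: "word \<Rightarrow> web" where
  "id_web s = Abs_web (s, [])"

definition elem_web :: "elem \<Rightarrow> web" where
  "elem_web g = Abs_web (elem_bot g, [([], g, [])])"

text \<open>\<open>stack w v\<close> puts \<open>w\<close> on top of \<open>v\<close>; it is meant for \<open>top_word v = bot_word w\<close> only.\<close>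

definition stack :: "web \<Rightarrow> web \<Rightarrow> web" where
  "stack w v = Abs_web (bot_word v, slices v @ slices w)"

text \<open>In \<open>juxt v w\<close> the web \<open>v\<close> is on the left; its slices are drawn below those of \<open>w\<close>.\<close>

definition juxt :: "web \<Rightarrow> web \<Rightarrow> web" where
  "juxt v w = Abs_web (bot_word v @ bot_word w,
     map (\<lambda>(x, g, y). (x, g, y @ bot_word w)) (slices v) @
     map (\<lambda>(x, g, y). (top_word v @ x, g, y)) (slices w))"

lemma chained_append:
  "chained s (ls @ ls') \<longleftrightarrow> chained s ls \<and> chained (end_word s ls) ls'"
  by (induction ls arbitrary: s) auto

lemma end_word_append: "end_word s (ls @ ls') = end_word (end_word s ls) ls'"
  by (induction ls arbitrary: s) auto

lemma chained_web: "chained (bot_word w) (slices w)"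
  using Rep_web[of w] by (auto simp: bot_word_def slices_def)

lemma chained_pad_right:
  "chained s ls \<Longrightarrow> chained (s @ r) (map (\<lambda>(x, g, y). (x, g, y @ r)) ls)
     \<and> end_word (s @ r) (map (\<lambda>(x, g, y). (x, g, y @ r)) ls) = end_word s ls @ r"
proof (induction ls arbitrary: s)
  case (Cons l ls)
  obtain x g y where l: "l = (x, g, y)" by (cases l)
  then show ?case using Cons.prems Cons.IH[of "slice_top l"] by auto
qed simp

lemma chained_pad_left:
  "chained s ls \<Longrightarrow> chained (r @ s) (map (\<lambda>(x, g, y). (r @ x, g, y)) ls)
     \<and> end_word (r @ s) (map (\<lambda>(x, g, y). (r @ x, g, y)) ls) = r @ end_word s ls"
  by (induction ls arbitrary: s) auto

lemma id_web_words [simp]: "bot_word (id_web s) = s" "slices (id_web s) = []" "top_word (id_web s) = s"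
  by (simp_all add: bot_word_def slices_def top_word_def id_web_def Abs_web_inverse)

lemma elem_web_words [simp]:
  "bot_word (elem_web g) = elem_bot g" "slices (elem_web g) = [([], g, [])]"
  "top_word (elem_web g) = elem_top g"
  by (simp_all add: bot_word_def slices_def top_word_def elem_web_def Abs_web_inverse)

lemma stack_words:
  assumes "top_word v = bot_word w"
  shows "bot_word (stack w v) = bot_word v" "slices (stack w v) = slices v @ slices w"
    "top_word (stack w v) = top_word w"
proof -
  have "chained (bot_word v) (slices v @ slices w)"
    using assms chained_web[of v] chained_web[of w] by (simp add: chained_append top_word_def)
  then have "Rep_web (stack w v) = (bot_word v, slices v @ slices w)"
    by (simp add: stack_def Abs_web_inverse)
  then show "bot_word (stack w v) = bot_word v" "slices (stack w v) = slices v @ slices w"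
      "top_word (stack w v) = top_word w"
    using assms by (simp_all add: bot_word_def slices_def top_word_def end_word_append)
qed

lemma juxt_words:
  "bot_word (juxt v w) = bot_word v @ bot_word w"
  "slices (juxt v w) = map (\<lambda>(x, g, y). (x, g, y @ bot_word w)) (slices v) @
     map (\<lambda>(x, g, y). (top_word v @ x, g, y)) (slices w)"
  "top_word (juxt v w) = top_word v @ top_word w"
proof -
  let ?ls = "map (\<lambda>(x, g, y). (x, g, y @ bot_word w)) (slices v) @
     map (\<lambda>(x, g, y). (top_word v @ x, g, y)) (slices w)"
  note r = chained_pad_right[OF chained_web[of v], of "bot_word w"]
  note l = chained_pad_left[OF chained_web[of w], of "top_word v"]
  have "chained (bot_word v @ bot_word w) ?ls"
    using r l by (simp add: chained_append top_word_def)
  then have R: "Rep_web (juxt v w) = (bot_word v @ bot_word w, ?ls)"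
    by (simp add: juxt_def Abs_web_inverse)
  show b: "bot_word (juxt v w) = bot_word v @ bot_word w" and s: "slices (juxt v w) = ?ls"
    using R by (simp_all add: bot_word_def slices_def)
  show "top_word (juxt v w) = top_word v @ top_word w"
    unfolding top_word_def[of "juxt v w"] b s using r l by (simp add: end_word_append top_word_def)
qed


section \<open>Formal linear combinations of webs\<close>

type_synonym lincomb = "web \<Rightarrow>\<^sub>0 scalar"

definition of_web :: "web \<Rightarrow> lincomb" where
  "of_web w = Poly_Mapping.single w 1"

definition lscale :: "scalar \<Rightarrow> lincomb \<Rightarrow> lincomb" where
  "lscale c X = Poly_Mapping.map ((*) c) X"

definition bilinear_ext :: "(web \<Rightarrow> web \<Rightarrow> lincomb) \<Rightarrow> lincomb \<Rightarrow> lincomb \<Rightarrow> lincomb" where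
  "bilinear_ext F X Y = (\<Sum>x\<in>Poly_Mapping.keys X. \<Sum>y\<in>Poly_Mapping.keys Y.
     lscale (Poly_Mapping.lookup X x * Poly_Mapping.lookup Y y) (F x y))"

text \<open>Webs whose boundary words do not match compose to \<open>0\<close>.\<close>

definition lcomp :: "lincomb \<Rightarrow> lincomb \<Rightarrow> lincomb"  (infixr "\<circ>\<^sub>0" 55) where
  "lcomp = bilinear_ext (\<lambda>w v. if top_word v = bot_word w then of_web (stack w v) else 0)"

definition ltens :: "lincomb \<Rightarrow> lincomb \<Rightarrow> lincomb"  (infixr "\<otimes>\<^sub>0" 70) where
  "ltens = bilinear_ext (\<lambda>v w. of_web (juxt v w))"

abbreviation lid :: "word \<Rightarrow> lincomb" where
  "lid s \<equiv> of_web (id_web s)"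

abbreviation lelem :: "elem \<Rightarrow> lincomb" where
  "lelem g \<equiv> of_web (elem_web g)"

text \<open>The resolved crossing of a strand \<open>x\<close> from bottom left to top right with a strand \<open>y\<close> from bottom
  right to top left. For \<open>x = y\<close> the two incoming half-edges are both at the bottom or both at
  the top; for \<open>y = -x\<close> they are both on the left or both on the right. In either case they meet at a
  sink, the outgoing ones at a source, and the middle edge joins these two vertices.\<close>

definition lcrossing :: "sign \<Rightarrow> sign \<Rightarrow> lincomb" where
  "lcrossing x y =
     (if x = y then lelem (Split (- x)) \<circ>\<^sub>0 lelem (Merge x)
      else (lid [y] \<otimes>\<^sub>0 lelem (Merge y)) \<circ>\<^sub>0 (lelem (Split x) \<otimes>\<^sub>0 lid [y]))"


section \<open>Web spaces\<close>

text \<open>The first five families are the planar isotopies between webs in generic position: distant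
  slices exchange heights, edges can be straightened, and vertices can be rotated. They hold for all
  orientations. The last three families are the relations for loops, bigons and squares.\<close>

inductive_set relators :: "lincomb set" where
  exchange: "((lid (elem_top g @ m) \<otimes>\<^sub>0 lelem h) \<circ>\<^sub>0 (lelem g \<otimes>\<^sub>0 lid (m @ elem_bot h)))
     - ((lelem g \<otimes>\<^sub>0 lid (m @ elem_top h)) \<circ>\<^sub>0 (lid (elem_bot g @ m) \<otimes>\<^sub>0 lelem h)) \<in> relators"
| zigzag_left: "((lelem (Cap x) \<otimes>\<^sub>0 lid [x]) \<circ>\<^sub>0 (lid [x] \<otimes>\<^sub>0 lelem (Cup (- x)))) - lid [x] \<in> relators"
| zigzag_right: "((lid [x] \<otimes>\<^sub>0 lelem (Cap (- x))) \<circ>\<^sub>0 (lelem (Cup x) \<otimes>\<^sub>0 lid [x])) - lid [x] \<in> relators"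
| rotate_left: "((lid [- x] \<otimes>\<^sub>0 lelem (Merge x)) \<circ>\<^sub>0 (lelem (Cup (- x)) \<otimes>\<^sub>0 lid [x]))
     - lelem (Split x) \<in> relators"
| rotate_right: "((lelem (Merge x) \<otimes>\<^sub>0 lid [- x]) \<circ>\<^sub>0 (lid [x] \<otimes>\<^sub>0 lelem (Cup x)))
     - lelem (Split x) \<in> relators"
| loop: "(lelem (Cap x) \<circ>\<^sub>0 lelem (Cup x)) - lscale (qint 3) (lid []) \<in> relators"
| bigon: "(lelem (Merge (- x)) \<circ>\<^sub>0 lelem (Split x)) - lscale (- qint 2) (lid [x]) \<in> relators"
| square: "(lcrossing (- x) x \<circ>\<^sub>0 lcrossing x (- x))
     - (lid [x, - x] + (lelem (Cup x) \<circ>\<^sub>0 lelem (Cap x))) \<in> relators"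

text \<open>The relations may be applied locally inside any web.\<close>

inductive_set null :: "lincomb set" where
  relator: "r \<in> relators \<Longrightarrow> r \<in> null"
| zero: "0 \<in> null"
| add: "X \<in> null \<Longrightarrow> Y \<in> null \<Longrightarrow> X + Y \<in> null"
| scale: "X \<in> null \<Longrightarrow> lscale c X \<in> null"
| comp_left: "X \<in> null \<Longrightarrow> Y \<circ>\<^sub>0 X \<in> null"
| comp_right: "X \<in> null \<Longrightarrow> X \<circ>\<^sub>0 Y \<in> null"
| tens_left: "X \<in> null \<Longrightarrow> Y \<otimes>\<^sub>0 X \<in> null"
| tens_right: "X \<in> null \<Longrightarrow> X \<otimes>\<^sub>0 Y \<in> null"

lemma lookup_lscale [simp]: "Poly_Mapping.lookup (lscale c X) w = c * Poly_Mapping.lookup X w"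
  by (simp add: lscale_def Poly_Mapping.map.rep_eq when_def)

lemma lscale_0_left [simp]: "lscale 0 X = 0"
  by (rule poly_mapping_eqI) simp

lemma lscale_diff_left: "lscale (c - d) X = lscale c X - lscale d X"
  by (rule poly_mapping_eqI) (simp add: lookup_minus algebra_simps)

lemma lscale_diff_right: "lscale c (X - Y) = lscale c X - lscale c Y"
  by (rule poly_mapping_eqI) (simp add: lookup_minus algebra_simps)

lemma lscale_minus_one: "lscale (- 1) X = - X"
  by (rule poly_mapping_eqI) simp

lemma bilinear_ext_superset:
  assumes "finite A" "finite B" "Poly_Mapping.keys X \<subseteq> A" "Poly_Mapping.keys Y \<subseteq> B"
  shows "bilinear_ext F X Y = (\<Sum>x\<in>A. \<Sum>y\<in>B.
    lscale (Poly_Mapping.lookup X x * Poly_Mapping.lookup Y y) (F x y))"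
  unfolding bilinear_ext_def
proof (rule sum.mono_neutral_cong_left)
  show "finite A" "Poly_Mapping.keys X \<subseteq> A" by fact+
  show "\<forall>x\<in>A - Poly_Mapping.keys X.
      (\<Sum>y\<in>B. lscale (Poly_Mapping.lookup X x * Poly_Mapping.lookup Y y) (F x y)) = 0"
    by (simp add: in_keys_iff)
  show "(\<Sum>y\<in>Poly_Mapping.keys Y. lscale (Poly_Mapping.lookup X x * Poly_Mapping.lookup Y y) (F x y))
      = (\<Sum>y\<in>B. lscale (Poly_Mapping.lookup X x * Poly_Mapping.lookup Y y) (F x y))" for x
    using assms by (intro sum.mono_neutral_left) (auto simp: in_keys_iff)
qed

lemma bilinear_ext_diff_left:
  "bilinear_ext F (X - X') Y = bilinear_ext F X Y - bilinear_ext F X' Y"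
proof -
  let ?A = "Poly_Mapping.keys X \<union> Poly_Mapping.keys X'" and ?B = "Poly_Mapping.keys Y"
  have "Poly_Mapping.keys (X - X') \<subseteq> ?A"
    by (auto simp: in_keys_iff lookup_minus)
  then show ?thesis
    by (simp add: bilinear_ext_superset[where A = ?A and B = ?B] lookup_minus left_diff_distrib
        lscale_diff_left sum_subtractf)
qed

lemma bilinear_ext_diff_right:
  "bilinear_ext F X (Y - Y') = bilinear_ext F X Y - bilinear_ext F X Y'"
proof -
  let ?A = "Poly_Mapping.keys X" and ?B = "Poly_Mapping.keys Y \<union> Poly_Mapping.keys Y'"
  have "Poly_Mapping.keys (Y - Y') \<subseteq> ?B"
    by (auto simp: in_keys_iff lookup_minus)
  then show ?thesis
    by (simp add: bilinear_ext_superset[where A = ?A and B = ?B] lookup_minus right_diff_distrib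
        lscale_diff_left sum_subtractf)
qed

lemma null_uminus: "X \<in> null \<Longrightarrow> - X \<in> null"
  using null.scale[of X "- 1"] by (simp add: lscale_minus_one)

lemma null_diff: "X \<in> null \<Longrightarrow> Y \<in> null \<Longrightarrow> X - Y \<in> null"
  using null.add[OF _ null_uminus, of X Y] by simp

lemma null_comp:
  assumes "X - X' \<in> null" "Y - Y' \<in> null"
  shows "(X \<circ>\<^sub>0 Y) - (X' \<circ>\<^sub>0 Y') \<in> null"
proof -
  have "(X \<circ>\<^sub>0 Y) - (X' \<circ>\<^sub>0 Y') = ((X - X') \<circ>\<^sub>0 Y) + (X' \<circ>\<^sub>0 (Y - Y'))"
    by (simp add: lcomp_def bilinear_ext_diff_left bilinear_ext_diff_right)
  then show ?thesis
    using assms by (simp add: null.add null.comp_left null.comp_right)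
qed

lemma null_tens:
  assumes "X - X' \<in> null" "Y - Y' \<in> null"
  shows "(X \<otimes>\<^sub>0 Y) - (X' \<otimes>\<^sub>0 Y') \<in> null"
proof -
  have "(X \<otimes>\<^sub>0 Y) - (X' \<otimes>\<^sub>0 Y') = ((X - X') \<otimes>\<^sub>0 Y) + (X' \<otimes>\<^sub>0 (Y - Y'))"
    by (simp add: ltens_def bilinear_ext_diff_left bilinear_ext_diff_right)
  then show ?thesis
    using assms by (simp add: null.add null.tens_left null.tens_right)
qed

text \<open>The direct sum of the spaces \<open>Hom s t\<close> over all words \<open>s\<close> and \<open>t\<close>.\<close>

quotient_type skein = lincomb / "\<lambda>X Y. X - Y \<in> null"
proof (rule equivpI)
  show "reflp (\<lambda>X Y. X - Y \<in> null)"
    by (simp add: reflp_def null.zero)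
  show "symp (\<lambda>X Y. X - Y \<in> null)"
    unfolding symp_def using null_uminus by fastforce
  show "transp (\<lambda>X Y. X - Y \<in> null)"
  proof (rule transpI)
    fix X Y Z :: lincomb
    assume "X - Y \<in> null" "Y - Z \<in> null"
    then show "X - Z \<in> null" using null.add[of "X - Y" "Y - Z"] by simp
  qed
qed

instantiation skein :: ab_group_add
begin

lift_definition zero_skein :: skein is 0 .

lift_definition plus_skein :: "skein \<Rightarrow> skein \<Rightarrow> skein" is "(+)"
proof -
  fix X X' Y Y' :: lincomb
  assume "X - X' \<in> null" "Y - Y' \<in> null"
  then show "(X + Y) - (X' + Y') \<in> null"
    using null.add[of "X - X'" "Y - Y'"] by (simp add: add_diff_add)
qed

lift_definition uminus_skein :: "skein \<Rightarrow> skein" is uminus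
proof -
  fix X X' :: lincomb
  assume "X - X' \<in> null"
  then show "- X - - X' \<in> null" using null_uminus[of "X - X'"] by simp
qed

lift_definition minus_skein :: "skein \<Rightarrow> skein \<Rightarrow> skein" is "(-)"
proof -
  fix X X' Y Y' :: lincomb
  assume "X - X' \<in> null" "Y - Y' \<in> null"
  then show "(X - Y) - (X' - Y') \<in> null"
    using null_diff[of "X - X'" "Y - Y'"] by (simp add: algebra_simps)
qed

instance
  by standard (transfer, simp add: algebra_simps null.zero)+

end

lift_definition scale :: "scalar \<Rightarrow> skein \<Rightarrow> skein" is lscale
  by (metis lscale_diff_right null.scale)

lift_definition comp :: "skein \<Rightarrow> skein \<Rightarrow> skein"  (infixr "\<odot>" 68) is lcomp
  by (rule null_comp)

lift_definition tens :: "skein \<Rightarrow> skein \<Rightarrow> skein"  (infixr "\<otimes>" 70) is ltens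
  by (rule null_tens)

lift_definition ident :: "word \<Rightarrow> skein" is lid .

lift_definition elementary :: "elem \<Rightarrow> skein" is lelem .

lift_definition crossing :: "sign \<Rightarrow> sign \<Rightarrow> skein" is lcrossing .

definition Hom :: "word \<Rightarrow> word \<Rightarrow> skein set" where
  "Hom s t = abs_skein ` {X. \<forall>w\<in>Poly_Mapping.keys X. bot_word w = s \<and> top_word w = t}"


section \<open>Clasps\<close>

text \<open>Weights live in the weight lattice, not only in its dominant part: for instance
  \<open>(1, 1) \<succ> (2, -1) \<succ> (0, 0)\<close>.\<close>

definition weight :: "word \<Rightarrow> int \<times> int" where
  "weight s = (int (count_list s Plus), int (count_list s Minus))"

inductive weight_gt :: "int \<times> int \<Rightarrow> int \<times> int \<Rightarrow> bool"  (infix "\<succ>" 50) where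
  step1: "(a, b) \<succ> (a + 1, b - 2)"
| step2: "(a, b) \<succ> (a - 2, b + 1)"
| trans: "\<kappa> \<succ> \<mu> \<Longrightarrow> \<mu> \<succ> \<nu> \<Longrightarrow> \<kappa> \<succ> \<nu>"

definition is_clasp :: "word \<Rightarrow> skein \<Rightarrow> bool" where
  "is_clasp s P \<longleftrightarrow>
     P \<in> Hom s s \<and> P \<noteq> 0 \<and> P \<odot> P = P \<and>
     (\<forall>t. weight s \<succ> weight t \<longrightarrow>
        (\<forall>w\<in>Hom s t. w \<odot> P = 0) \<and> (\<forall>w\<in>Hom t s. P \<odot> w = 0))"

text \<open>\<open>is_nonseg_clasp s t P\<close>: \<open>P\<close> is the non-segregated clasp in \<open>Hom s t\<close>, i.e. the one written
  $P_{t,s}$, obtained by some sequence of resolved crossings.\<close>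

inductive is_nonseg_clasp :: "word \<Rightarrow> word \<Rightarrow> skein \<Rightarrow> bool" for s where
  clasp: "is_clasp s P \<Longrightarrow> is_nonseg_clasp s s P"
| cross: "is_nonseg_clasp s (u @ [x, - x] @ v) P \<Longrightarrow>
    is_nonseg_clasp s (u @ [- x, x] @ v) ((ident u \<otimes> crossing x (- x) \<otimes> ident v) \<odot> P)"


section \<open>The webs \<open>E i j\<close>\<close>

text \<open>A strand \<open>x\<close> that starts at the left of the vertical strands \<open>w\<close> and crosses them one after the
  other, from left to right.\<close>

fun sweep :: "sign \<Rightarrow> word \<Rightarrow> skein" where
  "sweep x [] = ident [x]"
| "sweep x (y # w) = (ident [y] \<otimes> sweep x w) \<odot> (crossing x y \<otimes> ident w)"

text \<open>The arc has its lowest point immediately to the right of \<open>v\<^bsub>b-i\<^esub>\<close>; from there it goes upwards and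
  to the right through \<open>i - 1\<close> downward and \<open>j\<close> upward strands. The parameters are meant to
  satisfy \<open>1 \<le> i \<le> b\<close> and \<open>j \<le> a\<close>.\<close>

definition E_web :: "nat \<Rightarrow> nat \<Rightarrow> nat \<Rightarrow> nat \<Rightarrow> skein" where
  "E_web a b i j =
     (ident (replicate (b - i) Minus @ [Minus])
        \<otimes> sweep Plus (replicate (i - 1) Minus @ replicate j Plus)
        \<otimes> ident (replicate (a - j) Plus))
     \<odot> (ident (replicate (b - i) Minus)
        \<otimes> elementary (Cup Minus)
        \<otimes> ident (replicate (i - 1) Minus @ replicate a Plus))"

end

theory Submission
  imports Defs
begin

text \<open>Every web with bottom word \<open>s\<close> is a linear combination of webs that start with a cap or a
  merge (possibly preceded by crossings) and of webs without caps and merges. The latter never lower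
  the weight, and those that preserve it are chains of resolved crossings, any two of which with the
  same ends agree modulo webs through a smaller weight. Hence a clasp is the identity modulo such
  webs, and a non-segregated clasp is the only element that is congruent to a chain of crossings and
  that is annihilated, at its segregated end, by caps and merges. Bend the last strand of the right-hand
  side down. Exactly one summand, \<open>i = 1\<close> and \<open>j = a\<close>, becomes a chain of crossings and its
  coefficient is \<open>1\<close>; all others factor through a smaller weight. On top of the sum, a merge
  leaves three consecutive terms, which cancel by \<open>[n + 2] - [2] [n + 1] + [n] = 0\<close>, and the cap leaves
  four terms, with \<open>i \<le> 2\<close> and \<open>j \<le> 1\<close>, whose coefficients also add up to \<open>0\<close>.\<close>

section \<open>The linear monoidal category of webs\<close>

text \<open>Only spanning sets of webs are used, never a basis; the single input about nonvanishing
  of webs is that a clasp is nonzero. The obstacle is that a lowering web need not start with a bare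
  merge: two strands may merge across strands of the opposite sign between them. Such a start needs
  letters x, -x, x in this order, which no segregated word contains. This is why annihilation by
  bare merges and caps at the segregated end is as strong as annihilation by all lowering webs. The
  coefficients are forced. Write them as f(b - i) g(j). Merges of minus strands give the three-term
  recurrence for f with f(-1) = 0, so f(p) is proportional to [p + 1]. The cap then gives g(1) /
  g(0) = [b + 2] / [b + 1], and merges of plus strands continue this to g(j) proportional to
  [b + j + 1]. The denominator makes the coefficient of the chain of crossings equal to 1. Bending
  matters because the clasp on the left-hand side leaves out the last strand: bent down, the
  left-hand side is the clasp itself, to which uniqueness applies.\<close>

lift_definition web_skein :: "web \<Rightarrow> skein" is of_web .

section \<open>Bilinearity of composition and juxtaposition\<close>

lemma lscale_add_right: "lscale c (X + Y) = lscale c X + lscale c Y"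
  by (rule poly_mapping_eqI) (simp add: lookup_add algebra_simps)

lemma lscale_add_left: "lscale (c + d) X = lscale c X + lscale d X"
  by (rule poly_mapping_eqI) (simp add: lookup_add algebra_simps)

lemma lscale_lscale: "lscale c (lscale d X) = lscale (c * d) X"
  by (rule poly_mapping_eqI) simp

lemma lscale_sum: "lscale c (sum f A) = (\<Sum>x\<in>A. lscale c (f x))"
  by (induction A rule: infinite_finite_induct) (auto simp: lscale_add_right intro: poly_mapping_eqI)

lemma bilinear_ext_0 [simp]: "bilinear_ext F 0 Y = 0" "bilinear_ext F X 0 = 0"
  by (simp_all add: bilinear_ext_def)

lemma bilinear_ext_add_left: "bilinear_ext F (X + X') Y = bilinear_ext F X Y + bilinear_ext F X' Y"
  using bilinear_ext_diff_left[of F "X + X'" X' Y] by simp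

lemma bilinear_ext_add_right: "bilinear_ext F X (Y + Y') = bilinear_ext F X Y + bilinear_ext F X Y'"
  using bilinear_ext_diff_right[of F X "Y + Y'" Y'] by simp

lemma bilinear_ext_scale_left: "bilinear_ext F (lscale c X) Y = lscale c (bilinear_ext F X Y)"
proof -
  have "Poly_Mapping.keys (lscale c X) \<subseteq> Poly_Mapping.keys X"
    by (auto simp: in_keys_iff)
  then have "bilinear_ext F (lscale c X) Y =
    (\<Sum>x\<in>Poly_Mapping.keys X. \<Sum>y\<in>Poly_Mapping.keys Y.
      lscale (Poly_Mapping.lookup (lscale c X) x * Poly_Mapping.lookup Y y) (F x y))"
    by (intro bilinear_ext_superset) auto
  then show ?thesis
    by (simp add: bilinear_ext_def lscale_sum lscale_lscale mult.assoc)
qed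

lemma bilinear_ext_scale_right: "bilinear_ext F X (lscale c Y) = lscale c (bilinear_ext F X Y)"
proof -
  have "Poly_Mapping.keys (lscale c Y) \<subseteq> Poly_Mapping.keys Y"
    by (auto simp: in_keys_iff)
  then have "bilinear_ext F X (lscale c Y) =
    (\<Sum>x\<in>Poly_Mapping.keys X. \<Sum>y\<in>Poly_Mapping.keys Y.
      lscale (Poly_Mapping.lookup X x * Poly_Mapping.lookup (lscale c Y) y) (F x y))"
    by (intro bilinear_ext_superset) auto
  then show ?thesis
    by (simp add: bilinear_ext_def lscale_sum lscale_lscale mult_ac)
qed

lemma bilinear_ext_of_web: "bilinear_ext F (of_web v) (of_web w) = F v w"
  by (simp add: bilinear_ext_def of_web_def) (rule poly_mapping_eqI, simp)

lemma comp_add_left: "(A + B) \<odot> C = A \<odot> C + B \<odot> C"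
  by transfer (simp add: lcomp_def bilinear_ext_add_left null.zero)

lemma comp_add_right: "C \<odot> (A + B) = C \<odot> A + C \<odot> B"
  by transfer (simp add: lcomp_def bilinear_ext_add_right null.zero)

lemma comp_zero [simp]: "0 \<odot> C = 0" "C \<odot> 0 = 0"
  by (transfer, simp add: lcomp_def null.zero)+

lemma comp_scale_left: "scale c A \<odot> B = scale c (A \<odot> B)"
  by transfer (simp add: lcomp_def bilinear_ext_scale_left null.zero)

lemma comp_scale_right: "A \<odot> scale c B = scale c (A \<odot> B)"
  by transfer (simp add: lcomp_def bilinear_ext_scale_right null.zero)

lemma tens_add_left: "(A + B) \<otimes> C = A \<otimes> C + B \<otimes> C"
  by transfer (simp add: ltens_def bilinear_ext_add_left null.zero)

lemma tens_add_right: "C \<otimes> (A + B) = C \<otimes> A + C \<otimes> B"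
  by transfer (simp add: ltens_def bilinear_ext_add_right null.zero)

lemma tens_zero [simp]: "0 \<otimes> C = 0" "C \<otimes> 0 = 0"
  by (transfer, simp add: ltens_def null.zero)+

lemma tens_scale_left: "scale c A \<otimes> B = scale c (A \<otimes> B)"
  by transfer (simp add: ltens_def bilinear_ext_scale_left null.zero)

lemma tens_scale_right: "A \<otimes> scale c B = scale c (A \<otimes> B)"
  by transfer (simp add: ltens_def bilinear_ext_scale_right null.zero)

lemma scale_scale [simp]: "scale c (scale d A) = scale (c * d) A"
  by transfer (simp add: lscale_lscale null.zero)

lemma scale_one [simp]: "scale 1 A = A"
proof (induction A rule: skein.abs_induct)
  case (1 X)
  have "lscale 1 X = X" by (rule poly_mapping_eqI) simp
  then show ?case by (simp add: scale.abs_eq)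
qed

lemma scale_zero_left [simp]: "scale 0 A = 0"
  by transfer (simp add: null.zero)

lemma scale_zero_right [simp]: "scale c 0 = 0"
  using scale_scale[of c 0 0] by (simp del: scale_scale)

lemma scale_add_right: "scale c (A + B) = scale c A + scale c B"
  by transfer (simp add: lscale_add_right null.zero)

lemma scale_add_left: "scale (c + d) A = scale c A + scale d A"
  by transfer (simp add: lscale_add_left null.zero)

lemma scale_minus_one: "scale (- 1) A = - A"
  by transfer (simp add: lscale_minus_one null.zero)

lemma comp_sum_right: "B \<odot> sum f I = (\<Sum>i\<in>I. B \<odot> f i)"
  by (induction I rule: infinite_finite_induct) (auto simp: comp_add_right)

lemma tens_sum_left: "sum f I \<otimes> B = (\<Sum>i\<in>I. f i \<otimes> B)"
  by (induction I rule: infinite_finite_induct) (auto simp: tens_add_left)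

lemma comp_web_skein: "web_skein w \<odot> web_skein v =
    (if top_word v = bot_word w then web_skein (stack w v) else 0)"
  by transfer (simp add: lcomp_def bilinear_ext_of_web null.zero)

lemma tens_web_skein: "web_skein v \<otimes> web_skein w = web_skein (juxt v w)"
  by transfer (simp add: ltens_def bilinear_ext_of_web null.zero)

lemma ident_web: "ident s = web_skein (id_web s)"
  by transfer (simp add: null.zero)

lemma elementary_web: "elementary g = web_skein (elem_web g)"
  by transfer (simp add: null.zero)

lemma lincomb_sum: "X = (\<Sum>w\<in>Poly_Mapping.keys X. lscale (Poly_Mapping.lookup X w) (of_web w))"
  by (rule poly_mapping_eqI)
    (auto simp: of_web_def lookup_sum lookup_single when_def in_keys_iff if_distrib cong: if_cong)

lemma abs_skein_sum: "finite A \<Longrightarrow> abs_skein (sum f A) = (\<Sum>x\<in>A. abs_skein (f x))"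
  by (induction A rule: finite_induct) (simp_all add: zero_skein_def flip: plus_skein.abs_eq)

text \<open>Since every element is a finite combination of webs, a property that is closed under
  sums and multiples has to be checked on webs only. The induction rules \<open>Hom_induct\<close>
  and \<open>skein_induct\<close> rest on this.\<close>

lemma abs_skein_eq: "abs_skein X =
    (\<Sum>w\<in>Poly_Mapping.keys X. scale (Poly_Mapping.lookup X w) (web_skein w))"
  by (subst lincomb_sum)
    (simp add: abs_skein_sum scale.abs_eq web_skein.abs_eq)

section \<open>Spaces of webs with prescribed ends\<close>

lemma Hom_zero [simp]: "0 \<in> Hom s t"
  by (auto simp: Hom_def zero_skein_def intro!: image_eqI[of _ _ 0])

lemma Hom_add: "A \<in> Hom s t \<Longrightarrow> B \<in> Hom s t \<Longrightarrow> A + B \<in> Hom s t"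
proof -
  assume "A \<in> Hom s t" "B \<in> Hom s t"
  then obtain X Y where X: "A = abs_skein X" "\<forall>w\<in>Poly_Mapping.keys X. bot_word w = s \<and> top_word w = t"
    and Y: "B = abs_skein Y" "\<forall>w\<in>Poly_Mapping.keys Y. bot_word w = s \<and> top_word w = t"
    by (auto simp: Hom_def)
  have "\<forall>w\<in>Poly_Mapping.keys (X + Y). bot_word w = s \<and> top_word w = t"
    using X(2) Y(2) Poly_Mapping.keys_add[of X Y] by blast
  then show ?thesis
    unfolding Hom_def by (auto simp: X Y plus_skein.abs_eq intro!: image_eqI[of _ _ "X + Y"])
qed

lemma Hom_scale: "A \<in> Hom s t \<Longrightarrow> scale c A \<in> Hom s t"
proof -
  assume "A \<in> Hom s t"
  then obtain X where X: "A = abs_skein X" "\<forall>w\<in>Poly_Mapping.keys X. bot_word w = s \<and> top_word w = t"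
    by (auto simp: Hom_def)
  then show ?thesis
    unfolding Hom_def by (auto simp: X scale.abs_eq in_keys_iff intro!: image_eqI[of _ _ "lscale c X"])
qed

lemma Hom_uminus: "A \<in> Hom s t \<Longrightarrow> - A \<in> Hom s t"
  using Hom_scale[of A s t "- 1"] by (simp add: scale_minus_one)

lemma Hom_diff: "A \<in> Hom s t \<Longrightarrow> B \<in> Hom s t \<Longrightarrow> A - B \<in> Hom s t"
  using Hom_add[OF _ Hom_uminus, of A s t B] by simp

lemma Hom_sum: "(\<And>i. i \<in> I \<Longrightarrow> f i \<in> Hom s t) \<Longrightarrow> sum f I \<in> Hom s t"
  by (induction I rule: infinite_finite_induct) (auto intro: Hom_add)

lemma Hom_web_skein: "bot_word w = s \<Longrightarrow> top_word w = t \<Longrightarrow> web_skein w \<in> Hom s t"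
  by (auto simp: Hom_def web_skein.abs_eq of_web_def intro!: image_eqI[of _ _ "of_web w"])

lemma Hom_ident [simp]: "ident s \<in> Hom s s"
  by (simp add: ident_web Hom_web_skein)

lemma Hom_elementary: "elementary g \<in> Hom (elem_bot g) (elem_top g)"
  by (simp add: elementary_web Hom_web_skein)

lemma Hom_induct [consumes 1, case_names zero add scale web]:
  assumes A: "A \<in> Hom s t" and z: "P 0" and a: "\<And>A B. P A \<Longrightarrow> P B \<Longrightarrow> P (A + B)"
    and s: "\<And>c A. P A \<Longrightarrow> P (scale c A)"
    and w: "\<And>w. bot_word w = s \<Longrightarrow> top_word w = t \<Longrightarrow> P (web_skein w)"
  shows "P A"
proof -
  obtain X where X: "A = abs_skein X" "\<forall>w\<in>Poly_Mapping.keys X. bot_word w = s \<and> top_word w = t"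
    using A by (auto simp: Hom_def)
  have sum: "finite I \<Longrightarrow> (\<forall>i\<in>I. P (f i)) \<Longrightarrow> P (sum f I)" for I :: "web set" and f
    by (induction I rule: finite_induct) (auto intro: z a)
  show ?thesis
    unfolding X(1) abs_skein_eq using X(2) by (auto intro!: sum s w)
qed

lemma skein_induct [case_names zero add scale web]:
  assumes z: "P 0" and a: "\<And>A B. P A \<Longrightarrow> P B \<Longrightarrow> P (A + B)"
    and s: "\<And>c A. P A \<Longrightarrow> P (scale c A)" and w: "\<And>w. P (web_skein w)"
  shows "P A"
proof -
  obtain X where X: "A = abs_skein X"
    by (induction A rule: skein.abs_induct) blast
  have sum: "finite I \<Longrightarrow> (\<forall>i\<in>I. P (f i)) \<Longrightarrow> P (sum f I)" for I :: "web set" and f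
    by (induction I rule: finite_induct) (auto intro: z a)
  show ?thesis
    unfolding X abs_skein_eq by (auto intro!: sum s w)
qed

lemma web_eqI: "bot_word v = bot_word w \<Longrightarrow> slices v = slices w \<Longrightarrow> v = w"
  unfolding bot_word_def slices_def by (metis Rep_web_inject prod_eqI)

lemma Hom_comp: "A \<in> Hom s t \<Longrightarrow> B \<in> Hom t u \<Longrightarrow> B \<odot> A \<in> Hom s u"
proof (induction A rule: Hom_induct)
  case (web w)
  from web(3,1,2) show ?case
  proof (induction B rule: Hom_induct)
    case (web w')
    then show ?case by (simp add: comp_web_skein Hom_web_skein stack_words)
  qed (auto simp: comp_add_left comp_scale_left intro: Hom_add Hom_scale)
qed (auto simp: comp_add_right comp_scale_right intro: Hom_add Hom_scale)

lemma Hom_tens: "A \<in> Hom s t \<Longrightarrow> B \<in> Hom s' t' \<Longrightarrow> A \<otimes> B \<in> Hom (s @ s') (t @ t')"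
proof (induction A rule: Hom_induct)
  case (web w)
  from web(3,1,2) show ?case
  proof (induction B rule: Hom_induct)
    case (web w')
    then show ?case by (simp add: tens_web_skein Hom_web_skein juxt_words)
  qed (auto simp: tens_add_right tens_scale_right intro: Hom_add Hom_scale)
qed (auto simp: tens_add_left tens_scale_left intro: Hom_add Hom_scale)

section \<open>Axioms of a monoidal category\<close>

lemma comp_assoc: "(A \<odot> B) \<odot> C = A \<odot> (B \<odot> C)"
proof (induction A rule: skein_induct)
  case (web a)
  show ?case
  proof (induction B rule: skein_induct)
    case (web b)
    show ?case
    proof (induction C rule: skein_induct)
      case (web c)
      show ?case
        by (auto simp: comp_web_skein stack_words intro!: arg_cong[of _ _ web_skein] web_eqI)
    qed (simp_all add: comp_add_right comp_scale_right)
  qed (simp_all add: comp_add_left comp_scale_left comp_add_right comp_scale_right)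
qed (simp_all add: comp_add_left comp_scale_left)

lemma tens_assoc: "(A \<otimes> B) \<otimes> C = A \<otimes> (B \<otimes> C)"
proof (induction A rule: skein_induct)
  case (web a)
  show ?case
  proof (induction B rule: skein_induct)
    case (web b)
    show ?case
    proof (induction C rule: skein_induct)
      case (web c)
      show ?case
        by (auto simp: tens_web_skein juxt_words case_prod_unfold comp_def
            intro!: arg_cong[of _ _ web_skein] web_eqI)
    qed (simp_all add: tens_add_right tens_scale_right)
  qed (simp_all add: tens_add_left tens_scale_left tens_add_right tens_scale_right)
qed (simp_all add: tens_add_left tens_scale_left)

lemma ident_tens_ident [simp]: "ident u \<otimes> ident v = ident (u @ v)"
  by (simp add: ident_web tens_web_skein)
    (intro arg_cong[of _ _ web_skein] web_eqI, simp_all add: juxt_words)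

lemma ident_tens_ident_tens [simp]: "ident u \<otimes> (ident v \<otimes> A) = ident (u @ v) \<otimes> A"
  by (simp flip: tens_assoc)

lemma ident_Nil_tens [simp]: "ident [] \<otimes> A = A"
proof (induction A rule: skein_induct)
  case (web w)
  show ?case
    by (simp add: ident_web tens_web_skein)
      (intro arg_cong[of _ _ web_skein] web_eqI, simp_all add: juxt_words)
qed (simp_all add: tens_add_right tens_scale_right)

lemma tens_ident_Nil [simp]: "A \<otimes> ident [] = A"
proof (induction A rule: skein_induct)
  case (web w)
  show ?case
    by (simp add: ident_web tens_web_skein)
      (intro arg_cong[of _ _ web_skein] web_eqI, simp_all add: juxt_words)
qed (simp_all add: tens_add_left tens_scale_left)

lemma ident_comp: "A \<in> Hom s t \<Longrightarrow> ident t \<odot> A = A"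
proof (induction A rule: Hom_induct)
  case (web w)
  then show ?case
    by (simp add: ident_web comp_web_skein)
      (intro arg_cong[of _ _ web_skein] web_eqI, simp_all add: stack_words)
qed (simp_all add: comp_add_right comp_scale_right)

lemma comp_ident: "A \<in> Hom s t \<Longrightarrow> A \<odot> ident s = A"
proof (induction A rule: Hom_induct)
  case (web w)
  then show ?case
    by (simp add: ident_web comp_web_skein)
      (intro arg_cong[of _ _ web_skein] web_eqI, simp_all add: stack_words)
qed (simp_all add: comp_add_left comp_scale_left)

text \<open>Padding every slice by \<open>u\<close> commutes with concatenating slice lists, so on
  webs both sides are literally equal. For two nontrivial factors \<open>juxt\<close> draws the left
  one below the right one, and the interchange law holds only modulo exchange of heights, see
  \<open>exchange\<close>.\<close>

lemma ident_tens_comp: "ident u \<otimes> (A \<odot> B) = (ident u \<otimes> A) \<odot> (ident u \<otimes> B)"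
proof (induction A rule: skein_induct)
  case (web a)
  show ?case
  proof (induction B rule: skein_induct)
    case (web b)
    show ?case
      by (auto simp: comp_web_skein tens_web_skein ident_web stack_words juxt_words
          intro!: arg_cong[of _ _ web_skein] web_eqI)
  qed (simp_all add: tens_add_right tens_scale_right comp_add_right comp_scale_right)
qed (simp_all add: tens_add_right tens_scale_right comp_add_left comp_scale_left)

lemma comp_tens_ident: "(A \<odot> B) \<otimes> ident v = (A \<otimes> ident v) \<odot> (B \<otimes> ident v)"
proof (induction A rule: skein_induct)
  case (web a)
  show ?case
  proof (induction B rule: skein_induct)
    case (web b)
    show ?case
      by (auto simp: comp_web_skein tens_web_skein ident_web stack_words juxt_words
          intro!: arg_cong[of _ _ web_skein] web_eqI)
  qed (simp_all add: tens_add_left tens_scale_left comp_add_right comp_scale_right)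
qed (simp_all add: tens_add_left tens_scale_left comp_add_left comp_scale_left)

lemma Hom_slice: "ident u \<otimes> elementary g \<otimes> ident v \<in> Hom (u @ elem_bot g @ v) (u @ elem_top g @ v)"
  by (intro Hom_tens Hom_ident Hom_elementary)

text \<open>The last slice of the list is the topmost one, so reversed list induction adds
  elementary pieces on top.\<close>

lemma web_slice_induct [case_names ident slice]:
  assumes id: "\<And>s. P s s (ident s)"
    and step: "\<And>s u g v A. A \<in> Hom s (u @ elem_bot g @ v) \<Longrightarrow> P s (u @ elem_bot g @ v) A \<Longrightarrow>
      P s (u @ elem_top g @ v) ((ident u \<otimes> elementary g \<otimes> ident v) \<odot> A)"
  shows "P (bot_word w) (top_word w) (web_skein w)"
proof -
  have "chained s ls \<Longrightarrow> P s (end_word s ls) (web_skein (Abs_web (s, ls)))" for s ls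
  proof (induction ls rule: rev_induct)
    case Nil
    then show ?case using id[of s] by (simp add: ident_web id_web_def)
  next
    case (snoc l ls)
    obtain u g v where l: "l = (u, g, v)" by (cases l)
    let ?w = "Abs_web (s, ls)" and ?l = "juxt (id_web u) (juxt (elem_web g) (id_web v))"
    from snoc.prems have c: "chained s ls" and e: "end_word s ls = u @ elem_bot g @ v"
      by (simp_all add: chained_append l)
    have w: "bot_word ?w = s" "slices ?w = ls" "top_word ?w = u @ elem_bot g @ v"
      using c e by (simp_all add: bot_word_def slices_def top_word_def Abs_web_inverse)
    have "Abs_web (s, ls @ [l]) = stack ?l ?w"
      using snoc.prems
    proof (intro web_eqI)
      show "bot_word (Abs_web (s, ls @ [l])) = bot_word (stack ?l ?w)"
        using snoc.prems by (simp add: stack_words juxt_words w)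
          (simp add: bot_word_def Abs_web_inverse)
      show "slices (Abs_web (s, ls @ [l])) = slices (stack ?l ?w)"
        using snoc.prems by (simp add: stack_words juxt_words w l)
          (simp add: slices_def Abs_web_inverse)
    qed
    then have "web_skein (Abs_web (s, ls @ [l])) = (ident u \<otimes> elementary g \<otimes> ident v) \<odot> web_skein ?w"
      by (simp add: ident_web elementary_web tens_web_skein comp_web_skein juxt_words w)
    then show ?case
      using step[of "web_skein ?w" s u g v] snoc.IH[OF c] e w
      by (simp add: Hom_web_skein end_word_append l)
  qed
  from this[of "bot_word w" "slices w"] show ?thesis
    using chained_web[of w] by (simp add: top_word_def bot_word_def slices_def Rep_web_inverse)
qed

lemma Hom_slice_induct [consumes 1, case_names zero add scale ident slice]:
  assumes "A \<in> Hom s t"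
    and "\<And>s t. P s t 0" "\<And>s t A B. P s t A \<Longrightarrow> P s t B \<Longrightarrow> P s t (A + B)"
    and "\<And>s t c A. P s t A \<Longrightarrow> P s t (scale c A)"
    and "\<And>s. P s s (ident s)"
    and "\<And>s u g v A. A \<in> Hom s (u @ elem_bot g @ v) \<Longrightarrow> P s (u @ elem_bot g @ v) A \<Longrightarrow>
      P s (u @ elem_top g @ v) ((ident u \<otimes> elementary g \<otimes> ident v) \<odot> A)"
  shows "P s t A"
  using assms(1)
proof (induction A rule: Hom_induct)
  case (web w)
  then show ?case using web_slice_induct[of P w] assms(5,6) by blast
qed (use assms in blast)+

lemma elementary_exchange:
  "(ident (elem_top g @ m) \<otimes> elementary h) \<odot> (elementary g \<otimes> ident (m @ elem_bot h)) =
   (elementary g \<otimes> ident (m @ elem_top h)) \<odot> (ident (elem_bot g @ m) \<otimes> elementary h)"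
  by transfer (rule null.relator, rule relators.exchange)

lemma slice_exchange:
  "(ident (u @ elem_top g @ v) \<otimes> ident u' \<otimes> elementary h \<otimes> ident v') \<odot>
     ((ident u \<otimes> elementary g \<otimes> ident v) \<otimes> ident (u' @ elem_bot h @ v')) =
   ((ident u \<otimes> elementary g \<otimes> ident v) \<otimes> ident (u' @ elem_top h @ v')) \<odot>
     (ident (u @ elem_bot g @ v) \<otimes> ident u' \<otimes> elementary h \<otimes> ident v')"
proof -
  have "ident u \<otimes> ((ident (elem_top g @ v @ u') \<otimes> elementary h) \<odot>
      (elementary g \<otimes> ident ((v @ u') @ elem_bot h))) \<otimes> ident v' =
    ident u \<otimes> ((elementary g \<otimes> ident ((v @ u') @ elem_top h)) \<odot>
      (ident (elem_bot g @ v @ u') \<otimes> elementary h)) \<otimes> ident v'"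
    using elementary_exchange[of g "v @ u'" h] by simp
  then show ?thesis
    by (simp add: ident_tens_comp comp_tens_ident tens_assoc)
qed

text \<open>The relator exchanges two elementary pieces. It extends to \<open>B\<close> by adding
  slices of \<open>B\<close> over a fixed slice \<open>g\<close>, and then to \<open>A\<close> by
  adding slices of \<open>A\<close>.\<close>

lemma exchange:
  assumes "A \<in> Hom s t" "B \<in> Hom s' t'"
  shows "(ident t \<otimes> B) \<odot> (A \<otimes> ident s') = (A \<otimes> ident t') \<odot> (ident s \<otimes> B)"
proof -
  have comm: "(ident (u @ elem_top g @ v) \<otimes> B) \<odot> ((ident u \<otimes> elementary g \<otimes> ident v) \<otimes> ident s') =
      ((ident u \<otimes> elementary g \<otimes> ident v) \<otimes> ident t') \<odot> (ident (u @ elem_bot g @ v) \<otimes> B)" for u g v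
    using assms(2)
  proof (induction B rule: Hom_slice_induct)
    case (ident s)
    show ?case
      using Hom_tens[OF Hom_slice Hom_ident, of u g v s] by (simp add: ident_comp comp_ident)
  next
    case (slice s u' h v' B)
    let ?g = "ident u \<otimes> elementary g \<otimes> ident v" and ?h = "ident u' \<otimes> elementary h \<otimes> ident v'"
    have "(ident (u @ elem_top g @ v) \<otimes> (?h \<odot> B)) \<odot> (?g \<otimes> ident s) =
        (ident (u @ elem_top g @ v) \<otimes> ?h) \<odot> (?g \<otimes> ident (u' @ elem_bot h @ v')) \<odot>
          (ident (u @ elem_bot g @ v) \<otimes> B)"
      by (simp add: ident_tens_comp comp_assoc slice.IH)
    also have "\<dots> = (?g \<otimes> ident (u' @ elem_top h @ v')) \<odot>
          (ident (u @ elem_bot g @ v) \<otimes> ?h) \<odot> (ident (u @ elem_bot g @ v) \<otimes> B)"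
      by (simp only: slice_exchange flip: comp_assoc)
    finally show ?case by (simp add: ident_tens_comp)
  qed (simp_all add: tens_add_right tens_scale_right comp_add_left comp_scale_left
      comp_add_right comp_scale_right)
  show ?thesis
    using assms(1)
  proof (induction A rule: Hom_slice_induct)
    case (ident s)
    show ?case
      using Hom_tens[OF Hom_ident assms(2), of s] by (simp add: ident_comp comp_ident)
  next
    case (slice s u g v A)
    let ?g = "ident u \<otimes> elementary g \<otimes> ident v"
    have "(ident (u @ elem_top g @ v) \<otimes> B) \<odot> ((?g \<odot> A) \<otimes> ident s') =
       ((?g \<otimes> ident t') \<odot> (ident (u @ elem_bot g @ v) \<otimes> B)) \<odot> (A \<otimes> ident s')"
      by (simp add: comp_tens_ident comm flip: comp_assoc)
    also have "\<dots> = (?g \<otimes> ident t') \<odot> (A \<otimes> ident t') \<odot> (ident s \<otimes> B)"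
      by (simp add: comp_assoc slice.IH)
    finally show ?case by (simp add: comp_tens_ident comp_assoc)
  qed (simp_all add: tens_add_left tens_scale_left comp_add_left comp_scale_left
      comp_add_right comp_scale_right)
qed

section \<open>Local relations\<close>

lemma uminus_uminus_sign [simp]: "- (- x) = (x :: sign)"
  by (cases x) simp_all

lemma uminus_neq_sign [simp]: "- x \<noteq> (x :: sign)" "x \<noteq> - x"
  by (cases x; simp)+

lemma sign_neq_iff: "x \<noteq> y \<longleftrightarrow> y = - (x :: sign)"
  by (cases x; cases y) simp_all

abbreviation cup :: "sign \<Rightarrow> skein" where "cup x \<equiv> elementary (Cup x)"
abbreviation cap :: "sign \<Rightarrow> skein" where "cap x \<equiv> elementary (Cap x)"
abbreviation merge :: "sign \<Rightarrow> skein" where "merge x \<equiv> elementary (Merge x)"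
abbreviation fork :: "sign \<Rightarrow> skein" where "fork x \<equiv> elementary (Split x)"

lemma Hom_compI: "A \<in> Hom s t \<Longrightarrow> B \<in> Hom t' u \<Longrightarrow> t = t' \<Longrightarrow> B \<odot> A \<in> Hom s u"
  by (auto intro: Hom_comp)

lemma Hom_tensI:
  "A \<in> Hom s t \<Longrightarrow> B \<in> Hom s' t' \<Longrightarrow> u = s @ s' \<Longrightarrow> v = t @ t' \<Longrightarrow> A \<otimes> B \<in> Hom u v"
  by (auto intro: Hom_tens)

lemma Hom_identI: "s = t \<Longrightarrow> ident s \<in> Hom s t"
  by simp

lemma Hom_elementaryI: "s = elem_bot g \<Longrightarrow> t = elem_top g \<Longrightarrow> elementary g \<in> Hom s t"
  by (simp add: Hom_elementary)

lemmas Hom_intros = Hom_compI Hom_tensI Hom_identI Hom_elementaryI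

lemma crossing_same: "crossing x x = fork (- x) \<odot> merge x"
  by transfer (simp add: lcrossing_def null.zero)

lemma crossing_opposite: "crossing x (- x) = (ident [- x] \<otimes> merge (- x)) \<odot> (fork x \<otimes> ident [- x])"
  by transfer (simp add: lcrossing_def null.zero)

lemma zigzag_left: "(cap x \<otimes> ident [x]) \<odot> (ident [x] \<otimes> cup (- x)) = ident [x]"
  by transfer (rule null.relator, rule relators.zigzag_left)

lemma zigzag_right: "(ident [x] \<otimes> cap (- x)) \<odot> (cup x \<otimes> ident [x]) = ident [x]"
  by transfer (rule null.relator, rule relators.zigzag_right)

lemma rotate_left: "(ident [- x] \<otimes> merge x) \<odot> (cup (- x) \<otimes> ident [x]) = fork x"
  by transfer (rule null.relator, rule relators.rotate_left)

lemma rotate_right: "(merge x \<otimes> ident [- x]) \<odot> (ident [x] \<otimes> cup x) = fork x"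
  by transfer (rule null.relator, rule relators.rotate_right)

lemma cap_cup: "cap x \<odot> cup x = scale (qint 3) (ident [])"
  by transfer (rule null.relator, rule relators.loop)

lemma merge_fork: "merge (- x) \<odot> fork x = scale (- qint 2) (ident [x])"
  by transfer (rule null.relator, rule relators.bigon)

lemma crossing_crossing:
  "crossing (- x) x \<odot> crossing x (- x) = ident [x, - x] + cup x \<odot> cap x"
  by transfer (rule null.relator, rule relators.square)

text \<open>The common normal form: right-nested composites of single pieces padded by identities.
  Two drawings that differ in bracketing only become equal terms.\<close>

lemmas normalize = comp_tens_ident ident_tens_comp tens_assoc comp_assoc

lemma comp_reassoc: "A \<odot> B = C \<Longrightarrow> A \<odot> (B \<odot> D) = C \<odot> D"
  by (simp flip: comp_assoc)

text \<open>The device for applying a local relation inside a larger web: it is padded on both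
  sides, and \<open>comp_reassoc\<close> is added when more is stacked underneath.\<close>

lemma pad_comp: "A \<odot> B = C \<Longrightarrow>
    (ident u \<otimes> A \<otimes> ident v) \<odot> (ident u \<otimes> B \<otimes> ident v) = ident u \<otimes> C \<otimes> ident v"
  by (auto simp: normalize)

text \<open>Substituting \<open>rotate_right\<close> for the fork puts a cup and a cap on the same
  strand, and \<open>zigzag_right\<close> straightens it.\<close>

lemma cap_fork_right: "(ident [- x] \<otimes> cap (- x)) \<odot> (fork x \<otimes> ident [x]) = merge x"
proof -
  have "(ident [- x] \<otimes> cap (- x)) \<odot> (fork x \<otimes> ident [x]) =
      (ident [- x] \<otimes> cap (- x)) \<odot> (merge x \<otimes> ident [- x, x]) \<odot> (ident [x] \<otimes> cup x \<otimes> ident [x])"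
    by (simp add: normalize flip: rotate_right)
  also have "\<dots> = merge x \<odot> (ident [x, x] \<otimes> cap (- x)) \<odot> (ident [x] \<otimes> cup x \<otimes> ident [x])"
    using elementary_exchange[of "Merge x" "[]" "Cap (- x)"] by (simp flip: comp_assoc)
  also have "\<dots> = merge x \<odot> ident [x, x]"
    using pad_comp[OF zigzag_right, of "[x]" x "[]"] by simp
  finally show ?thesis by (simp add: comp_ident[OF Hom_elementary[of "Merge x", simplified]])
qed

lemma cap_fork_left: "(cap x \<otimes> ident [- x]) \<odot> (ident [x] \<otimes> fork x) = merge x"
proof -
  have "(cap x \<otimes> ident [- x]) \<odot> (ident [x] \<otimes> fork x) =
      (cap x \<otimes> ident [- x]) \<odot> (ident [x, - x] \<otimes> merge x) \<odot> (ident [x] \<otimes> cup (- x) \<otimes> ident [x])"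
    by (simp add: normalize flip: rotate_left)
  also have "\<dots> = merge x \<odot> (cap x \<otimes> ident [x, x]) \<odot> (ident [x] \<otimes> cup (- x) \<otimes> ident [x])"
    using elementary_exchange[of "Cap x" "[]" "Merge x"] by (simp flip: comp_assoc)
  also have "\<dots> = merge x \<odot> ident [x, x]"
    using pad_comp[OF zigzag_left, of "[]" x "[x]"] by (simp add: tens_assoc)
  finally show ?thesis by (simp add: comp_ident[OF Hom_elementary[of "Merge x", simplified]])
qed

text \<open>Once one vertex of the H is rotated, the H consists of two merges over a cup, so either
  of its vertices can be drawn as the lower one.\<close>

lemma crossing_opposite': "crossing x (- x) = (merge x \<otimes> ident [x]) \<odot> (ident [x] \<otimes> fork (- x))"
proof -
  have "(merge x \<otimes> ident [x]) \<odot> (ident [x] \<otimes> fork (- x)) =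
      (merge x \<otimes> ident [x]) \<odot> (ident [x, x] \<otimes> merge (- x)) \<odot> (ident [x] \<otimes> cup x \<otimes> ident [- x])"
    using rotate_left[of "- x"] by (simp add: normalize ident_tens_comp flip: rotate_left[of "- x"])
  also have "\<dots> = (ident [- x] \<otimes> merge (- x)) \<odot> (merge x \<otimes> ident [- x, - x]) \<odot> (ident [x] \<otimes> cup x \<otimes> ident [- x])"
    using elementary_exchange[of "Merge x" "[]" "Merge (- x)"] by (simp flip: comp_assoc)
  also have "\<dots> = crossing x (- x)"
    using pad_comp[OF rotate_right, of "[]" x "[- x]"] by (simp add: crossing_opposite tens_assoc)
  finally show ?thesis ..
qed

lemma Hom_crossing: "crossing x y \<in> Hom [x, y] [y, x]"
proof (cases "x = y")
  case True
  then show ?thesis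
    by (auto simp: crossing_same intro!: Hom_intros)
next
  case False
  then have [simp]: "y = - x" by (simp add: sign_neq_iff)
  show ?thesis
    unfolding \<open>y = - x\<close> crossing_opposite by (rule Hom_intros refl | simp)+
qed

text \<open>Both sides draw the trivalent vertex with its three legs pointing down.\<close>

lemma cap_merge: "cap x \<odot> (ident [x] \<otimes> merge x) = cap (- x) \<odot> (merge x \<otimes> ident [x])"
proof -
  have "cap x \<odot> (ident [x] \<otimes> merge x) =
      cap x \<odot> (ident [x, - x] \<otimes> cap (- x)) \<odot> (ident [x] \<otimes> fork x \<otimes> ident [x])"
    by (simp add: normalize flip: cap_fork_right)
  also have "\<dots> = cap (- x) \<odot> (cap x \<otimes> ident [- x, x]) \<odot> (ident [x] \<otimes> fork x \<otimes> ident [x])"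
    using elementary_exchange[of "Cap x" "[]" "Cap (- x)"] by (simp flip: comp_assoc)
  also have "\<dots> = cap (- x) \<odot> (merge x \<otimes> ident [x])"
    using pad_comp[OF cap_fork_left, of "[]" x "[x]"] by (simp add: tens_assoc)
  finally show ?thesis .
qed

lemma fork_cup: "(fork x \<otimes> ident [- x]) \<odot> cup x = (ident [- x] \<otimes> fork x) \<odot> cup (- x)"
proof -
  have "(fork x \<otimes> ident [- x]) \<odot> cup x =
      (ident [- x] \<otimes> merge x \<otimes> ident [- x]) \<odot> (cup (- x) \<otimes> ident [x, - x]) \<odot> cup x"
    by (simp add: normalize flip: rotate_left)
  also have "(cup (- x) \<otimes> ident [x, - x]) \<odot> cup x = (ident [- x, x] \<otimes> cup x) \<odot> cup (- x)"
    using elementary_exchange[of "Cup (- x)" "[]" "Cup x"] by simp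
  also have "(ident [- x] \<otimes> merge x \<otimes> ident [- x]) \<odot> (ident [- x, x] \<otimes> cup x) \<odot> cup (- x) =
      (ident [- x] \<otimes> fork x) \<odot> cup (- x)"
    using pad_comp[OF rotate_right, of "[- x]" x "[]"] by (simp add: tens_assoc flip: comp_assoc)
  finally show ?thesis .
qed

text \<open>Sliding the upper vertex of the H along the cap makes the two vertices bound a
  bigon.\<close>

lemma cap_crossing: "cap (- x) \<odot> crossing x (- x) = scale (- qint 2) (cap x)"
proof -
  have "cap (- x) \<odot> crossing x (- x) = cap x \<odot> (merge (- x) \<otimes> ident [- x]) \<odot> (fork x \<otimes> ident [- x])"
    using cap_merge[of "- x"] by (simp add: crossing_opposite flip: comp_assoc)
  also have "\<dots> = scale (- qint 2) (cap x \<odot> ident [x, - x])"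
    using pad_comp[OF merge_fork, of "[]" x "[- x]"]
    by (simp add: tens_scale_left comp_scale_right)
  finally show ?thesis by (simp add: comp_ident[OF Hom_elementary[of "Cap x", simplified]])
qed

lemma crossing_cup: "crossing x (- x) \<odot> cup x = scale (- qint 2) (cup (- x))"
proof -
  have "crossing x (- x) \<odot> cup x = (ident [- x] \<otimes> merge (- x)) \<odot> (ident [- x] \<otimes> fork x) \<odot> cup (- x)"
    by (simp add: crossing_opposite comp_assoc fork_cup)
  also have "\<dots> = scale (- qint 2) (ident [- x, x] \<odot> cup (- x))"
    using pad_comp[OF merge_fork, of "[- x]" x "[]"]
    by (simp add: tens_scale_right comp_scale_left flip: comp_assoc)
  finally show ?thesis by (simp add: ident_comp[OF Hom_elementary[of "Cup (- x)", simplified]])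
qed

text \<open>The cap bends an upper leg of the H down, so the H becomes a binary tree with three
  inputs.\<close>

lemma cap_crossing_right:
  "(ident [- x] \<otimes> cap x) \<odot> (crossing x (- x) \<otimes> ident [- x]) = merge x \<odot> (ident [x] \<otimes> merge (- x))"
proof -
  have "(ident [- x] \<otimes> cap x) \<odot> (crossing x (- x) \<otimes> ident [- x]) =
      (ident [- x] \<otimes> cap x) \<odot> (merge x \<otimes> ident [x, - x]) \<odot> (ident [x] \<otimes> fork (- x) \<otimes> ident [- x])"
    by (simp add: crossing_opposite' normalize)
  also have "\<dots> = merge x \<odot> (ident [x, x] \<otimes> cap x) \<odot> (ident [x] \<otimes> fork (- x) \<otimes> ident [- x])"
    using elementary_exchange[of "Merge x" "[]" "Cap x"] by (simp flip: comp_assoc)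
  also have "\<dots> = merge x \<odot> (ident [x] \<otimes> merge (- x))"
    using pad_comp[OF cap_fork_right, of "[x]" "- x" "[]"] by simp
  finally show ?thesis .
qed

lemma cap_crossing_left:
  "(cap x \<otimes> ident [x]) \<odot> (ident [x] \<otimes> crossing x (- x)) = merge (- x) \<odot> (merge x \<otimes> ident [- x])"
proof -
  have "(cap x \<otimes> ident [x]) \<odot> (ident [x] \<otimes> crossing x (- x)) =
      (cap x \<otimes> ident [x]) \<odot> (ident [x, - x] \<otimes> merge (- x)) \<odot> (ident [x] \<otimes> fork x \<otimes> ident [- x])"
    by (simp add: crossing_opposite normalize)
  also have "\<dots> = merge (- x) \<odot> (cap x \<otimes> ident [- x, - x]) \<odot> (ident [x] \<otimes> fork x \<otimes> ident [- x])"
    using elementary_exchange[of "Cap x" "[]" "Merge (- x)"] by (simp flip: comp_assoc)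
  also have "\<dots> = merge (- x) \<odot> (merge x \<otimes> ident [- x])"
    using pad_comp[OF cap_fork_left, of "[]" x "[- x]"] by (simp add: tens_assoc)
  finally show ?thesis .
qed

text \<open>One and the same web, two merges above a fork of the middle strand; either merge may be
  combined with the fork into an H. This is what allows a wide merge to be read from either
  end.\<close>

lemma merge_crossing:
  "(ident [- x] \<otimes> merge x) \<odot> (crossing x (- x) \<otimes> ident [x]) =
   (merge x \<otimes> ident [- x]) \<odot> (ident [x] \<otimes> crossing (- x) x)"
proof -
  have "(ident [- x] \<otimes> merge x) \<odot> (crossing x (- x) \<otimes> ident [x]) =
      (ident [- x] \<otimes> merge x) \<odot> (merge x \<otimes> ident [x, x]) \<odot> (ident [x] \<otimes> fork (- x) \<otimes> ident [x])"
    by (simp add: crossing_opposite' normalize)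
  also have "\<dots> = (merge x \<otimes> ident [- x]) \<odot> (ident [x, x] \<otimes> merge x) \<odot> (ident [x] \<otimes> fork (- x) \<otimes> ident [x])"
    using elementary_exchange[of "Merge x" "[]" "Merge x"] by (simp flip: comp_assoc)
  finally show ?thesis
    using crossing_opposite[of "- x"] by (simp add: normalize)
qed

lemma comp_ident_crossing [simp]:
  "crossing x y \<odot> ident [x, y] = crossing x y" "ident [y, x] \<odot> crossing x y = crossing x y"
  by (simp_all add: ident_comp[OF Hom_crossing] comp_ident[OF Hom_crossing])

text \<open>Two forks below a merge of their inner legs, with the merge attached to either
  fork.\<close>

lemma crossing_fork:
  "(crossing x (- x) \<otimes> ident [- x]) \<odot> (ident [x] \<otimes> fork x) =
   (ident [- x] \<otimes> crossing (- x) x) \<odot> (fork x \<otimes> ident [x])"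
proof -
  have "(crossing x (- x) \<otimes> ident [- x]) \<odot> (ident [x] \<otimes> fork x) =
      (ident [- x] \<otimes> merge (- x) \<otimes> ident [- x]) \<odot> (fork x \<otimes> ident [- x, - x]) \<odot> (ident [x] \<otimes> fork x)"
    by (simp add: crossing_opposite normalize)
  also have "\<dots> = (ident [- x] \<otimes> merge (- x) \<otimes> ident [- x]) \<odot> (ident [- x, - x] \<otimes> fork x) \<odot> (fork x \<otimes> ident [x])"
    using elementary_exchange[of "Split x" "[]" "Split x"] by simp
  finally show ?thesis
    using crossing_opposite'[of "- x"] by (simp add: normalize)
qed

section \<open>Sweeping a strand across a word\<close>

text \<open>Mirror image of \<open>sweep\<close>, needed for wide merges read from the right and for
  arcs that are pulled straight.\<close>

fun sweep_left :: "sign \<Rightarrow> word \<Rightarrow> skein" where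
  "sweep_left x [] = ident [x]"
| "sweep_left x (y # w) = (crossing y x \<otimes> ident w) \<odot> (ident [y] \<otimes> sweep_left x w)"

lemma Hom_sweep: "sweep x w \<in> Hom (x # w) (w @ [x])"
proof (induction w)
  case (Cons y w)
  show ?case by (rule Hom_intros Hom_crossing Cons refl | simp)+
qed simp

lemma Hom_sweep_left: "sweep_left x w \<in> Hom (w @ [x]) (x # w)"
proof (induction w)
  case (Cons y w)
  show ?case by (rule Hom_intros Hom_crossing Cons refl | simp)+
qed simp

lemma sweep_append:
  "sweep x (v @ w) = (ident v \<otimes> sweep x w) \<odot> (sweep x v \<otimes> ident w)"
proof (induction v)
  case Nil
  show ?case using comp_ident[OF Hom_sweep[of x w]] by simp
next
  case (Cons y v)
  show ?case by (simp add: Cons normalize)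
qed

lemma sweep_left_append:
  "sweep_left x (v @ w) = (sweep_left x v \<otimes> ident w) \<odot> (ident v \<otimes> sweep_left x w)"
proof (induction v)
  case Nil
  show ?case using ident_comp[OF Hom_sweep_left[of x w]] by simp
next
  case (Cons y v)
  show ?case by (simp add: Cons normalize)
qed

lemma sweep_single [simp]: "sweep x [y] = crossing x y"
  using ident_comp[OF Hom_crossing[of x y]] by simp

lemma sweep_pair: "sweep x [y, z] = (ident [y] \<otimes> crossing x z) \<odot> (crossing x y \<otimes> ident [z])"
  using sweep_append[of x "[y]" "[z]"] by (simp del: sweep.simps)

lemma sweep_left_single [simp]: "sweep_left x [y] = crossing y x"
  by simp

text \<open>After \<open>merge_crossing\<close> the two crossings form a square, whose resolution
  either separates the merge from the strand or leaves a fork over a cap. This lemma and the next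
  three treat the pieces that can meet a swept strand; each is one application of the square
  relation.\<close>

lemma sweep_merge:
  "(merge (- x) \<otimes> ident [x]) \<odot> sweep x [- x, - x] =
   ident [x] \<otimes> merge (- x) + fork (- x) \<odot> (cap x \<otimes> ident [- x])"
proof -
  have "(merge (- x) \<otimes> ident [x]) \<odot> sweep x [- x, - x] =
      ((merge (- x) \<otimes> ident [x]) \<odot> (ident [- x] \<otimes> crossing x (- x))) \<odot> (crossing x (- x) \<otimes> ident [- x])"
    by (simp add: comp_assoc sweep_pair del: sweep.simps)
  also have "\<dots> = (ident [x] \<otimes> merge (- x)) \<odot> ((crossing (- x) x \<odot> crossing x (- x)) \<otimes> ident [- x])"
    using merge_crossing[of "- x"] by (simp add: comp_tens_ident flip: comp_assoc)
  also have "\<dots> = ident [x] \<otimes> merge (- x) +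
      (ident [x] \<otimes> merge (- x)) \<odot> (cup x \<otimes> ident [- x]) \<odot> (cap x \<otimes> ident [- x])"
    using comp_ident[OF Hom_tens[OF Hom_ident Hom_elementary], of "[x]" "Merge (- x)"]
    by (simp add: crossing_crossing tens_add_left comp_add_right normalize)
  also have "(ident [x] \<otimes> merge (- x)) \<odot> (cup x \<otimes> ident [- x]) \<odot> (cap x \<otimes> ident [- x]) =
      fork (- x) \<odot> (cap x \<otimes> ident [- x])"
    using rotate_left[of "- x", THEN comp_reassoc] by simp
  finally show ?thesis .
qed

lemma sweep_fork:
  "sweep x [- x, - x] \<odot> (ident [x] \<otimes> fork x) =
   fork x \<otimes> ident [x] + (ident [- x] \<otimes> cup (- x)) \<odot> merge x"
proof -
  have "sweep x [- x, - x] \<odot> (ident [x] \<otimes> fork x) =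
      (ident [- x] \<otimes> crossing x (- x)) \<odot> ((crossing x (- x) \<otimes> ident [- x]) \<odot> (ident [x] \<otimes> fork x))"
    by (simp add: comp_assoc sweep_pair del: sweep.simps)
  also have "\<dots> = (ident [- x] \<otimes> (crossing x (- x) \<odot> crossing (- x) x)) \<odot> (fork x \<otimes> ident [x])"
    by (simp add: crossing_fork normalize)
  also have "\<dots> = fork x \<otimes> ident [x] +
      (ident [- x] \<otimes> cup (- x)) \<odot> (ident [- x] \<otimes> cap (- x)) \<odot> (fork x \<otimes> ident [x])"
    using crossing_crossing[of "- x"]
      ident_comp[OF Hom_tens[OF Hom_elementary Hom_ident], of "Split x" "[x]"]
    by (simp add: tens_add_right comp_add_left normalize)
  finally show ?thesis by (simp add: cap_fork_right)
qed

text \<open>Crossings of equal signs are forks over merges; regrouped with the extra merge they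
  become two crossings of opposite signs, hence a square.\<close>

lemma sweep_merge_same:
  "(merge x \<otimes> ident [x]) \<odot> sweep x [x, x] =
   merge x \<otimes> ident [x] + cup (- x) \<odot> cap x \<odot> (ident [x] \<otimes> merge x)"
proof -
  have "(merge x \<otimes> ident [x]) \<odot> sweep x [x, x] =
      ((merge x \<otimes> ident [x]) \<odot> (ident [x] \<otimes> fork (- x))) \<odot>
      (((ident [x] \<otimes> merge x) \<odot> (fork (- x) \<otimes> ident [x])) \<odot> (merge x \<otimes> ident [x]))"
    by (simp add: crossing_same normalize sweep_pair del: sweep.simps)
  also have "\<dots> = (crossing x (- x) \<odot> crossing (- x) x) \<odot> (merge x \<otimes> ident [x])"
    using crossing_opposite[of "- x"] by (simp add: comp_assoc flip: crossing_opposite')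
  also have "\<dots> = merge x \<otimes> ident [x] + cup (- x) \<odot> cap (- x) \<odot> (merge x \<otimes> ident [x])"
    using crossing_crossing[of "- x"]
      ident_comp[OF Hom_tens[OF Hom_elementary Hom_ident], of "Merge x" "[x]"]
    by (simp add: comp_add_left comp_assoc)
  finally show ?thesis by (simp add: cap_merge)
qed

text \<open>The cap rotates the fork of the second crossing, and the resulting tree is again a
  crossing under a cap. The square that appears resolves into the two ways of pulling the strand off
  the cap.\<close>

lemma sweep_cap:
  "(cap (- x) \<otimes> ident [x]) \<odot> sweep x [- x, x] = ident [x] \<otimes> cap (- x) + cap x \<otimes> ident [x]"
proof -
  have "(cap (- x) \<otimes> ident [x]) \<odot> sweep x [- x, x] =
      ((cap (- x) \<otimes> ident [x]) \<odot> (ident [- x] \<otimes> fork (- x))) \<odot> (ident [- x] \<otimes> merge x) \<odot>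
      (crossing x (- x) \<otimes> ident [x])"
    by (simp add: crossing_same normalize sweep_pair del: sweep.simps)
  also have "\<dots> = (merge (- x) \<odot> (ident [- x] \<otimes> merge x)) \<odot> (crossing x (- x) \<otimes> ident [x])"
    using cap_fork_left[of "- x"] by (simp add: comp_assoc)
  also have "\<dots> = (ident [x] \<otimes> cap (- x)) \<odot> ((crossing (- x) x \<odot> crossing x (- x)) \<otimes> ident [x])"
    using cap_crossing_right[of "- x"] by (simp add: normalize flip: comp_assoc)
  also have "\<dots> = ident [x] \<otimes> cap (- x) +
      ((ident [x] \<otimes> cap (- x)) \<odot> (cup x \<otimes> ident [x])) \<odot> (cap x \<otimes> ident [x])"
    using comp_ident[OF Hom_tens[OF Hom_ident Hom_elementary], of "[x]" "Cap (- x)"]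
    by (simp add: crossing_crossing tens_add_left comp_add_right normalize)
  also have "\<dots> = ident [x] \<otimes> cap (- x) + cap x \<otimes> ident [x]"
    using ident_comp[OF Hom_tens[OF Hom_elementary Hom_ident], of "Cap x" "[x]"]
    by (simp add: zigzag_right)
  finally show ?thesis .
qed

section \<open>Wide merges\<close>

text \<open>These are the webs that appear when a merge is pushed below crossings. The strand may
  equally well pass from the right end (\<open>wide_merge_left\<close>), which makes the family closed under
  commutation with everything underneath.\<close>

definition wide_merge :: "sign \<Rightarrow> nat \<Rightarrow> skein" where
  "wide_merge x k = (ident (replicate k (- x)) \<otimes> merge x) \<odot> (sweep x (replicate k (- x)) \<otimes> ident [x])"

lemma Hom_wide_merge:
  "wide_merge x k \<in> Hom (x # replicate k (- x) @ [x]) (replicate k (- x) @ [- x])"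
  unfolding wide_merge_def by (rule Hom_intros Hom_sweep refl | simp)+

lemma wide_merge_0 [simp]: "wide_merge x 0 = merge x"
  using comp_ident[OF Hom_elementary[of "Merge x"]] by (simp add: wide_merge_def)

lemma wide_merge_Suc:
  "wide_merge x (Suc k) =
   (ident [- x] \<otimes> wide_merge x k) \<odot> (crossing x (- x) \<otimes> ident (replicate k (- x) @ [x]))"
  by (simp add: wide_merge_def normalize)

text \<open>A crossing may be split off at either end: the base case is
  \<open>merge_crossing\<close>, and the step exchanges the two outermost crossings, which lie side
  by side.\<close>

lemma wide_merge_Suc':
  "wide_merge x (Suc k) =
   (wide_merge x k \<otimes> ident [- x]) \<odot> (ident (x # replicate k (- x)) \<otimes> crossing (- x) x)"
proof (induction k)
  case 0
  show ?case by (simp add: wide_merge_Suc merge_crossing)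
next
  case (Suc k)
  let ?N = "replicate k (- x)"
  have N: "replicate (Suc k) (- x) = ?N @ [- x]"
    by (simp add: replicate_append_same)
  have A: "crossing x (- x) \<otimes> ident ?N \<in> Hom (x # - x # ?N) (- x # x # ?N)"
    by (rule Hom_intros Hom_crossing refl | simp)+
  have "wide_merge x (Suc (Suc k)) =
      (ident [- x] \<otimes> wide_merge x k \<otimes> ident [- x]) \<odot>
      (ident (- x # x # ?N) \<otimes> crossing (- x) x) \<odot> ((crossing x (- x) \<otimes> ident ?N) \<otimes> ident [- x, x])"
    unfolding wide_merge_Suc[of x "Suc k"] Suc N by (simp add: normalize)
  also have "\<dots> = ((ident [- x] \<otimes> wide_merge x k \<otimes> ident [- x]) \<odot>
      (crossing x (- x) \<otimes> ident (?N @ [x, - x]))) \<odot> (ident (x # - x # ?N) \<otimes> crossing (- x) x)"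
    using exchange[OF A Hom_crossing[of "- x" x]] by (simp add: tens_assoc comp_assoc)
  finally show ?case by (simp add: wide_merge_Suc[of x k] normalize)
qed

lemma wide_merge_left:
  "wide_merge x k = (merge x \<otimes> ident (replicate k (- x))) \<odot> (ident [x] \<otimes> sweep_left x (replicate k (- x)))"
proof (induction k)
  case 0
  show ?case using comp_ident[OF Hom_elementary[of "Merge x"]] by simp
next
  case (Suc k)
  have N: "replicate (Suc k) (- x) = replicate k (- x) @ [- x]"
    by (simp add: replicate_append_same)
  show ?case
    unfolding wide_merge_Suc' Suc N sweep_left_append by (simp add: normalize)
qed

text \<open>The cup bends the first input upwards, so the vertex becomes a fork at the left end,
  reached by the second input alone.\<close>

lemma wide_merge_cup_left:
  "(ident [- x] \<otimes> wide_merge x k) \<odot> (cup (- x) \<otimes> ident (replicate k (- x) @ [x])) =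
   (fork x \<otimes> ident (replicate k (- x))) \<odot> sweep_left x (replicate k (- x))"
proof -
  let ?N = "replicate k (- x)"
  have "(ident [- x] \<otimes> wide_merge x k) \<odot> (cup (- x) \<otimes> ident (?N @ [x])) =
      (ident [- x] \<otimes> merge x \<otimes> ident ?N) \<odot>
      ((ident [- x, x] \<otimes> sweep_left x ?N) \<odot> (cup (- x) \<otimes> ident (?N @ [x])))"
    by (simp add: wide_merge_left normalize)
  also have "(ident [- x, x] \<otimes> sweep_left x ?N) \<odot> (cup (- x) \<otimes> ident (?N @ [x])) =
      (cup (- x) \<otimes> ident (x # ?N)) \<odot> sweep_left x ?N"
    using exchange[OF Hom_elementary[of "Cup (- x)"] Hom_sweep_left[of x ?N]] by simp
  also have "(ident [- x] \<otimes> merge x \<otimes> ident ?N) \<odot> \<dots> = (fork x \<otimes> ident ?N) \<odot> sweep_left x ?N"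
    using pad_comp[OF rotate_left, of "[]" x ?N, THEN comp_reassoc] by (simp add: tens_assoc)
  finally show ?thesis .
qed

lemma wide_merge_cup_right:
  "(wide_merge x k \<otimes> ident [- x]) \<odot> (ident (x # replicate k (- x)) \<otimes> cup x) =
   (ident (replicate k (- x)) \<otimes> fork x) \<odot> sweep x (replicate k (- x))"
proof -
  let ?N = "replicate k (- x)"
  have "(wide_merge x k \<otimes> ident [- x]) \<odot> (ident (x # ?N) \<otimes> cup x) =
      (ident ?N \<otimes> merge x \<otimes> ident [- x]) \<odot>
      ((sweep x ?N \<otimes> ident [x, - x]) \<odot> (ident (x # ?N) \<otimes> cup x))"
    by (simp add: wide_merge_def normalize)
  also have "(sweep x ?N \<otimes> ident [x, - x]) \<odot> (ident (x # ?N) \<otimes> cup x) =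
      (ident (?N @ [x]) \<otimes> cup x) \<odot> sweep x ?N"
    using exchange[OF Hom_sweep[of x ?N] Hom_elementary[of "Cup x"]] by simp
  also have "(ident ?N \<otimes> merge x \<otimes> ident [- x]) \<odot> \<dots> = (ident ?N \<otimes> fork x) \<odot> sweep x ?N"
    using pad_comp[OF rotate_right, of ?N x "[]", THEN comp_reassoc] by (simp add: tens_assoc)
  finally show ?thesis .
qed

text \<open>Fork and merge share an edge and together are the resolved crossing with one more
  strand.\<close>

lemma wide_merge_fork_left:
  "(ident [x] \<otimes> wide_merge x k) \<odot> (fork (- x) \<otimes> ident (replicate k (- x) @ [x])) =
   sweep_left x (replicate (Suc k) (- x))"
proof -
  let ?N = "replicate k (- x)"
  have "(ident [x] \<otimes> wide_merge x k) \<odot> (fork (- x) \<otimes> ident (?N @ [x])) =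
      (ident [x] \<otimes> merge x \<otimes> ident ?N) \<odot>
      ((ident [x, x] \<otimes> sweep_left x ?N) \<odot> (fork (- x) \<otimes> ident (?N @ [x])))"
    by (simp add: wide_merge_left normalize)
  also have "(ident [x, x] \<otimes> sweep_left x ?N) \<odot> (fork (- x) \<otimes> ident (?N @ [x])) =
      (fork (- x) \<otimes> ident (x # ?N)) \<odot> (ident [- x] \<otimes> sweep_left x ?N)"
    using exchange[OF Hom_elementary[of "Split (- x)"] Hom_sweep_left[of x ?N]] by simp
  finally show ?thesis
    using crossing_opposite[of "- x"] by (simp add: normalize)
qed

lemma wide_merge_fork_right:
  "(wide_merge x k \<otimes> ident [x]) \<odot> (ident (x # replicate k (- x)) \<otimes> fork (- x)) =
   sweep x (replicate k (- x) @ [- x])"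
proof -
  let ?N = "replicate k (- x)"
  have "(wide_merge x k \<otimes> ident [x]) \<odot> (ident (x # ?N) \<otimes> fork (- x)) =
      (ident ?N \<otimes> merge x \<otimes> ident [x]) \<odot>
      ((sweep x ?N \<otimes> ident [x, x]) \<odot> (ident (x # ?N) \<otimes> fork (- x)))"
    by (simp add: wide_merge_def normalize)
  also have "(sweep x ?N \<otimes> ident [x, x]) \<odot> (ident (x # ?N) \<otimes> fork (- x)) =
      (ident (?N @ [x]) \<otimes> fork (- x)) \<odot> (sweep x ?N \<otimes> ident [- x])"
    using exchange[OF Hom_sweep[of x ?N] Hom_elementary[of "Split (- x)"]] by simp
  finally show ?thesis
    by (simp add: sweep_append crossing_opposite' normalize del: sweep.simps)
qed

text \<open>The two successive crossings on the left cancel up to a cup over a cap, and the cup is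
  absorbed by \<open>wide_merge_cup_left\<close>.\<close>

lemma wide_merge_crossing_left:
  "wide_merge x (Suc k) \<odot> (crossing (- x) x \<otimes> ident (replicate k (- x) @ [x])) =
   ident [- x] \<otimes> wide_merge x k +
   (fork x \<otimes> ident (replicate k (- x))) \<odot> sweep_left x (replicate k (- x)) \<odot>
     (cap (- x) \<otimes> ident (replicate k (- x) @ [x]))"
proof -
  let ?N = "replicate k (- x)"
  have "wide_merge x (Suc k) \<odot> (crossing (- x) x \<otimes> ident (?N @ [x])) =
      (ident [- x] \<otimes> wide_merge x k) \<odot> ((crossing x (- x) \<odot> crossing (- x) x) \<otimes> ident (?N @ [x]))"
    by (simp add: wide_merge_Suc normalize)
  also have "\<dots> = ident [- x] \<otimes> wide_merge x k +
      ((ident [- x] \<otimes> wide_merge x k) \<odot> (cup (- x) \<otimes> ident (?N @ [x]))) \<odot> (cap (- x) \<otimes> ident (?N @ [x]))"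
    using crossing_crossing[of "- x"]
      comp_ident[OF Hom_tens[OF Hom_ident Hom_wide_merge], of "[- x]" x k]
    by (simp add: tens_add_left comp_add_right normalize)
  finally show ?thesis by (simp add: wide_merge_cup_left comp_assoc)
qed

lemma wide_merge_crossing_right:
  "wide_merge x (Suc k) \<odot> (ident (x # replicate k (- x)) \<otimes> crossing x (- x)) =
   wide_merge x k \<otimes> ident [- x] +
   (ident (replicate k (- x)) \<otimes> fork x) \<odot> sweep x (replicate k (- x)) \<odot>
     (ident (x # replicate k (- x)) \<otimes> cap x)"
proof -
  let ?N = "replicate k (- x)"
  have "wide_merge x (Suc k) \<odot> (ident (x # ?N) \<otimes> crossing x (- x)) =
      (wide_merge x k \<otimes> ident [- x]) \<odot> (ident (x # ?N) \<otimes> (crossing (- x) x \<odot> crossing x (- x)))"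
    by (simp add: wide_merge_Suc' normalize)
  also have "\<dots> = wide_merge x k \<otimes> ident [- x] +
      ((wide_merge x k \<otimes> ident [- x]) \<odot> (ident (x # ?N) \<otimes> cup x)) \<odot> (ident (x # ?N) \<otimes> cap x)"
    using crossing_crossing[of x]
      comp_ident[OF Hom_tens[OF Hom_wide_merge Hom_ident], of x k "[- x]"]
    by (simp add: tens_add_right comp_add_right normalize)
  finally show ?thesis by (simp add: wide_merge_cup_right comp_assoc)
qed

lemma wide_merge_inner_cup_left:
  "wide_merge x (Suc k) \<odot> (cup x \<otimes> ident (replicate k (- x) @ [x])) =
   scale (- qint 2) ((fork x \<otimes> ident (replicate k (- x))) \<odot> sweep_left x (replicate k (- x)))"
  using pad_comp[OF crossing_cup, of "[]" x "replicate k (- x) @ [x]"]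
  by (simp add: wide_merge_Suc comp_assoc tens_scale_left comp_scale_right flip: wide_merge_cup_left)

lemma wide_merge_inner_cup_right:
  "wide_merge x (Suc k) \<odot> (ident (x # replicate k (- x)) \<otimes> cup (- x)) =
   scale (- qint 2) ((ident (replicate k (- x)) \<otimes> fork x) \<odot> sweep x (replicate k (- x)))"
  using pad_comp[OF crossing_cup, of "x # replicate k (- x)" "- x" "[]"]
  by (simp add: wide_merge_Suc' comp_assoc tens_scale_right comp_scale_right flip: wide_merge_cup_right)

text \<open>The word below the fork contains three letters \<open>x\<close>. By
  \<open>sweep_fork\<close> the middle one merges with the right one or with the left one, and the
  remaining letter \<open>x\<close> ends in a fork.\<close>

lemma wide_merge_inner_fork:
  "wide_merge x (i + 2 + l) \<odot>
     (ident (x # replicate i (- x)) \<otimes> fork x \<otimes> ident (replicate l (- x) @ [x])) =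
   (ident (replicate i (- x)) \<otimes> fork x \<otimes> ident (replicate (Suc l) (- x))) \<odot>
     (sweep x (replicate i (- x)) \<otimes> ident (replicate (Suc l) (- x))) \<odot>
     (ident (x # replicate i (- x)) \<otimes> wide_merge x l) +
   (ident (replicate (Suc i) (- x)) \<otimes> fork x \<otimes> ident (replicate l (- x))) \<odot>
     (ident (replicate (Suc i) (- x)) \<otimes> sweep_left x (replicate l (- x))) \<odot>
     (wide_merge x i \<otimes> ident (replicate l (- x) @ [x]))"
proof -
  let ?N = "\<lambda>k. replicate k (- x)"
  have N: "?N (i + 2 + l) = ?N i @ [- x, - x] @ ?N l"
    by (simp add: replicate_add replicate_app_Cons_same)
  have N': "?N (Suc i) = ?N i @ [- x]" "?N (Suc l) = ?N l @ [- x]"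
    by (simp_all add: replicate_append_same)
  have "wide_merge x (i + 2 + l) \<odot> (ident (x # ?N i) \<otimes> fork x \<otimes> ident (?N l @ [x])) =
      (ident (?N i @ [- x, - x]) \<otimes> wide_merge x l) \<odot> (ident (?N i) \<otimes> sweep x [- x, - x] \<otimes> ident (?N l @ [x])) \<odot>
      ((sweep x (?N i) \<otimes> ident ([- x, - x] @ ?N l @ [x])) \<odot> (ident (x # ?N i) \<otimes> fork x \<otimes> ident (?N l @ [x])))"
    unfolding wide_merge_def N sweep_append by (simp add: normalize del: sweep.simps)
  also have "(sweep x (?N i) \<otimes> ident ([- x, - x] @ ?N l @ [x])) \<odot> (ident (x # ?N i) \<otimes> fork x \<otimes> ident (?N l @ [x])) =
      (ident (?N i @ [x]) \<otimes> fork x \<otimes> ident (?N l @ [x])) \<odot> (sweep x (?N i) \<otimes> ident ([x] @ ?N l @ [x]))"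
    using exchange[OF Hom_sweep[of x "?N i"] Hom_tens[OF Hom_elementary[of "Split x"] Hom_ident[of "?N l @ [x]"]]]
    by simp
  also have "(ident (?N i @ [- x, - x]) \<otimes> wide_merge x l) \<odot> (ident (?N i) \<otimes> sweep x [- x, - x] \<otimes> ident (?N l @ [x])) \<odot> \<dots> =
     (ident (?N i @ [- x, - x]) \<otimes> wide_merge x l) \<odot> (ident (?N i) \<otimes> (sweep x [- x, - x] \<odot> (ident [x] \<otimes> fork x)) \<otimes> ident (?N l @ [x])) \<odot>
      (sweep x (?N i) \<otimes> ident ([x] @ ?N l @ [x]))"
    by (simp add: normalize del: sweep.simps)
  also have "\<dots> = (ident (?N i @ [- x, - x]) \<otimes> wide_merge x l) \<odot> (ident (?N i) \<otimes> fork x \<otimes> ident (x # ?N l @ [x])) \<odot>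
      (sweep x (?N i) \<otimes> ident ([x] @ ?N l @ [x])) +
     (ident (?N i @ [- x, - x]) \<otimes> wide_merge x l) \<odot> (ident (?N i @ [- x]) \<otimes> cup (- x) \<otimes> ident (?N l @ [x])) \<odot>
      (ident (?N i) \<otimes> merge x \<otimes> ident (?N l @ [x])) \<odot> (sweep x (?N i) \<otimes> ident ([x] @ ?N l @ [x]))"
    unfolding sweep_fork by (simp add: tens_add_left tens_add_right comp_add_left comp_add_right normalize)
  also have "(ident (?N i @ [- x, - x]) \<otimes> wide_merge x l) \<odot> (ident (?N i) \<otimes> fork x \<otimes> ident (x # ?N l @ [x])) \<odot>
      (sweep x (?N i) \<otimes> ident ([x] @ ?N l @ [x])) =
      (ident (?N i) \<otimes> fork x \<otimes> ident (?N (Suc l))) \<odot> (sweep x (?N i) \<otimes> ident (?N (Suc l))) \<odot>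
      (ident (x # ?N i) \<otimes> wide_merge x l)"
  proof -
    have A: "(ident (?N i) \<otimes> fork x) \<odot> sweep x (?N i) \<in> Hom (x # ?N i) (?N i @ [- x, - x])"
      by (rule Hom_intros Hom_sweep refl | simp)+
    show ?thesis
      using exchange[OF A Hom_wide_merge[of x l]] by (simp add: normalize N'(2) del: replicate.simps)
  qed
  also have "(ident (?N i @ [- x, - x]) \<otimes> wide_merge x l) \<odot> (ident (?N i @ [- x]) \<otimes> cup (- x) \<otimes> ident (?N l @ [x])) \<odot>
      (ident (?N i) \<otimes> merge x \<otimes> ident (?N l @ [x])) \<odot> (sweep x (?N i) \<otimes> ident ([x] @ ?N l @ [x])) =
     (ident (?N (Suc i)) \<otimes> ((ident [- x] \<otimes> wide_merge x l) \<odot> (cup (- x) \<otimes> ident (?N l @ [x])))) \<odot>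
     (wide_merge x i \<otimes> ident (?N l @ [x]))"
    by (simp add: wide_merge_def[of x i] N'(1) normalize del: replicate.simps(2))
  finally show ?thesis
    by (simp add: wide_merge_cup_left normalize del: replicate.simps)
qed

section \<open>Webs modulo lowering pieces\<close>

abbreviation pad :: "word \<Rightarrow> skein \<Rightarrow> word \<Rightarrow> skein" where
  "pad u A v \<equiv> ident u \<otimes> A \<otimes> ident v"

lemma Hom_pad: "A \<in> Hom s t \<Longrightarrow> pad u A v \<in> Hom (u @ s @ v) (u @ t @ v)"
  by (intro Hom_tens Hom_ident)

lemma pad_exchange:
  assumes "A \<in> Hom s s'" "B \<in> Hom t t'"
  shows "pad (u @ s' @ m) B v \<odot> pad u A (m @ t @ v) = pad u A (m @ t' @ v) \<odot> pad (u @ s @ m) B v"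
proof -
  have "ident u \<otimes> ((ident s' \<otimes> (ident m \<otimes> B)) \<odot> (A \<otimes> ident (m @ t))) \<otimes> ident v =
      ident u \<otimes> ((A \<otimes> ident (m @ t')) \<odot> (ident s \<otimes> (ident m \<otimes> B))) \<otimes> ident v"
    using exchange[OF assms(1) Hom_tens[OF Hom_ident assms(2)], of m] by simp
  then show ?thesis by (simp add: normalize)
qed

text \<open>Cups and forks, together with caps and merges, generate all webs. The crossing of
  opposite signs is added because it contains a merge but preserves the weight, so it must not count
  as lowering.\<close>

inductive raising :: "word \<Rightarrow> word \<Rightarrow> skein \<Rightarrow> bool" where
  cup: "raising [] [x, - x] (cup x)"
| fork: "raising [x] [- x, - x] (fork x)"
| crossing: "raising [x, - x] [- x, x] (crossing x (- x))"

lemma raising_Hom: "raising s t A \<Longrightarrow> A \<in> Hom s t"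
  by (induction rule: raising.induct) (use Hom_crossing[of _ "- _"] in \<open>auto intro: Hom_elementaryI\<close>)

text \<open>The number of pieces is recorded because a cap on top of a crossing turns into two merges: after
  the first one, the induction hypothesis has to apply again to the outcome.\<close>

inductive upward :: "word \<Rightarrow> nat \<Rightarrow> word \<Rightarrow> skein \<Rightarrow> bool" for s where
  ident: "upward s 0 s (ident s)"
| raise: "upward s n (u @ b @ v) A \<Longrightarrow> raising b c B \<Longrightarrow> upward s (Suc n) (u @ c @ v) (pad u B v \<odot> A)"

lemma upward_Hom: "upward s n t A \<Longrightarrow> A \<in> Hom s t"
  by (induction rule: upward.induct) (auto intro: Hom_comp Hom_pad raising_Hom)

text \<open>The number \<open>n\<close> bounds the pieces of the upward terms only: once a term
  begins with a cap or a wide merge, whatever is stacked above is absorbed into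
  \<open>B\<close>.\<close>

inductive spanned :: "word \<Rightarrow> nat \<Rightarrow> word \<Rightarrow> skein \<Rightarrow> bool" for s n where
  zero: "spanned s n t 0"
| add: "spanned s n t A \<Longrightarrow> spanned s n t B \<Longrightarrow> spanned s n t (A + B)"
| scale: "spanned s n t A \<Longrightarrow> spanned s n t (scale c A)"
| upward: "upward s m t A \<Longrightarrow> m \<le> n \<Longrightarrow> spanned s n t A"
| cap: "s = u @ [x, - x] @ v \<Longrightarrow> B \<in> Hom (u @ v) t \<Longrightarrow> spanned s n t (B \<odot> pad u (cap x) v)"
| wide_merge: "s = u @ (x # replicate k (- x) @ [x]) @ v \<Longrightarrow> B \<in> Hom (u @ (replicate k (- x) @ [- x]) @ v) t \<Longrightarrow>
    spanned s n t (B \<odot> pad u (wide_merge x k) v)"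

lemma spanned_mono: "spanned s n t A \<Longrightarrow> n \<le> m \<Longrightarrow> spanned s m t A"
  by (induction rule: spanned.induct) (auto intro: spanned.intros)

lemma spanned_raise:
  "spanned s n (u @ b @ v) A \<Longrightarrow> raising b c B \<Longrightarrow> spanned s (Suc n) (u @ c @ v) (pad u B v \<odot> A)"
proof (induction "u @ b @ v" A rule: spanned.induct)
  case (upward m A)
  then show ?case by (auto intro: spanned.upward upward.raise)
next
  case (cap u' x v' B')
  then show ?case
    using Hom_comp[OF cap(2) Hom_pad[OF raising_Hom[OF cap(3)]]]
    unfolding comp_assoc[symmetric] by (intro spanned.cap)
next
  case (wide_merge u' x k v' B')
  then show ?case
    using Hom_comp[OF wide_merge(2) Hom_pad[OF raising_Hom[OF wide_merge(3)]]]
    unfolding comp_assoc[symmetric] by (intro spanned.wide_merge)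
qed (auto simp: comp_add_right comp_scale_right intro: spanned.intros)

lemma Hom_pad_cap: "pad u (cap x) v \<in> Hom (u @ [x, - x] @ v) (u @ v)"
  using Hom_pad[OF Hom_elementary[of "Cap x"], of u v] by simp

lemma spanned_Hom: "spanned s n t A \<Longrightarrow> A \<in> Hom s t"
proof (induction rule: spanned.induct)
  case (cap u x v B t)
  show ?case
    using Hom_comp[OF Hom_pad_cap cap(2)] by (simp add: cap(1))
next
  case (wide_merge u x k v B t)
  show ?case
    unfolding wide_merge(1) by (rule Hom_comp[OF Hom_pad wide_merge(2)]) (rule Hom_wide_merge)
qed (auto intro: Hom_add Hom_scale upward_Hom)

lemma spanned_sweep:
  "spanned s n (u @ x # replicate k (- x) @ v) A \<Longrightarrow>
   spanned s (n + k) (u @ replicate k (- x) @ x # v) (pad u (sweep x (replicate k (- x))) v \<odot> A)"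
proof (induction k arbitrary: u n A)
  case 0
  then show ?case using ident_comp[OF spanned_Hom[OF 0]] by simp
next
  case (Suc k)
  have "spanned s (Suc n) (u @ [- x, x] @ (replicate k (- x) @ v)) (pad u (crossing x (- x)) (replicate k (- x) @ v) \<odot> A)"
    using Suc.prems by (intro spanned_raise[OF _ raising.crossing]) simp
  from Suc.IH[of "Suc n" "u @ [- x]", simplified, OF this[simplified]]
  show ?case by (simp add: normalize)
qed

lemma spanned_sweep_left:
  "spanned s n (u @ replicate k (- x) @ x # v) A \<Longrightarrow>
   spanned s (n + k) (u @ x # replicate k (- x) @ v) (pad u (sweep_left x (replicate k (- x))) v \<odot> A)"
proof (induction k arbitrary: v n A)
  case 0
  then show ?case using ident_comp[OF spanned_Hom[OF 0]] by simp
next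
  case (Suc k)
  have N: "replicate (Suc k) (- x) = replicate k (- x) @ [- x]"
    by (simp add: replicate_append_same)
  have "spanned s (Suc n) ((u @ replicate k (- x)) @ [- (- x), - x] @ v)
      (pad (u @ replicate k (- x)) (crossing (- x) (- (- x))) v \<odot> A)"
    using Suc.prems unfolding N by (intro spanned_raise[OF _ raising.crossing]) simp
  from Suc.IH[of "Suc n" "- x # v", simplified, OF this[simplified]]
  show ?case
    unfolding N sweep_left_append by (simp add: normalize)
qed

text \<open>The bound \<open>m + k\<close> reflects that the strand of a wide merge may leave up to
  \<open>k\<close> crossings behind, whereas a cap or a bare merge does not increase the
  count.\<close>

definition reducible :: "word \<Rightarrow> nat \<Rightarrow> bool" where
  "reducible s n \<longleftrightarrow> (\<forall>m t A. m \<le> n \<and> upward s m t A \<longrightarrow>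
     (\<forall>u x v. t = u @ [x, - x] @ v \<longrightarrow> spanned s m (u @ v) (pad u (cap x) v \<odot> A)) \<and>
     (\<forall>u x k v. t = u @ (x # replicate k (- x) @ [x]) @ v \<longrightarrow>
        spanned s (m + k) (u @ (replicate k (- x) @ [- x]) @ v) (pad u (wide_merge x k) v \<odot> A)))"

lemma reducibleD:
  assumes "reducible s n" "upward s m t A" "m \<le> n"
  shows "t = u @ [x, - x] @ v \<Longrightarrow> spanned s m (u @ v) (pad u (cap x) v \<odot> A)"
    and "t = u @ (x # replicate k (- x) @ [x]) @ v \<Longrightarrow>
      spanned s (m + k) (u @ (replicate k (- x) @ [- x]) @ v) (pad u (wide_merge x k) v \<odot> A)"
  using assms unfolding reducible_def by blast+

text \<open>Linear extension of the hypothesis from upward webs to combinations; terms that already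
  begin with a lowering piece only gain something on top.\<close>

lemma spanned_cap:
  assumes r: "reducible s n" and A: "spanned s n (u @ [x, - x] @ v) A"
  shows "spanned s n (u @ v) (pad u (cap x) v \<odot> A)"
  using A
proof (induction "u @ [x, - x] @ v" A rule: spanned.induct)
  case (upward m A)
  then show ?case
    using spanned_mono[OF reducibleD(1)[OF r upward refl]] by simp
next
  case (cap u' x' v' B')
  then show ?case
    using Hom_comp[OF cap(2) Hom_pad_cap]
    unfolding comp_assoc[symmetric] by (intro spanned.cap)
next
  case (wide_merge u' x' k v' B')
  then show ?case
    using Hom_comp[OF wide_merge(2) Hom_pad_cap]
    unfolding comp_assoc[symmetric] by (intro spanned.wide_merge)
qed (auto simp: comp_add_right comp_scale_right intro: spanned.intros)

lemma spanned_wide_merge: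
  assumes r: "reducible s n" and A: "spanned s n (u @ (x # replicate k (- x) @ [x]) @ v) A"
  shows "spanned s (n + k) (u @ (replicate k (- x) @ [- x]) @ v) (pad u (wide_merge x k) v \<odot> A)"
  using A
proof (induction "u @ (x # replicate k (- x) @ [x]) @ v" A rule: spanned.induct)
  case (upward m A)
  then show ?case
    using spanned_mono[OF reducibleD(2)[OF r upward refl]] by simp
next
  case (cap u' x' v' B')
  then show ?case
    using Hom_comp[OF cap(2) Hom_pad[OF Hom_wide_merge]]
    unfolding comp_assoc[symmetric] by (intro spanned.cap)
next
  case (wide_merge u' x' k' v' B')
  then show ?case
    using Hom_comp[OF wide_merge(2) Hom_pad[OF Hom_wide_merge]]
    unfolding comp_assoc[symmetric] by (intro spanned.wide_merge)
qed (auto simp: comp_add_right comp_scale_right intro: spanned.intros)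

section \<open>Positions of a raising piece relative to a lowering piece above it\<close>

lemma append_pair_cases:
  assumes eq: "u' @ [p, q] @ v' = u @ d @ v" and d: "length d \<ge> 2"
  obtains (left) m where "u = u' @ [p, q] @ m" "v' = m @ d @ v"
  | (overlap_left) d' where "u = u' @ [p]" "d = q # d'" "v' = d' @ v"
  | (inside) d1 d2 where "d = d1 @ [p, q] @ d2" "u' = u @ d1" "v' = d2 @ v"
  | (overlap_right) d' where "d = d' @ [p]" "v = q # v'" "u' = u @ d'"
  | (right) m where "u' = u @ d @ m" "v = m @ [p, q] @ v'"
proof -
  consider (1) w where "u = u' @ w" "[p, q] @ v' = w @ d @ v"
    | (2) w where "u' = u @ w" "w @ [p, q] @ v' = d @ v"
    using eq unfolding append_eq_append_conv2 by blast
  then show ?thesis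
  proof cases
    case 1
    show ?thesis
    proof (cases w)
      case Nil
      moreover obtain a b d2 where "d = a # b # d2"
        using d by (cases d; cases "tl d") auto
      ultimately show ?thesis using 1 inside[of "[]" d2] by simp
    next
      case (Cons a w')
      then show ?thesis using 1 d overlap_left left by (cases w'; cases d) auto
    qed
  next
    case 2
    from 2(2) consider (3) m where "w = d @ m" "m @ [p, q] @ v' = v"
      | (4) m where "w @ m = d" "[p, q] @ v' = m @ v"
      unfolding append_eq_append_conv2 by blast
    then show ?thesis
    proof cases
      case 3
      then show ?thesis using 2 right by auto
    next
      case 4
      show ?thesis
      proof (cases m)
        case Nil
        then show ?thesis using 2 4 right[of "[]"] by simp
      next
        case (Cons a m')
        then show ?thesis using 2 4 overlap_right inside by (cases m') auto
      qed
    qed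
  qed
qed

lemma replicate_eq_append:
  assumes "replicate n x = v @ w"
  shows "v = replicate (length v) x" "w = replicate (length w) x" "n = length v + length w"
proof -
  show n: "n = length v + length w"
    using arg_cong[OF assms, of length] by simp
  have "take (length v) (replicate n x) = v" "drop (length v) (replicate n x) = w"
    unfolding assms by simp_all
  then show "v = replicate (length v) x" "w = replicate (length w) x"
    by (simp_all add: n)
qed

lemma inside_cases:
  assumes "x # replicate k (- x) @ [x] = d1 @ [p, q] @ d2"
  obtains (merge) "k = 0" "d1 = []" "p = x" "q = x" "d2 = []"
  | (first) k' where "k = Suc k'" "d1 = []" "p = x" "q = - x" "d2 = replicate k' (- x) @ [x]"
  | (last) k' where "k = Suc k'" "d1 = x # replicate k' (- x)" "p = - x" "q = x" "d2 = []"
  | (middle) i l where "k = i + 2 + l" "d1 = x # replicate i (- x)" "p = - x" "q = - x"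
      "d2 = replicate l (- x) @ [x]"
proof (cases d1)
  case Nil
  then show ?thesis using assms merge first by (cases k) auto
next
  case (Cons a e)
  show ?thesis
  proof (cases d2 rule: rev_cases)
    case Nil
    have "replicate k (- x) @ [x] = (e @ [p]) @ [q]"
      using assms unfolding Cons Nil by auto
    then have "replicate k (- x) = e @ [p]" "q = x"
      unfolding append1_eq_conv by blast+
    then show ?thesis
      using assms Cons Nil last[of "length e"] replicate_eq_append[of k "- x" e "[p]"] by auto
  next
    case (snoc f b)
    have "replicate k (- x) @ [x] = (e @ [p, q] @ f) @ [b]"
      using assms unfolding Cons snoc by auto
    then have "b = x" and N: "replicate k (- x) = e @ [p, q] @ f"
      unfolding append1_eq_conv by blast+
    have "e = replicate (length e) (- x)" "[p, q] @ f = replicate (length f + 2) (- x)"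
      "k = length e + 2 + length f"
      using replicate_eq_append[OF N] by simp_all
    then show ?thesis
      using assms Cons snoc \<open>b = x\<close> middle[of "length e" "length f"] by simp
  qed
qed

text \<open>Pieces side by side are exchanged, so the lowering piece meets the shorter web
  \<open>A\<close> first and the raising piece is put back on top.\<close>

lemma spanned_past_left:
  assumes B: "raising b c B" and D: "D \<in> Hom d d'"
    and A: "spanned s n ((u @ b @ m) @ d' @ v) (pad (u @ b @ m) D v \<odot> A)"
  shows "spanned s (Suc n) ((u @ c @ m) @ d' @ v) (pad (u @ c @ m) D v \<odot> pad u B (m @ d @ v) \<odot> A)"
proof -
  have "spanned s (Suc n) (u @ c @ (m @ d' @ v)) (pad u B (m @ d' @ v) \<odot> (pad (u @ b @ m) D v \<odot> A))"
    using A by (intro spanned_raise[OF _ B]) simp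
  then show ?thesis
    using pad_exchange[OF raising_Hom[OF B] D, of u m v, THEN comp_reassoc] by (simp add: comp_assoc)
qed

lemma spanned_past_right:
  assumes B: "raising b c B" and D: "D \<in> Hom d d'"
    and A: "spanned s n (u @ d' @ (m @ b @ v)) (pad u D (m @ b @ v) \<odot> A)"
  shows "spanned s (Suc n) (u @ d' @ (m @ c @ v)) (pad u D (m @ c @ v) \<odot> pad (u @ d @ m) B v \<odot> A)"
proof -
  have "spanned s (Suc n) ((u @ d' @ m) @ c @ v) (pad (u @ d' @ m) B v \<odot> (pad u D (m @ b @ v) \<odot> A))"
    using A by (intro spanned_raise[OF _ B]) simp
  then show ?thesis
    using pad_exchange[OF D raising_Hom[OF B], of u m v, THEN comp_reassoc] by (simp add: comp_assoc)
qed

lemma upward_spanned: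
  assumes "upward s n t A"
  shows "spanned s n t A" "ident t \<odot> A = A"
  using assms by (auto intro: spanned.upward ident_comp upward_Hom)

lemma spanned_merge:
  assumes "reducible s n" "spanned s n (u @ [x, x] @ v) A"
  shows "spanned s n (u @ [- x] @ v) (pad u (merge x) v \<odot> A)"
  using spanned_wide_merge[OF assms(1), of u x 0 v A] assms(2) by simp

text \<open>Every contact of a cap with a raising piece is resolved by a local relation, and the
  result has at most two lowering pieces directly on top of the shorter web
  \<open>A\<close>.\<close>

lemma spanned_cap_raise:
  assumes r: "reducible s n" and A: "upward s n (u' @ b @ v') A" and B: "raising b c B"
    and eq: "u' @ c @ v' = u @ [x, - x] @ v"
  shows "spanned s (Suc n) (u @ v) (pad u (cap x) v \<odot> pad u' B v' \<odot> A)"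
proof -
  obtain p q where c: "c = [p, q]" using B by cases auto
  note up = upward_spanned[OF A]
  have cap: "cap x \<in> Hom [x, - x] []" for x by (simp add: Hom_elementaryI)
  have Suc: "spanned s (Suc n) t C" if "spanned s n t C" for t C
    using that by (rule spanned_mono) simp
  have "length [x, - x] \<ge> 2" by simp
  with eq[unfolded c] show ?thesis
  proof (cases rule: append_pair_cases)
    case (left m)
    then have A': "spanned s n ((u' @ b @ m) @ [x, - x] @ v) A" using up by simp
    show ?thesis
      using spanned_past_left[where s=s and n=n and u=u' and m=m and v=v and A=A, OF B cap[of x]] spanned_cap[OF r A'] left by (simp add: c)
  next
    case (right m)
    then have A': "spanned s n (u @ [x, - x] @ (m @ b @ v')) A" using up by simp
    show ?thesis
      using spanned_past_right[where s=s and n=n and u=u and m=m and v=v' and A=A, OF B cap[of x]] spanned_cap[OF r A'] right by (simp add: c)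
  next
    case (overlap_left d')
    then have d: "q = x" "d' = [- x]" by auto
    note eqs = overlap_left(1,3) d
    from B have "spanned s n (u @ v) (pad u (cap x) v \<odot> pad u' B v' \<odot> A)"
    proof cases
      case (cup y)
      have y: "y = - x" "p = - x" using cup(2) c d by simp_all
      show ?thesis
        using pad_comp[OF zigzag_right, of u' "- x" v, THEN comp_reassoc, of A] up
        by (simp add: eqs cup(1,3) y tens_assoc)
    next
      case (fork y)
      have y: "y = - x" "p = x" using fork(2) c d by auto
      have "pad u (cap x) v \<odot> pad u' B v' \<odot> A = pad u' (merge (- x)) v \<odot> A"
        using pad_comp[OF cap_fork_right[of "- x"], of u' v, THEN comp_reassoc, of A]
        by (simp add: eqs fork(3) y tens_assoc)
      then show ?thesis
        using spanned_merge[OF r, of u' "- x" v A] up(1) by (simp add: eqs fork(1) y)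
    next
      case (crossing y)
      have y: "y = x" "p = - x" using crossing(2) c d by auto
      have "pad u (cap x) v \<odot> pad u' B v' \<odot> A = pad u' (merge x) v \<odot> pad (u' @ [x]) (merge (- x)) v \<odot> A"
        using pad_comp[OF cap_crossing_right[of x], of u' v, THEN comp_reassoc, of A]
        by (simp add: eqs crossing(3) y normalize)
      moreover have A1: "spanned s n ((u' @ [x]) @ [- x, - x] @ v) A"
        using up(1) by (simp add: eqs crossing(1) y)
      have "spanned s n (u' @ [x, x] @ v) (pad (u' @ [x]) (merge (- x)) v \<odot> A)"
        using spanned_merge[OF r A1] by simp
      from spanned_merge[OF r this] have "spanned s n (u @ v) (pad u' (merge x) v \<odot> pad (u' @ [x]) (merge (- x)) v \<odot> A)"
        by (simp add: eqs y)
      ultimately show ?thesis by simp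
    qed
    then show ?thesis by (rule Suc)
  next
    case (overlap_right d')
    then have d: "p = - x" "d' = [x]" by auto
    note eqs = overlap_right(2,3) d
    from B have "spanned s n (u @ v) (pad u (cap x) v \<odot> pad u' B v' \<odot> A)"
    proof cases
      case (cup y)
      have y: "y = - x" "q = x" using cup(2) c d by (cases x; cases y; simp)+
      show ?thesis
        using pad_comp[OF zigzag_left, of u x v', THEN comp_reassoc, of A] up
        by (simp add: eqs cup(1,3) y tens_assoc)
    next
      case (fork y)
      have y: "y = x" "q = - x" using fork(2) c d by (cases x; cases y; simp)+
      have "pad u (cap x) v \<odot> pad u' B v' \<odot> A = pad u (merge x) v' \<odot> A"
        using pad_comp[OF cap_fork_left[of x], of u v', THEN comp_reassoc, of A]
        by (simp add: eqs fork(3) y tens_assoc)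
      then show ?thesis
        using spanned_merge[OF r, of u x v' A] up(1) by (simp add: eqs fork(1) y)
    next
      case (crossing y)
      have y: "y = x" "q = x" using crossing(2) c d by (cases x; cases y; simp)+
      have "pad u (cap x) v \<odot> pad u' B v' \<odot> A = pad u (merge (- x)) v' \<odot> pad u (merge x) (- x # v') \<odot> A"
        using pad_comp[OF cap_crossing_left[of x], of u v', THEN comp_reassoc, of A]
        by (simp add: eqs crossing(3) y normalize)
      moreover have A1: "spanned s n (u @ [x, x] @ (- x # v')) A"
        using up(1) by (simp add: eqs crossing(1) y)
      have "spanned s n (u @ [- x, - x] @ v') (pad u (merge x) (- x # v') \<odot> A)"
        using spanned_merge[OF r A1] by simp
      from spanned_merge[OF r this] have "spanned s n (u @ v) (pad u (merge (- x)) v' \<odot> pad u (merge x) (- x # v') \<odot> A)"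
        by (simp add: eqs y)
      ultimately show ?thesis by simp
    qed
    then show ?thesis by (rule Suc)
  next
    case (inside d1 d2)
    then have d: "d1 = []" "d2 = []" "p = x" "q = - x" by (cases d1; auto simp: Cons_eq_append_conv)+
    note eqs = inside(2,3) d
    from B have "spanned s n (u @ v) (pad u (cap x) v \<odot> pad u' B v' \<odot> A)"
    proof cases
      case (cup y)
      have y: "y = x" using cup(2) c d by simp
      have "pad u (cap x) v \<odot> pad u' B v' \<odot> A = scale (qint 3) A"
        using pad_comp[OF cap_cup[of x], of u v, THEN comp_reassoc, of A] up
        by (simp add: eqs cup(1,3) y tens_scale_left tens_scale_right comp_scale_left)
      then show ?thesis using up(1) by (simp add: eqs cup(1) spanned.scale)
    next
      case (fork y)
      then show ?thesis using c d by (cases x; cases y) auto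
    next
      case (crossing y)
      have y: "y = - x" using crossing(2) c d by auto
      have "pad u (cap x) v \<odot> pad u' B v' \<odot> A = scale (- qint 2) (pad u (cap (- x)) v \<odot> A)"
        using pad_comp[OF cap_crossing[of "- x"], of u v, THEN comp_reassoc, of A]
        by (simp add: eqs crossing(3) y tens_scale_left tens_scale_right comp_scale_left)
      then show ?thesis
        using spanned_cap[OF r, of u "- x" v A] up(1) by (simp add: eqs crossing(1) y spanned.scale)
    qed
    then show ?thesis by (rule Suc)
  qed
qed

text \<open>Here the family of wide merges proves to be closed: a crossing at either end is absorbed
  into the width, and a fork between the passed strands gives two terms with a narrower merge each.
  The count survives since \<open>n + Suc k = Suc n + k\<close>.\<close>

lemma spanned_wide_merge_raise:
  assumes r: "reducible s n" and A: "upward s n (u' @ b @ v') A" and B: "raising b c B"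
    and eq: "u' @ c @ v' = u @ (x # replicate k (- x) @ [x]) @ v"
  shows "spanned s (Suc n + k) (u @ (replicate k (- x) @ [- x]) @ v)
    (pad u (wide_merge x k) v \<odot> pad u' B v' \<odot> A)"
proof -
  obtain p q where c: "c = [p, q]" using B by cases auto
  note up = upward_spanned[OF A]
  let ?N = "\<lambda>k. replicate k (- x)"
  have N: "?N (Suc k) = ?N k @ [- x]" for k
    by (simp add: replicate_append_same)
  \<comment> \<open>General in \<open>n\<close>, because after a narrower wide merge of width
    \<open>i\<close> the web may already have \<open>n + i\<close> pieces.\<close>
  have fork_left': "spanned s (Suc (n + k)) (w @ [- x, - x] @ ?N k @ w')
      (pad w ((fork x \<otimes> ident (?N k)) \<odot> sweep_left x (?N k)) w' \<odot> C)"
    if "spanned s n (w @ ?N k @ x # w') C" for w w' n k C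
    using spanned_raise[OF _ raising.fork, of s "n + k" w x "?N k @ w'"] spanned_sweep_left[OF that]
    by (simp add: normalize)
  note fork_left = fork_left'[where n = n]
  have fork_right: "spanned s (Suc (n + k)) (w @ ?N k @ [- x, - x] @ w')
      (pad w ((ident (?N k) \<otimes> fork x) \<odot> sweep x (?N k)) w' \<odot> C)"
    if "spanned s n (w @ x # ?N k @ w') C" for w w' k C
    using spanned_raise[OF _ raising.fork, of s "n + k" "w @ ?N k" x w'] spanned_sweep[OF that]
    by (simp add: normalize)
  have "length (x # replicate k (- x) @ [x]) \<ge> 2" by simp
  with eq[unfolded c] show ?thesis
  proof (cases rule: append_pair_cases)
    case (left m)
    then have A': "spanned s n ((u' @ b @ m) @ (x # ?N k @ [x]) @ v) A" using up by simp
    show ?thesis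
      using spanned_past_left[where s=s and n="n + k" and u=u' and m=m and v=v and A=A, OF B Hom_wide_merge[of x k]]
        spanned_wide_merge[OF r A'] left by (simp add: c)
  next
    case (right m)
    then have A': "spanned s n (u @ (x # ?N k @ [x]) @ (m @ b @ v')) A" using up by simp
    show ?thesis
      using spanned_past_right[where s=s and n="n + k" and u=u and m=m and v=v' and A=A, OF B Hom_wide_merge[of x k]]
        spanned_wide_merge[OF r A'] right by (simp add: c)
  next
    case (overlap_left d')
    then have d: "q = x" "d' = ?N k @ [x]" by auto
    note eqs = overlap_left(1,3) d
    from B show ?thesis
    proof cases
      case (cup y)
      have y: "y = - x" "p = - x" using cup(2) c d by simp_all
      have "pad u (wide_merge x k) v \<odot> pad u' B v' \<odot> A =
          pad u' ((fork x \<otimes> ident (?N k)) \<odot> sweep_left x (?N k)) v \<odot> A"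
        using pad_comp[OF wide_merge_cup_left[of x k], of u' v, THEN comp_reassoc, of A]
        by (simp add: eqs cup(3) y tens_assoc)
      then show ?thesis
        using fork_left[of u' k v A] up(1) by (simp add: eqs cup(1) y replicate_append_same)
    next
      case (fork y)
      have y: "y = - x" "p = x" using fork(2) c d by auto
      have "pad u (wide_merge x k) v \<odot> pad u' B v' \<odot> A = pad u' (sweep_left x (?N (Suc k))) v \<odot> A"
        using pad_comp[OF wide_merge_fork_left[of x k], of u' v, THEN comp_reassoc, of A]
        by (simp add: eqs fork(3) y tens_assoc)
      then show ?thesis
        using spanned_sweep_left[of s n u' "Suc k" x v A] up(1)
        by (simp add: eqs fork(1) y replicate_append_same)
    next
      case (crossing y)
      have y: "y = x" "p = - x" using crossing(2) c d by auto
      have "pad u (wide_merge x k) v \<odot> pad u' B v' \<odot> A = pad u' (wide_merge x (Suc k)) v \<odot> A"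
        using pad_comp[OF wide_merge_Suc[of x k, symmetric], of u' v, THEN comp_reassoc, of A]
        by (simp add: eqs crossing(3) y tens_assoc)
      then show ?thesis
        using spanned_wide_merge[OF r, of u' x "Suc k" v A] up(1)
        by (simp add: eqs crossing(1) y)
    qed
  next
    case (overlap_right d')
    then have d: "p = x" "d' = x # ?N k" using append1_eq_conv[of "x # ?N k" x d' p] by auto
    note eqs = overlap_right(2,3) d
    from B show ?thesis
    proof cases
      case (cup y)
      have y: "y = x" "q = - x" using cup(2) c d by simp_all
      have "pad u (wide_merge x k) v \<odot> pad u' B v' \<odot> A =
          pad u ((ident (?N k) \<otimes> fork x) \<odot> sweep x (?N k)) v' \<odot> A"
        using pad_comp[OF wide_merge_cup_right[of x k], of u v', THEN comp_reassoc, of A]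
        by (simp add: eqs cup(3) y tens_assoc)
      then show ?thesis
        using fork_right[of u k v' A] up(1) by (simp add: eqs cup(1) y)
    next
      case (fork y)
      have y: "y = - x" "q = x" using fork(2) c d by auto
      have "pad u (wide_merge x k) v \<odot> pad u' B v' \<odot> A = pad u (sweep x (?N (Suc k))) v' \<odot> A"
        using pad_comp[OF wide_merge_fork_right[of x k], of u v', THEN comp_reassoc, of A]
        unfolding N by (simp add: eqs fork(3) y tens_assoc)
      then show ?thesis
        using spanned_sweep[of s n u x "Suc k" v' A] up(1)
        by (simp add: eqs fork(1) y replicate_app_Cons_same)
    next
      case (crossing y)
      have y: "y = - x" "q = - x" using crossing(2) c d by auto
      have "pad u (wide_merge x k) v \<odot> pad u' B v' \<odot> A = pad u (wide_merge x (Suc k)) v' \<odot> A"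
        using pad_comp[OF wide_merge_Suc'[of x k, symmetric], of u v', THEN comp_reassoc, of A]
        by (simp add: eqs crossing(3) y tens_assoc)
      then show ?thesis
        using spanned_wide_merge[OF r, of u x "Suc k" v' A] up(1)
        by (simp add: eqs crossing(1) y replicate_app_Cons_same)
    qed
  next
    case (inside d1 d2)
    from inside(1) show ?thesis
    proof (cases rule: inside_cases)
      case merge
      note eqs = inside(2,3) merge
      from B show ?thesis
      proof cases
        case (fork y)
        have y: "y = - x" using fork(2) c merge by auto
        have "pad u (wide_merge x k) v \<odot> pad u' B v' \<odot> A = scale (- qint 2) A"
          using pad_comp[OF merge_fork[of "- x"], of u v, THEN comp_reassoc, of A] up
          by (simp add: eqs fork(1,3) y tens_scale_left tens_scale_right comp_scale_left)
        then show ?thesis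
          using spanned_mono[OF up(1), of "Suc n"] by (simp add: eqs fork(1) y spanned.scale)
      qed (use c merge in \<open>(cases x; auto; fail)+\<close>)
    next
      case (first k')
      note eqs = inside(2,3) first
      from B show ?thesis
      proof cases
        case (cup y)
        have y: "y = x" using cup(2) c first by auto
        have "pad u (wide_merge x k) v \<odot> pad u' B v' \<odot> A =
            scale (- qint 2) (pad u ((fork x \<otimes> ident (?N k')) \<odot> sweep_left x (?N k')) v \<odot> A)"
          using pad_comp[OF wide_merge_inner_cup_left[of x k'], of u v, THEN comp_reassoc, of A]
          by (simp add: eqs cup(3) y tens_assoc tens_scale_left tens_scale_right comp_scale_left)
        then show ?thesis
          using spanned_mono[OF fork_left[of u k' v A], of "Suc n + k"] up(1)
          by (simp add: eqs cup(1) replicate_append_same spanned.scale)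
      next
        case (fork y)
        then show ?thesis using c first by (cases x) auto
      next
        case (crossing y)
        have y: "y = - x" using crossing(2) c first by auto
        have "pad u (wide_merge x k) v \<odot> pad u' B v' \<odot> A =
            pad (u @ [- x]) (wide_merge x k') v \<odot> A +
            pad u ((fork x \<otimes> ident (?N k')) \<odot> sweep_left x (?N k')) v \<odot> pad u (cap (- x)) (?N k' @ x # v) \<odot> A"
          using pad_comp[OF wide_merge_crossing_left[of x k'], of u v, THEN comp_reassoc, of A]
          by (simp add: eqs crossing(3) y normalize tens_add_left tens_add_right comp_add_left)
        moreover have "spanned s (n + k') ((u @ [- x]) @ (?N k' @ [- x]) @ v) (pad (u @ [- x]) (wide_merge x k') v \<odot> A)"
          using spanned_wide_merge[OF r, of "u @ [- x]" x k' v A] up(1)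
          by (simp add: eqs crossing(1) y)
        then have "spanned s (Suc n + k) (u @ (?N k @ [- x]) @ v) (pad (u @ [- x]) (wide_merge x k') v \<odot> A)"
          using spanned_mono[of s "n + k'" _ _ "Suc n + k"] by (simp add: eqs)
        moreover have "spanned s n (u @ (?N k' @ x # v)) (pad u (cap (- x)) (?N k' @ x # v) \<odot> A)"
          using spanned_cap[OF r, of u "- x" "?N k' @ x # v" A] up(1)
          by (simp add: eqs crossing(1) y)
        then have "spanned s (Suc n + k) (u @ (?N k @ [- x]) @ v)
            (pad u ((fork x \<otimes> ident (?N k')) \<odot> sweep_left x (?N k')) v \<odot> pad u (cap (- x)) (?N k' @ x # v) \<odot> A)"
          using spanned_mono[OF fork_left[of u k' v], of _ "Suc n + k"] by (simp add: eqs replicate_append_same)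
        ultimately show ?thesis by (simp add: spanned.add)
      qed
    next
      case (last k')
      note eqs = inside(2,3) last
      from B show ?thesis
      proof cases
        case (cup y)
        have y: "y = - x" using cup(2) c last by auto
        have "pad u (wide_merge x k) v \<odot> pad u' B v' \<odot> A =
            scale (- qint 2) (pad u ((ident (?N k') \<otimes> fork x) \<odot> sweep x (?N k')) v \<odot> A)"
          using pad_comp[OF wide_merge_inner_cup_right[of x k'], of u v, THEN comp_reassoc, of A]
          by (simp add: eqs cup(3) y tens_assoc tens_scale_left tens_scale_right comp_scale_left)
        then show ?thesis
          using spanned_mono[OF fork_right[of u k' v A], of "Suc n + k"] up(1)
          by (simp add: eqs cup(1) replicate_app_Cons_same spanned.scale)
      next
        case (fork y)
        then show ?thesis using c last by (cases x) auto
      next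
        case (crossing y)
        have y: "y = x" using crossing(2) c last by auto
        have "pad u (wide_merge x k) v \<odot> pad u' B v' \<odot> A =
            pad u (wide_merge x k') (- x # v) \<odot> A +
            pad u ((ident (?N k') \<otimes> fork x) \<odot> sweep x (?N k')) v \<odot> pad (u @ x # ?N k') (cap x) v \<odot> A"
          using pad_comp[OF wide_merge_crossing_right[of x k'], of u v, THEN comp_reassoc, of A]
          by (simp add: eqs crossing(3) y normalize tens_add_left tens_add_right comp_add_left)
        moreover have "spanned s (n + k') (u @ (?N k' @ [- x]) @ (- x # v)) (pad u (wide_merge x k') (- x # v) \<odot> A)"
          using spanned_wide_merge[OF r, of u x k' "- x # v" A] up(1)
          by (simp add: eqs crossing(1) y)
        then have "spanned s (Suc n + k) (u @ (?N k @ [- x]) @ v) (pad u (wide_merge x k') (- x # v) \<odot> A)"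
          using spanned_mono[of s "n + k'" _ _ "Suc n + k"] by (simp add: eqs replicate_app_Cons_same)
        moreover have "spanned s n ((u @ x # ?N k') @ v) (pad (u @ x # ?N k') (cap x) v \<odot> A)"
          using spanned_cap[OF r, of "u @ x # ?N k'" x v A] up(1)
          by (simp add: eqs crossing(1) y)
        then have "spanned s (Suc n + k) (u @ (?N k @ [- x]) @ v)
            (pad u ((ident (?N k') \<otimes> fork x) \<odot> sweep x (?N k')) v \<odot> pad (u @ x # ?N k') (cap x) v \<odot> A)"
          using spanned_mono[OF fork_right[of u k' v], of _ "Suc n + k"] by (simp add: eqs replicate_app_Cons_same)
        ultimately show ?thesis by (simp add: spanned.add)
      qed
    next
      case (middle i l)
      note eqs = inside(2,3) middle
      \<comment> \<open>The top word is read in two ways, according to where each of the two terms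
        of \<open>wide_merge_inner_fork\<close> has its fork.\<close>
      have M: "?N k @ [- x] = ?N i @ [- x, - x] @ ?N (Suc l)" "?N k @ [- x] = ?N (Suc i) @ [- x, - x] @ ?N l"
        by (simp_all add: middle replicate_add replicate_app_Cons_same replicate_append_same)
      from B show ?thesis
      proof cases
        case (cup y)
        then show ?thesis using c middle by (cases x) auto
      next
        case (fork y)
        have y: "y = x" using fork(2) c middle by (cases x; cases y) auto
        have "pad u (wide_merge x k) v \<odot> pad u' B v' \<odot> A =
            pad (u @ ?N i) (fork x) (?N (Suc l) @ v) \<odot> pad u (sweep x (?N i)) (?N (Suc l) @ v) \<odot>
              pad (u @ x # ?N i) (wide_merge x l) v \<odot> A +
            pad (u @ ?N (Suc i)) ((fork x \<otimes> ident (?N l)) \<odot> sweep_left x (?N l)) v \<odot>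
              pad u (wide_merge x i) (?N l @ x # v) \<odot> A"
          using pad_comp[OF wide_merge_inner_fork[of x i l], of u v, THEN comp_reassoc, of A]
          unfolding eqs fork(3) y
          by (simp add: normalize tens_add_left tens_add_right comp_add_left del: replicate.simps)
        moreover have "spanned s (n + l) ((u @ x # ?N i) @ (?N l @ [- x]) @ v) (pad (u @ x # ?N i) (wide_merge x l) v \<odot> A)"
          using spanned_wide_merge[OF r, of "u @ x # ?N i" x l v A] up(1)
          by (simp add: eqs fork(1) y)
        then have "spanned s (Suc (n + l + i)) ((u @ ?N i) @ [- x, - x] @ (?N (Suc l) @ v))
            (pad (u @ ?N i) (fork x) (?N (Suc l) @ v) \<odot> pad u (sweep x (?N i)) (?N (Suc l) @ v) \<odot>
              pad (u @ x # ?N i) (wide_merge x l) v \<odot> A)"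
          using spanned_sweep[of s "n + l" u x i "?N (Suc l) @ v"]
          by (intro spanned_raise[OF _ raising.fork]) (simp add: replicate_append_same)
        then have "spanned s (Suc n + k) (u @ (?N k @ [- x]) @ v)
            (pad (u @ ?N i) (fork x) (?N (Suc l) @ v) \<odot> pad u (sweep x (?N i)) (?N (Suc l) @ v) \<odot>
              pad (u @ x # ?N i) (wide_merge x l) v \<odot> A)"
          unfolding M(1) append_assoc by (rule spanned_mono) (simp add: middle)
        moreover have "spanned s (n + i) (u @ (?N i @ [- x]) @ (?N l @ x # v)) (pad u (wide_merge x i) (?N l @ x # v) \<odot> A)"
          using spanned_wide_merge[OF r, of u x i "?N l @ x # v" A] up(1)
          by (simp add: eqs fork(1) y)
        then have "spanned s (n + i) ((u @ ?N (Suc i)) @ ?N l @ x # v) (pad u (wide_merge x i) (?N l @ x # v) \<odot> A)"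
          by (simp add: replicate_app_Cons_same)
        from fork_left'[OF this]
        have "spanned s (Suc n + k) (u @ (?N k @ [- x]) @ v)
            (pad (u @ ?N (Suc i)) ((fork x \<otimes> ident (?N l)) \<odot> sweep_left x (?N l)) v \<odot>
              pad u (wide_merge x i) (?N l @ x # v) \<odot> A)"
          unfolding M(2) append_assoc by (rule spanned_mono) (simp add: middle)
        ultimately show ?thesis by (simp add: spanned.add)
      next
        case (crossing y)
        then show ?thesis using c middle by (cases x; cases y) auto
      qed
    qed
  qed
qed


lemma spanned_pad_cap:
  assumes "s = u @ [x, - x] @ v"
  shows "spanned s n (u @ v) (pad u (cap x) v)"
  using spanned.cap[OF assms Hom_ident, of n] Hom_pad_cap[of u x v] by (simp add: ident_comp)

lemma spanned_pad_wide_merge: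
  assumes "s = u @ (x # replicate k (- x) @ [x]) @ v"
  shows "spanned s n (u @ (replicate k (- x) @ [- x]) @ v) (pad u (wide_merge x k) v)"
  using spanned.wide_merge[OF assms Hom_ident, of n] by (simp only: ident_comp[OF Hom_pad[OF Hom_wide_merge]])

lemma reducible: "reducible s n"
proof (induction n)
  case 0
  show ?case
    unfolding reducible_def
  proof (intro allI impI conjI; elim conjE)
    fix m t A u x v
    assume "m \<le> 0" "upward s m t A" and t: "t = u @ [x, - x] @ v"
    then have A: "A = ident s" "t = s" by (auto elim: upward.cases)
    show "spanned s m (u @ v) (pad u (cap x) v \<odot> A)"
      using spanned_pad_cap[of s u x v m] t A comp_ident[OF Hom_pad_cap[of u x v]] by simp
  next
    fix m t A u x k v
    assume "m \<le> 0" "upward s m t A" and t: "t = u @ (x # replicate k (- x) @ [x]) @ v"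
    then have A: "A = ident s" "t = s" by (auto elim: upward.cases)
    show "spanned s (m + k) (u @ (replicate k (- x) @ [- x]) @ v) (pad u (wide_merge x k) v \<odot> A)"
      using spanned_pad_wide_merge[of s u x k v "m + k"] t A
        comp_ident[OF Hom_pad[OF Hom_wide_merge[of x k]], of u v] by simp
  qed
next
  case (Suc n)
  show ?case
    unfolding reducible_def
  proof (intro allI impI conjI; elim conjE)
    fix m t A u x v
    assume m: "m \<le> Suc n" and A: "upward s m t A" and t: "t = u @ [x, - x] @ v"
    show "spanned s m (u @ v) (pad u (cap x) v \<odot> A)"
    proof (cases "m = Suc n")
      case True
      from A True obtain u' b v' A' c B where "t = u' @ c @ v'" "A = pad u' B v' \<odot> A'"
        "upward s n (u' @ b @ v') A'" "raising b c B"
        by (auto elim: upward.cases)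
      then show ?thesis
        using spanned_cap_raise[OF Suc, of u' b v' A' c B u x v] t True by simp
    next
      case False
      then show ?thesis using reducibleD(1)[OF Suc A _ t] m by simp
    qed
  next
    fix m t A u x k v
    assume m: "m \<le> Suc n" and A: "upward s m t A" and t: "t = u @ (x # replicate k (- x) @ [x]) @ v"
    show "spanned s (m + k) (u @ (replicate k (- x) @ [- x]) @ v) (pad u (wide_merge x k) v \<odot> A)"
    proof (cases "m = Suc n")
      case True
      from A True obtain u' b v' A' c B where "t = u' @ c @ v'" "A = pad u' B v' \<odot> A'"
        "upward s n (u' @ b @ v') A'" "raising b c B"
        by (auto elim: upward.cases)
      then show ?thesis
        using spanned_wide_merge_raise[OF Suc, of u' b v' A' c B u x k v] t True by simp
    next
      case False
      then show ?thesis using reducibleD(2)[OF Suc A _ t] m by simp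
    qed
  qed
qed

text \<open>Webs are built from the bottom, one slice at a time: cups and forks raise, while caps
  and merges, which are wide merges of width 0, are pushed down by \<open>reducible\<close>.\<close>

lemma Hom_spanned: "A \<in> Hom s t \<Longrightarrow> \<exists>n. spanned s n t A"
proof (induction A rule: Hom_slice_induct)
  case (add s t A B)
  then obtain n m where "spanned s n t A" "spanned s m t B" by blast
  then have "spanned s (n + m) t (A + B)"
    by (intro spanned.add) (erule spanned_mono, simp)+
  then show ?case ..
next
  case (slice s u g v A)
  then obtain n where n: "spanned s n (u @ elem_bot g @ v) A" by blast
  show ?case
  proof (cases g)
    case (Cup x)
    then show ?thesis using spanned_raise[OF _ raising.cup, of s n u v A x] n by auto
  next
    case (Cap x)
    then show ?thesis using spanned_cap[OF reducible, of s n u x v A] n by auto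
  next
    case (Merge x)
    then show ?thesis using spanned_merge[OF reducible, of s n u x v A] n by auto
  next
    case (Split x)
    then show ?thesis using spanned_raise[OF _ raising.fork, of s n u x v A] n by auto
  qed
qed (auto intro: spanned.zero spanned.scale spanned.upward[OF upward.ident])

section \<open>Congruence modulo lower weights\<close>

lemma weight_gt_shift: "\<kappa> \<succ> \<mu> \<Longrightarrow> (fst \<kappa> + c, snd \<kappa> + d) \<succ> (fst \<mu> + c, snd \<mu> + d)"
proof (induction rule: weight_gt.induct)
  case (step1 a b)
  then show ?case using weight_gt.step1[of "a + c" "b + d"] by (simp add: algebra_simps)
next
  case (step2 a b)
  then show ?case using weight_gt.step2[of "a + c" "b + d"] by (simp add: algebra_simps)
next
  case (trans \<kappa> \<mu> \<nu>)
  then show ?case using weight_gt.trans by blast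
qed

lemma weight_append: "weight (s @ t) = (fst (weight s) + fst (weight t), snd (weight s) + snd (weight t))"
  by (simp add: weight_def)

lemma weight_gt_append: "weight s \<succ> weight t \<Longrightarrow> weight (u @ s @ v) \<succ> weight (u @ t @ v)"
  using weight_gt_shift[of "weight s" "weight t" "fst (weight u) + fst (weight v)" "snd (weight u) + snd (weight v)"]
  by (simp add: weight_append algebra_simps)

text \<open>Each generator of the order lowers a + b by 1, that is, the number of letters. Hence
  length alone separates upward webs from webs to a smaller weight.\<close>

lemma weight_gt_sum: "\<kappa> \<succ> \<mu> \<Longrightarrow> fst \<mu> + snd \<mu> < fst \<kappa> + snd \<kappa>"
  by (induction rule: weight_gt.induct) auto

lemma sum_weight: "fst (weight s) + snd (weight s) = int (length s)"
proof (induction s)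
  case (Cons x s)
  then show ?case by (cases x) (simp_all add: weight_def)
qed (simp add: weight_def)

lemma weight_gt_length: "weight s \<succ> weight t \<Longrightarrow> length t < length s"
  using weight_gt_sum[of "weight s" "weight t"] by (simp add: sum_weight)

lemma weight_cap: "weight (u @ [x, - x] @ v) \<succ> weight (u @ v)"
proof -
  \<comment> \<open>The way down passes through (2, -1), which is not the weight of a word.\<close>
  have "(1, 1) \<succ> (0, 0)"
    using weight_gt.trans[OF weight_gt.step1[of 1 1] weight_gt.step2[of "1 + 1" "1 - 2"]] by simp
  then have "weight [x, - x] \<succ> weight []"
    by (cases x) (simp_all add: weight_def)
  from weight_gt_append[OF this, of u v] show ?thesis by simp
qed

lemma weight_wide_merge:
  "weight (u @ (x # replicate k (- x) @ [x]) @ v) \<succ> weight (u @ (replicate k (- x) @ [- x]) @ v)"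
proof -
  have c: "count_list (replicate k y) z = (if y = z then k else 0)" for y z :: sign
    by (induction k) auto
  have "weight (x # replicate k (- x) @ [x]) \<succ> weight (replicate k (- x) @ [- x])"
    using weight_gt.step1[of k 2] weight_gt.step2[of 2 k]
    by (cases x) (simp_all add: weight_def c algebra_simps)
  then show ?thesis by (rule weight_gt_append)
qed

text \<open>The bound \<kappa> is kept apart from the ends, since the top may itself have a smaller
  weight and padding changes ends and bound together. For fixed \<kappa> these elements form a
  two-sided ideal.\<close>

inductive lower :: "int \<times> int \<Rightarrow> word \<Rightarrow> word \<Rightarrow> skein \<Rightarrow> bool" for \<kappa> s t where
  zero: "lower \<kappa> s t 0"
| add: "lower \<kappa> s t A \<Longrightarrow> lower \<kappa> s t B \<Longrightarrow> lower \<kappa> s t (A + B)"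
| scale: "lower \<kappa> s t A \<Longrightarrow> lower \<kappa> s t (scale c A)"
| factor: "A \<in> Hom s r \<Longrightarrow> B \<in> Hom r t \<Longrightarrow> \<kappa> \<succ> weight r \<Longrightarrow> lower \<kappa> s t (B \<odot> A)"

lemma lower_uminus: "lower \<kappa> s t A \<Longrightarrow> lower \<kappa> s t (- A)"
  using lower.scale[of \<kappa> s t A "- 1"] by (simp add: scale_minus_one)

lemma lower_diff: "lower \<kappa> s t A \<Longrightarrow> lower \<kappa> s t B \<Longrightarrow> lower \<kappa> s t (A - B)"
  using lower.add[OF _ lower_uminus, of \<kappa> s t A B] by simp

lemma lower_sum: "(\<And>i. i \<in> I \<Longrightarrow> lower \<kappa> s t (f i)) \<Longrightarrow> lower \<kappa> s t (sum f I)"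
  by (induction I rule: infinite_finite_induct) (auto intro: lower.intros)

lemma lower_trans: "lower \<kappa> s t (A - B) \<Longrightarrow> lower \<kappa> s t (B - C) \<Longrightarrow> lower \<kappa> s t (A - C)"
  using lower.add[of \<kappa> s t "A - B" "B - C"] by simp

lemma lower_commute: "lower \<kappa> s t (A - B) \<Longrightarrow> lower \<kappa> s t (B - A)"
  using lower_uminus[of \<kappa> s t "A - B"] by simp

lemma lower_comp_left: "lower \<kappa> s t A \<Longrightarrow> B \<in> Hom t u \<Longrightarrow> lower \<kappa> s u (B \<odot> A)"
proof (induction rule: lower.induct)
  case (factor A r C)
  then show ?case
    using lower.factor[OF factor(1) Hom_comp[OF factor(2,4)] factor(3)] by (simp add: comp_assoc)
qed (auto simp: comp_add_right comp_scale_right intro: lower.intros)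

lemma lower_comp_right: "lower \<kappa> s t A \<Longrightarrow> B \<in> Hom u s \<Longrightarrow> lower \<kappa> u t (A \<odot> B)"
proof (induction rule: lower.induct)
  case (factor A r C)
  then show ?case
    using lower.factor[OF Hom_comp[OF factor(4,1)] factor(2,3)] by (simp add: comp_assoc)
qed (auto simp: comp_add_left comp_scale_left intro: lower.intros)

lemma comp_diff_left: "(A - B) \<odot> C = A \<odot> C - B \<odot> C"
  using comp_add_left[of "A - B" B C] by (simp add: algebra_simps)

lemma comp_diff_right: "C \<odot> (A - B) = C \<odot> A - C \<odot> B"
  using comp_add_right[of C "A - B" B] by (simp add: algebra_simps)

lemma tens_diff_left: "(A - B) \<otimes> C = A \<otimes> C - B \<otimes> C"
  using tens_add_left[of "A - B" B C] by (simp add: algebra_simps)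

lemma tens_diff_right: "C \<otimes> (A - B) = C \<otimes> A - C \<otimes> B"
  using tens_add_right[of C "A - B" B] by (simp add: algebra_simps)

lemma lower_tens_left:
  assumes "lower (weight w) s t A"
  shows "lower (weight (u @ w)) (u @ s) (u @ t) (ident u \<otimes> A)"
  using assms
proof (induction rule: lower.induct)
  case (factor A r C)
  then show ?case
    using lower.factor[OF Hom_tens[OF Hom_ident factor(1)] Hom_tens[OF Hom_ident factor(2)]]
      weight_gt_append[OF factor(3), of u "[]"]
    by (simp add: ident_tens_comp)
qed (auto simp: tens_add_right tens_scale_right intro: lower.intros)

lemma lower_tens_right:
  assumes "lower (weight w) s t A"
  shows "lower (weight (w @ v)) (s @ v) (t @ v) (A \<otimes> ident v)"
  using assms
proof (induction rule: lower.induct)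
  case (factor A r C)
  then show ?case
    using lower.factor[OF Hom_tens[OF factor(1) Hom_ident] Hom_tens[OF factor(2) Hom_ident]]
      weight_gt_append[OF factor(3), of "[]" v]
    by (simp add: comp_tens_ident)
qed (auto simp: tens_add_left tens_scale_left intro: lower.intros)

section \<open>Chains of resolved crossings\<close>

inductive flat :: "word \<Rightarrow> word \<Rightarrow> skein \<Rightarrow> bool" for s where
  ident: "flat s s (ident s)"
| cross: "flat s (u @ [x, - x] @ v) A \<Longrightarrow> flat s (u @ [- x, x] @ v) (pad u (crossing x (- x)) v \<odot> A)"

lemma Hom_pad_crossing: "pad u (crossing x (- x)) v \<in> Hom (u @ [x, - x] @ v) (u @ [- x, x] @ v)"
  by (intro Hom_pad Hom_crossing)

lemma flat_Hom: "flat s t A \<Longrightarrow> A \<in> Hom s t"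
  by (induction rule: flat.induct) (auto intro: Hom_comp[OF _ Hom_pad_crossing, simplified])

lemma flat_weight: "flat s t A \<Longrightarrow> weight t = weight s"
  by (induction rule: flat.induct) (auto simp: weight_def elim: sign.exhaust)

lemma flat_comp: "flat t u B \<Longrightarrow> flat s t A \<Longrightarrow> flat s u (B \<odot> A)"
proof (induction rule: flat.induct)
  case ident
  then show ?case using ident_comp[OF flat_Hom] by simp
next
  case (cross u x v B)
  then show ?case using flat.cross[of s u x v "B \<odot> A"] by (simp add: comp_assoc)
qed

lemma flat_crossing: "flat (u @ [x, - x] @ v) (u @ [- x, x] @ v) (pad u (crossing x (- x)) v)"
  using flat.cross[OF flat.ident] comp_ident[OF Hom_pad_crossing, of u x v] by metis

lemma flat_tens_left: "flat s t A \<Longrightarrow> flat (w @ s) (w @ t) (ident w \<otimes> A)"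
proof (induction rule: flat.induct)
  case ident
  show ?case using flat.ident by simp
next
  case (cross u x v A)
  then show ?case using flat.cross[of "w @ s" "w @ u" x v] by (simp add: normalize)
qed

lemma flat_tens_right: "flat s t A \<Longrightarrow> flat (s @ w) (t @ w) (A \<otimes> ident w)"
proof (induction rule: flat.induct)
  case ident
  show ?case using flat.ident by simp
next
  case (cross u x v A)
  then show ?case using flat.cross[of "s @ w" u x "v @ w"] by (simp add: normalize)
qed

text \<open>The second term of the square relation is a cup over a cap, which passes through the
  smaller weight of \<open>u @ v\<close>.\<close>

lemma pad_crossing_inverse:
  "lower (weight (u @ [x, - x] @ v)) (u @ [x, - x] @ v) (u @ [x, - x] @ v)
     (pad u (crossing (- x) x) v \<odot> pad u (crossing x (- x)) v - ident (u @ [x, - x] @ v))"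
proof -
  have cup: "pad u (cup x) v \<in> Hom (u @ v) (u @ [x, - x] @ v)"
    using Hom_pad[OF Hom_elementary[of "Cup x"], of u v] by simp
  have "pad u (crossing (- x) x) v \<odot> pad u (crossing x (- x)) v - ident (u @ [x, - x] @ v) =
      pad u (cup x) v \<odot> pad u (cap x) v"
    using pad_comp[OF crossing_crossing[of x], of u v]
    by (simp add: tens_add_left tens_add_right normalize)
  then show ?thesis
    using lower.factor[OF Hom_pad_cap cup weight_cap] by simp
qed

text \<open>The chain is undone by crossing back in reverse order.\<close>

lemma flat_inverse:
  assumes "flat s t A"
  obtains B where "flat t s B" "lower (weight s) s s (B \<odot> A - ident s)" "lower (weight s) t t (A \<odot> B - ident t)"
  using assms
proof (induction arbitrary: thesis rule: flat.induct)
  case ident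
  show ?case
    by (rule ident[of "ident s"]) (simp_all add: flat.ident ident_comp[OF Hom_ident] lower.zero)
next
  case (cross u x v A)
  obtain B where B: "flat (u @ [x, - x] @ v) s B" "lower (weight s) s s (B \<odot> A - ident s)"
    "lower (weight s) (u @ [x, - x] @ v) (u @ [x, - x] @ v) (A \<odot> B - ident (u @ [x, - x] @ v))"
    using cross.IH by blast
  let ?H = "pad u (crossing x (- x)) v" and ?H' = "pad u (crossing (- x) x) v"
  have w: "weight (u @ [x, - x] @ v) = weight s" "weight (u @ [- x, x] @ v) = weight s"
    using flat_weight[OF cross.hyps] flat_weight[OF flat_crossing[of u x v]] by simp_all
  have H': "flat (u @ [- x, x] @ v) (u @ [x, - x] @ v) ?H'"
    using flat_crossing[of u "- x" v] by simp
  note Hom = flat_Hom[OF cross.hyps] flat_Hom[OF B(1)] flat_Hom[OF H'] flat_Hom[OF flat_crossing[of u x v]]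
  have "lower (weight s) s s (B \<odot> (?H' \<odot> ?H - ident (u @ [x, - x] @ v)) \<odot> A)"
    using lower_comp_left[OF lower_comp_right[OF pad_crossing_inverse Hom(1)] Hom(2)] w by simp
  then have "lower (weight s) s s ((B \<odot> ?H') \<odot> (?H \<odot> A) - B \<odot> A)"
    by (simp add: comp_diff_left comp_diff_right comp_assoc ident_comp[OF Hom(1), simplified])
  then have 1: "lower (weight s) s s ((B \<odot> ?H') \<odot> (?H \<odot> A) - ident s)"
    by (rule lower_trans) (rule B(2))
  have "lower (weight s) (u @ [- x, x] @ v) (u @ [- x, x] @ v) (?H \<odot> (A \<odot> B - ident (u @ [x, - x] @ v)) \<odot> ?H')"
    using lower_comp_left[OF lower_comp_right[OF B(3) Hom(3)] Hom(4)] .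
  then have "lower (weight s) (u @ [- x, x] @ v) (u @ [- x, x] @ v) ((?H \<odot> A) \<odot> (B \<odot> ?H') - ?H \<odot> ?H')"
    by (simp add: comp_diff_left comp_diff_right comp_assoc ident_comp[OF Hom(3), simplified])
  then have 2: "lower (weight s) (u @ [- x, x] @ v) (u @ [- x, x] @ v)
      ((?H \<odot> A) \<odot> (B \<odot> ?H') - ident (u @ [- x, x] @ v))"
    by (rule lower_trans) (use pad_crossing_inverse[of u "- x" v] w in simp)
  show ?case
    by (rule cross.prems[OF flat_comp[OF B(1) H'] 1 2])
qed

definition segregated :: "word \<Rightarrow> word" where
  "segregated s = replicate (count_list s Minus) Minus @ replicate (count_list s Plus) Plus"

text \<open>Insertion sort by crossings: a fixed chain with which others are compared. Its
  compatibility with \<open>Cons\<close> carries the induction in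
  \<open>segregate_crossing\<close>.\<close>

fun segregate :: "word \<Rightarrow> skein" where
  "segregate [] = ident []"
| "segregate (Minus # s) = ident [Minus] \<otimes> segregate s"
| "segregate (Plus # s) =
    (sweep Plus (replicate (count_list s Minus) Minus) \<otimes> ident (replicate (count_list s Plus) Plus)) \<odot>
    (ident [Plus] \<otimes> segregate s)"

lemma flat_sweep: "flat (x # replicate k (- x)) (replicate k (- x) @ [x]) (sweep x (replicate k (- x)))"
proof (induction k)
  case 0
  show ?case using flat.ident by simp
next
  case (Suc k)
  show ?case
    using flat_comp[OF flat_tens_left[OF Suc, of "[- x]", simplified] flat_crossing[of "[]" x "replicate k (- x)", simplified]]
    by simp
qed

lemma flat_sweep_left: "flat (replicate k (- x) @ [x]) (x # replicate k (- x)) (sweep_left x (replicate k (- x)))"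
proof (induction k)
  case 0
  show ?case using flat.ident by simp
next
  case (Suc k)
  show ?case
    using flat_comp[OF flat_crossing[of "[]" "- x" "replicate k (- x)", simplified] flat_tens_left[OF Suc, of "[- x]", simplified]]
    by simp
qed

lemma flat_segregate: "flat s (segregated s) (segregate s)"
proof (induction s rule: segregate.induct)
  case 1
  show ?case using flat.ident by (simp add: segregated_def)
next
  case (2 s)
  then show ?case using flat_tens_left[OF 2, of "[Minus]"] by (simp add: segregated_def)
next
  case (3 s)
  show ?case
    using flat_comp[OF flat_tens_right[OF flat_sweep[of Plus "count_list s Minus"],
          of "replicate (count_list s Plus) Plus", simplified]
        flat_tens_left[OF 3, of "[Plus]", unfolded segregated_def, simplified]]
    by (simp add: segregated_def)
qed

text \<open>At the head of the word and for \<open>x = Plus\<close> the crossing is a step of the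
  sorting chain up to exchange of heights. For \<open>x = Minus\<close> sorting undoes it at once,
  and the double crossing is the identity up to a cup over a cap. Letters in front are added by
  induction.\<close>

lemma segregate_crossing:
  "lower (weight (u @ [x, - x] @ v)) (u @ [x, - x] @ v) (segregated (u @ [x, - x] @ v))
     (segregate (u @ [- x, x] @ v) \<odot> pad u (crossing x (- x)) v - segregate (u @ [x, - x] @ v))"
proof (induction u)
  case Nil
  note N = flat_Hom[OF flat_segregate[of v]]
  have plus: "segregate (Plus # Minus # v) = segregate (Minus # Plus # v) \<odot> (crossing Plus Minus \<otimes> ident v)"
  proof -
    have "(ident [Minus, Plus] \<otimes> segregate v) \<odot> (crossing Plus Minus \<otimes> ident v) =
        (crossing Plus Minus \<otimes> ident (segregated v)) \<odot> (ident [Plus, Minus] \<otimes> segregate v)"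
      by (rule exchange[OF Hom_crossing N])
    then show ?thesis by (simp add: normalize segregated_def)
  qed
  show ?case
  proof (cases x)
    case Plus
    then show ?thesis using plus lower.zero by simp
  next
    case Minus
    have "lower (weight (Minus # Plus # v)) (Minus # Plus # v) (segregated (Minus # Plus # v))
        (segregate (Minus # Plus # v) \<odot> (pad [] (crossing Plus Minus) v \<odot> pad [] (crossing Minus Plus) v
          - ident (Minus # Plus # v)))"
      using lower_comp_left[OF pad_crossing_inverse[of "[]" Minus v] flat_Hom[OF flat_segregate], simplified] by simp
    then show ?thesis
      unfolding Minus using plus comp_ident[OF flat_Hom[OF flat_segregate[of "Minus # Plus # v"]]]
      by (simp add: comp_diff_right comp_assoc segregated_def del: segregate.simps)
  qed
next
  case (Cons y u)
  have c: "count_list (u @ [- x, x] @ v) z = count_list (u @ [x, - x] @ v) z" for z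
    by (cases x) auto
  let ?D = "segregate (u @ [- x, x] @ v) \<odot> pad u (crossing x (- x)) v - segregate (u @ [x, - x] @ v)"
  have L: "lower (weight ([y] @ u @ [x, - x] @ v)) ([y] @ u @ [x, - x] @ v) ([y] @ segregated (u @ [x, - x] @ v))
      (ident [y] \<otimes> ?D)"
    by (rule lower_tens_left[OF Cons])
  show ?case
  proof (cases y)
    case Minus
    then show ?thesis using L by (simp add: tens_diff_right normalize segregated_def)
  next
    case Plus
    let ?b = "count_list (u @ [x, - x] @ v) Minus" and ?a = "count_list (u @ [x, - x] @ v) Plus"
    have S: "sweep Plus (replicate ?b Minus) \<otimes> ident (replicate ?a Plus) \<in>
        Hom ([Plus] @ segregated (u @ [x, - x] @ v)) (segregated ([Plus] @ u @ [x, - x] @ v))"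
      using flat_Hom[OF flat_tens_right[OF flat_sweep[of Plus ?b], of "replicate ?a Plus"]]
      by (simp add: segregated_def)
    show ?thesis
      using lower_comp_left[OF L[unfolded Plus] S] Plus c[of Minus] c[of Plus]
      by (simp add: comp_diff_right tens_diff_right normalize del: count_list_append)
  qed
qed

lemma segregate_flat:
  "flat s t A \<Longrightarrow> lower (weight s) s (segregated s) (segregate t \<odot> A - segregate s)"
proof (induction rule: flat.induct)
  case ident
  show ?case using comp_ident[OF flat_Hom[OF flat_segregate]] by (simp add: lower.zero)
next
  case (cross u x v A)
  have s: "segregated (u @ [x, - x] @ v) = segregated s" "weight (u @ [x, - x] @ v) = weight s"
    using flat_weight[OF cross.hyps] by (simp_all add: weight_def segregated_def)
  have "lower (weight s) s (segregated s)
      ((segregate (u @ [- x, x] @ v) \<odot> pad u (crossing x (- x)) v - segregate (u @ [x, - x] @ v)) \<odot> A)"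
    using lower_comp_right[OF segregate_crossing flat_Hom[OF cross.hyps]] s by simp
  then have "lower (weight s) s (segregated s)
      (segregate (u @ [- x, x] @ v) \<odot> (pad u (crossing x (- x)) v \<odot> A) - segregate (u @ [x, - x] @ v) \<odot> A)"
    by (simp add: comp_diff_left comp_assoc)
  then show ?case by (rule lower_trans) (rule cross.IH)
qed

text \<open>Both chains agree with the standard sorting chain after \<open>segregate t\<close>, which is invertible.\<close>

lemma flat_unique:
  assumes A: "flat s t A" and B: "flat s t B"
  shows "lower (weight s) s t (A - B)"
proof -
  obtain C where C: "flat (segregated t) t C" "lower (weight t) t t (C \<odot> segregate t - ident t)"
    using flat_inverse[OF flat_segregate[of t]] by blast
  have w: "weight t = weight s" using flat_weight[OF A] .
  have "lower (weight s) s t (C \<odot> (segregate t \<odot> A - segregate t \<odot> B))"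
  proof (rule lower_comp_left[OF lower_trans])
    show "C \<in> Hom (segregated s) t"
      using flat_Hom[OF C(1)] w by (simp add: segregated_def weight_def)
    show "lower (weight s) s (segregated s) (segregate t \<odot> A - segregate s)"
      by (rule segregate_flat[OF A])
    show "lower (weight s) s (segregated s) (segregate s - segregate t \<odot> B)"
      by (rule lower_commute[OF segregate_flat[OF B]])
  qed
  moreover have "lower (weight s) s t ((C \<odot> segregate t - ident t) \<odot> (A - B))"
    using lower_comp_right[OF C(2) Hom_diff[OF flat_Hom[OF A] flat_Hom[OF B]]] w by simp
  ultimately have "lower (weight s) s t (C \<odot> (segregate t \<odot> A - segregate t \<odot> B) - (C \<odot> segregate t - ident t) \<odot> (A - B))"
    by (rule lower_diff)
  then show ?thesis
    by (simp add: comp_diff_left comp_diff_right comp_assoc ident_comp[OF flat_Hom[OF A]]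
        ident_comp[OF flat_Hom[OF B]])
qed

text \<open>A cup adds two letters, a fork one, a crossing none.\<close>

lemma upward_length: "upward s n t A \<Longrightarrow> length s \<le> length t \<and> (length t = length s \<longrightarrow> flat s t A)"
proof (induction rule: upward.induct)
  case (raise n u b v A c B)
  from raise.hyps(2) show ?case
    by cases (use raise.IH in \<open>auto intro: flat.cross[simplified]\<close>)
qed (auto intro: flat.ident)

text \<open>By length, an upward web from \<open>s\<close> to \<open>t\<close> is a chain of
  crossings and so congruent to \<open>A\<close> by \<open>flat_unique\<close>; the other terms go
  through a smaller weight.\<close>

lemma spanned_flat:
  assumes "flat s t A" "spanned s n t B"
  shows "\<exists>c. lower (weight s) s t (B - scale c A)"
proof -
  have len: "length t = length s"
    using flat_weight[OF assms(1)] sum_weight[of s] sum_weight[of t] by simp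
  from assms(2) show ?thesis
    using assms(1) len
  proof (induction rule: spanned.induct)
    case (zero t)
    then show ?case by (auto intro!: exI[of _ 0] lower.zero)
  next
    case (add t B B')
    then obtain c c' where "lower (weight s) s t (B - scale c A)" "lower (weight s) s t (B' - scale c' A)"
      by blast
    from lower.add[OF this] show ?case
      by (intro exI[of _ "c + c'"]) (simp add: scale_add_left algebra_simps)
  next
    case (scale t B d)
    then obtain c where "lower (weight s) s t (B - scale c A)" by blast
    from lower.scale[OF this, of d] show ?case
      using scale_add_right[of d "B - scale c A" "scale c A"]
      by (intro exI[of _ "d * c"]) (simp add: algebra_simps)
  next
    case (upward m t B)
    then show ?case
      using flat_unique[of s t B A] upward_length[of s m t B] by (intro exI[of _ 1]) simp
  next
    case (cap u x v B t)
    then show ?case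
      using lower.factor[OF Hom_pad_cap[of u x v] cap(2) weight_cap] by (intro exI[of _ 0]) simp
  next
    case (wide_merge u x k v B t)
    then show ?case
      using lower.factor[OF Hom_pad[OF Hom_wide_merge[of x k]] wide_merge(2) weight_wide_merge]
      by (intro exI[of _ 0]) simp
  qed
qed

section \<open>Clasps\<close>

lemma clasp_lower:
  assumes "is_clasp s P"
  shows "lower (weight s) s t A \<Longrightarrow> A \<odot> P = 0" and "lower (weight s) t s A \<Longrightarrow> P \<odot> A = 0"
proof -
  show "A \<odot> P = 0" if "lower (weight s) s t A"
    using that
  proof (induction rule: lower.induct)
    case (factor A r B)
    then have "A \<odot> P = 0" using assms unfolding is_clasp_def by blast
    then show ?case by (simp add: comp_assoc)
  qed (simp_all add: comp_add_left comp_scale_left)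
  show "P \<odot> A = 0" if "lower (weight s) t s A"
    using that
  proof (induction rule: lower.induct)
    case (factor A r B)
    then have "P \<odot> B = 0" using assms unfolding is_clasp_def by blast
    then show ?case by (simp flip: comp_assoc)
  qed (simp_all add: comp_add_right comp_scale_right)
qed

text \<open>By \<open>spanned_flat\<close> for the empty chain, \<open>P\<close> is congruent to
  \<open>c\<close> times the identity. Composing with \<open>P\<close> kills the lower part and
  gives \<open>P = scale c P\<close>, so \<open>c = 1\<close> because \<open>P\<close> is
  nonzero.\<close>

lemma clasp_cong_ident:
  assumes "is_clasp s P"
  shows "lower (weight s) s s (P - ident s)"
proof -
  have P: "P \<in> Hom s s" "P \<noteq> 0" "P \<odot> P = P"
    using assms by (simp_all add: is_clasp_def)
  obtain n where "spanned s n s P" using Hom_spanned[OF P(1)] by blast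
  then obtain c where c: "lower (weight s) s s (P - scale c (ident s))"
    using spanned_flat[OF flat.ident] by blast
  then have "P = scale c P"
    using clasp_lower(1)[OF assms c] ident_comp[OF P(1)] by (simp add: comp_diff_left comp_scale_left P(3))
  then have *: "scale (1 - c) P = 0"
    using scale_add_left[of "1 - c" c P] by simp
  have "c = 1"
  proof (rule ccontr)
    assume "c \<noteq> 1"
    then show False
      using arg_cong[OF *, of "scale (inverse (1 - c))"] P(2) by simp
  qed
  with c show ?thesis by simp
qed

lemma nonseg_clasp_flat:
  assumes "is_nonseg_clasp s t P"
  obtains A C where "flat s t A" "is_clasp s C" "P = A \<odot> C"
  using assms
proof (induction arbitrary: thesis rule: is_nonseg_clasp.induct)
  case (clasp P)
  then show ?case
    using ident_comp[of P s s] by (intro clasp(2)[OF flat.ident clasp(1)]) (simp add: is_clasp_def)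
next
  case (cross u x v P)
  then show ?case
    by (metis comp_assoc flat.cross)
qed

text \<open>Only bare merges occur; by \<open>segregated_wide\<close> a segregated word admits no
  wider ones.\<close>

definition killed :: "word \<Rightarrow> skein \<Rightarrow> bool" where
  "killed s A \<longleftrightarrow> (\<forall>u v x. (s = u @ [x, x] @ v \<longrightarrow> pad u (merge x) v \<odot> A = 0) \<and>
     (s = u @ [x, - x] @ v \<longrightarrow> pad u (cap x) v \<odot> A = 0))"

lemma segregated_no_descent: "replicate b Minus @ replicate a Plus \<noteq> u @ [Plus, Minus] @ v"
proof (induction b arbitrary: u)
  case 0
  show ?case
  proof
    assume "replicate 0 Minus @ replicate a Plus = u @ [Plus, Minus] @ v"
    then have "Minus \<in> set (replicate a Plus)" by simp
    then show False by simp
  qed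
next
  case (Suc b)
  then show ?case by (cases u) auto
qed

text \<open>For positive \<open>k\<close> the word would contain \<open>Plus\<close> directly before
  \<open>Minus\<close>.\<close>

lemma segregated_wide:
  assumes "replicate b Minus @ replicate a Plus = u @ (x # replicate k (- x) @ [x]) @ v"
  shows "k = 0"
proof (rule ccontr)
  assume "k \<noteq> 0"
  then obtain j where k: "k = Suc j" by (cases k) auto
  show False
  proof (cases x)
    case Plus
    then show False
      using segregated_no_descent[of b a u "replicate j Minus @ [Plus] @ v"] assms k by simp
  next
    case Minus
    then show False
      using segregated_no_descent[of b a "u @ Minus # replicate j Plus" v] assms k
      by (simp add: replicate_app_Cons_same)
  qed
qed

text \<open>The lower factor \<open>A\<close> ends in a shorter word, so its expansion has no upward
  term; each term begins with a cap or, the word being segregated, with a bare merge.\<close>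

lemma killed_lower:
  assumes s: "s = replicate b Minus @ replicate a Plus" and "killed s R" and "lower (weight s) s t A"
  shows "A \<odot> R = 0"
  using assms(3)
proof (induction rule: lower.induct)
  case (factor A r B)
  obtain n where "spanned s n r A" using Hom_spanned[OF factor(1)] by blast
  moreover have "length r < length s" by (rule weight_gt_length[OF factor(3)])
  ultimately have "A \<odot> R = 0"
  proof (induction rule: spanned.induct)
    case (upward m t A)
    then show ?case using upward_length[of s m t A] by simp
  next
    case (cap u x v B t)
    then have "pad u (cap x) v \<odot> R = 0" using assms(2) unfolding killed_def by blast
    then show ?case by (simp add: comp_assoc)
  next
    case (wide_merge u x k v B t)
    then have "k = 0" using segregated_wide[of b a u x k v] s by simp
    then have "pad u (wide_merge x k) v \<odot> R = 0"
      using assms(2) wide_merge(1) unfolding killed_def by simp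
    then show ?case by (simp add: comp_assoc)
  qed (simp_all add: comp_add_left comp_scale_left)
  then show ?case by (simp add: comp_assoc)
qed (simp_all add: comp_add_left comp_scale_left)

text \<open>Let \<open>T\<close> invert the chain \<open>B\<close> in
  \<open>P = B \<odot> C\<close>. Then \<open>P \<odot> T\<close> is congruent to the identity at
  \<open>t\<close>, so \<open>P \<odot> T \<odot> R = R\<close> because \<open>R\<close> is killed.
  Also \<open>T \<odot> R\<close> is congruent to the identity at \<open>s\<close>, so
  \<open>P \<odot> T \<odot> R = P\<close> because \<open>C\<close> kills the lower terms.\<close>

lemma nonseg_clasp_unique:
  assumes P: "is_nonseg_clasp s t P" and t: "t = replicate b Minus @ replicate a Plus"
    and R: "R \<in> Hom s t" "killed t R" and A: "flat s t A" "lower (weight s) s t (R - A)"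
  shows "R = P"
proof -
  obtain B C where B: "flat s t B" and C: "is_clasp s C" and P: "P = B \<odot> C"
    using nonseg_clasp_flat[OF P] by blast
  obtain T where T: "flat t s T" "lower (weight s) t t (B \<odot> T - ident t)"
    using flat_inverse[OF B] by blast
  have w: "weight t = weight s" by (rule flat_weight[OF B])
  note Hom = flat_Hom[OF B] flat_Hom[OF T(1)] flat_Hom[OF A(1)]
  have C': "C \<in> Hom s s" using C by (simp add: is_clasp_def)
  have "lower (weight s) t t (B \<odot> (C - ident s) \<odot> T)"
    by (rule lower_comp_left[OF lower_comp_right[OF clasp_cong_ident[OF C] Hom(2)] Hom(1)])
  then have "lower (weight s) t t (P \<odot> T - B \<odot> T)"
    by (simp add: P comp_diff_left comp_diff_right comp_assoc ident_comp[OF Hom(2)])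
  then have "lower (weight t) t t (P \<odot> T - ident t)"
    using lower_trans T(2) w by simp
  then have "(P \<odot> T - ident t) \<odot> R = 0" by (rule killed_lower[OF t R(2)])
  then have 1: "P \<odot> (T \<odot> R) = R"
    using ident_comp[OF R(1)] by (simp add: comp_diff_left comp_assoc)
  have "lower (weight s) s s (T \<odot> R - T \<odot> A)"
    using lower_comp_left[OF A(2) Hom(2)] by (simp add: comp_diff_right)
  then have "lower (weight s) s s (T \<odot> R - ident s)"
    using lower_trans flat_unique[OF flat_comp[OF T(1) A(1)] flat.ident] by blast
  then have "C \<odot> (T \<odot> R - ident s) = 0" by (rule clasp_lower(2)[OF C])
  then have "P \<odot> (T \<odot> R) = P"
    using comp_ident[OF C'] by (simp add: P comp_diff_right comp_assoc)
  with 1 show ?thesis by simp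
qed

section \<open>Arcs\<close>

text \<open>The part of \<open>E_web\<close> without bystanders. What a merge leaves of it is
  \<open>fork_sweep\<close> at the left end and \<open>arc_merge\<close> at the right end.\<close>

definition arc :: "sign \<Rightarrow> word \<Rightarrow> skein" where
  "arc x w = (ident [- x] \<otimes> sweep x w) \<odot> (cup (- x) \<otimes> ident w)"

definition arc_merge :: "sign \<Rightarrow> word \<Rightarrow> skein" where
  "arc_merge x w = (ident (- x # w) \<otimes> merge x) \<odot> (arc x w \<otimes> ident [x])"

definition fork_sweep :: "sign \<Rightarrow> word \<Rightarrow> skein" where
  "fork_sweep x w = (ident [x] \<otimes> sweep x w) \<odot> (fork (- x) \<otimes> ident w)"

lemma Hom_arc: "arc x w \<in> Hom w (- x # w @ [x])"
  unfolding arc_def by (rule Hom_intros Hom_sweep refl | simp)+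

lemma Hom_arc_merge: "arc_merge x w \<in> Hom (w @ [x]) (- x # w @ [- x])"
  unfolding arc_merge_def by (rule Hom_intros Hom_arc refl | simp)+

lemma arc_Nil: "arc x [] = cup (- x)"
  using ident_comp[OF Hom_elementary[of "Cup (- x)"]] by (simp add: arc_def)

lemma arc_append: "arc x (v @ w) = (ident (- x # v) \<otimes> sweep x w) \<odot> (arc x v \<otimes> ident w)"
  by (simp add: arc_def sweep_append normalize)

text \<open>One of the two crossings is between equal signs and the other between opposite signs;
  bent by the cap, both are the same tree of two merges.\<close>

lemma cap_slide:
  "(ident [y] \<otimes> cap x) \<odot> (crossing x y \<otimes> ident [- x]) = (cap x \<otimes> ident [y]) \<odot> (ident [x] \<otimes> crossing y (- x))"
proof (cases "x = y")
  case True
  have "(ident [x] \<otimes> cap x) \<odot> (crossing x x \<otimes> ident [- x]) = merge (- x) \<odot> (merge x \<otimes> ident [- x])"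
    using cap_fork_right[of "- x"] by (simp add: crossing_same comp_tens_ident flip: comp_assoc)
  then show ?thesis using cap_crossing_left[of x] True by simp
next
  case False
  then have y: "y = - x" by (simp add: sign_neq_iff)
  have "(cap x \<otimes> ident [- x]) \<odot> (ident [x] \<otimes> crossing (- x) (- x)) = merge x \<odot> (ident [x] \<otimes> merge (- x))"
    using cap_fork_left[of x] by (simp add: crossing_same ident_tens_comp flip: comp_assoc)
  then show ?thesis using cap_crossing_right[of x] y by simp
qed

text \<open>Capping the right end pulls the arc straight: \<open>cap_slide\<close> moves the cap
  past one strand at a time until \<open>zigzag_right\<close> applies.\<close>

lemma arc_cap: "(ident (- x # w) \<otimes> cap x) \<odot> (arc x w \<otimes> ident [- x]) = sweep_left (- x) w"
proof (induction w rule: rev_induct)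
  case Nil
  show ?case using zigzag_right[of "- x"] by (simp add: arc_Nil)
next
  case (snoc y w)
  have "(ident (- x # w @ [y]) \<otimes> cap x) \<odot> (arc x (w @ [y]) \<otimes> ident [- x]) =
      (ident (- x # w) \<otimes> ((ident [y] \<otimes> cap x) \<odot> (crossing x y \<otimes> ident [- x]))) \<odot> (arc x w \<otimes> ident [y, - x])"
    unfolding arc_append sweep_single by (simp add: normalize)
  also have "\<dots> = (ident (- x # w) \<otimes> cap x \<otimes> ident [y]) \<odot>
      ((ident (- x # w @ [x]) \<otimes> crossing y (- x)) \<odot> (arc x w \<otimes> ident [y, - x]))"
    by (simp add: cap_slide normalize)
  also have "(ident (- x # w @ [x]) \<otimes> crossing y (- x)) \<odot> (arc x w \<otimes> ident [y, - x]) =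
      (arc x w \<otimes> ident [- x, y]) \<odot> (ident w \<otimes> crossing y (- x))"
    by (rule exchange[OF Hom_arc Hom_crossing])
  also have "(ident (- x # w) \<otimes> cap x \<otimes> ident [y]) \<odot> \<dots> =
      (((ident (- x # w) \<otimes> cap x) \<odot> (arc x w \<otimes> ident [- x])) \<otimes> ident [y]) \<odot> (ident w \<otimes> crossing y (- x))"
    by (simp add: normalize)
  finally show ?case unfolding snoc sweep_left_append sweep_left_single by simp
qed

section \<open>Merges and caps on top of an arc\<close>

lemma merge_arc_before:
  "(merge (- x) \<otimes> ident (w @ [x])) \<odot> (ident [- x] \<otimes> arc x w) = fork_sweep x w"
proof -
  have "(merge (- x) \<otimes> ident (w @ [x])) \<odot> (ident [- x] \<otimes> arc x w) =
      ((merge (- x) \<otimes> ident (w @ [x])) \<odot> (ident [- x, - x] \<otimes> sweep x w)) \<odot> (ident [- x] \<otimes> cup (- x) \<otimes> ident w)"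
    by (simp add: arc_def normalize)
  also have "(merge (- x) \<otimes> ident (w @ [x])) \<odot> (ident [- x, - x] \<otimes> sweep x w) =
      (ident [x] \<otimes> sweep x w) \<odot> (merge (- x) \<otimes> ident (x # w))"
    using exchange[OF Hom_elementary[of "Merge (- x)"] Hom_sweep[of x w]] by simp
  finally show ?thesis
    using pad_comp[OF rotate_right[of "- x"], of "[]" w] by (simp add: fork_sweep_def comp_assoc tens_assoc)
qed

text \<open>After \<open>merge_crossing\<close> the crossing sits on the cup of the arc and closes a
  bigon, whence the factor -[2].\<close>

lemma merge_arc_start:
  "(merge (- x) \<otimes> ident (w @ [x])) \<odot> arc x (- x # w) = scale (- qint 2) (fork_sweep x w)"
proof -
  have "(merge (- x) \<otimes> ident [x]) \<odot> arc x [- x] =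
      (ident [x] \<otimes> merge (- x)) \<odot> ((crossing (- x) x \<odot> cup (- x)) \<otimes> ident [- x])"
    unfolding arc_def sweep_single using merge_crossing[of "- x", THEN comp_reassoc] by (simp add: normalize)
  also have "\<dots> = scale (- qint 2) (fork (- x))"
    using crossing_cup[of "- x"] rotate_left[of "- x"] by (simp add: tens_scale_left comp_scale_right)
  finally have *: "(merge (- x) \<otimes> ident [x]) \<odot> arc x [- x] = scale (- qint 2) (fork (- x))" .
  have "(merge (- x) \<otimes> ident (w @ [x])) \<odot> arc x ([- x] @ w) =
      ((merge (- x) \<otimes> ident (w @ [x])) \<odot> (ident [- x, - x] \<otimes> sweep x w)) \<odot> (arc x [- x] \<otimes> ident w)"
    unfolding arc_append by (simp add: comp_assoc)
  also have "(merge (- x) \<otimes> ident (w @ [x])) \<odot> (ident [- x, - x] \<otimes> sweep x w) =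
      (ident [x] \<otimes> sweep x w) \<odot> (merge (- x) \<otimes> ident (x # w))"
    using exchange[OF Hom_elementary[of "Merge (- x)"] Hom_sweep[of x w]] by simp
  also have "\<dots> \<odot> (arc x [- x] \<otimes> ident w) =
      (ident [x] \<otimes> sweep x w) \<odot> (((merge (- x) \<otimes> ident [x]) \<odot> arc x [- x]) \<otimes> ident w)"
    by (simp add: normalize)
  finally show ?thesis
    unfolding * by (simp add: tens_scale_left comp_scale_right fork_sweep_def)
qed

text \<open>In the first term the merge has reached the bottom. In the second the arc is cut: its
  left part is capped and pulled straight, and a fork starts its right part.\<close>

lemma merge_arc_inner:
  "(ident (- x # v) \<otimes> merge (- x) \<otimes> ident (w @ [x])) \<odot> arc x (v @ [- x, - x] @ w) =
   ((ident (- x # v @ [x]) \<otimes> sweep x w) \<odot> (arc x v \<otimes> ident (x # w))) \<odot> (ident v \<otimes> merge (- x) \<otimes> ident w) +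
   (ident (- x # v) \<otimes> fork_sweep x w) \<odot> (sweep_left (- x) v \<otimes> ident (- x # w))"
proof -
  let ?S = "ident (- x # v) \<otimes> ident [x] \<otimes> sweep x w"
  have "(ident (- x # v) \<otimes> merge (- x) \<otimes> ident (w @ [x])) \<odot> arc x (v @ [- x, - x] @ w) =
      (ident (- x # v) \<otimes> ((merge (- x) \<otimes> ident (w @ [x])) \<odot> (ident [- x, - x] \<otimes> sweep x w))) \<odot>
      (ident (- x # v) \<otimes> sweep x [- x, - x] \<otimes> ident w) \<odot> (arc x v \<otimes> ident ([- x, - x] @ w))"
    unfolding arc_append sweep_append by (simp add: normalize del: sweep.simps)
  also have "(merge (- x) \<otimes> ident (w @ [x])) \<odot> (ident [- x, - x] \<otimes> sweep x w) =
      (ident [x] \<otimes> sweep x w) \<odot> (merge (- x) \<otimes> ident (x # w))"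
    using exchange[OF Hom_elementary[of "Merge (- x)"] Hom_sweep[of x w]] by simp
  also have "(ident (- x # v) \<otimes> ((ident [x] \<otimes> sweep x w) \<odot> (merge (- x) \<otimes> ident (x # w)))) \<odot>
      (ident (- x # v) \<otimes> sweep x [- x, - x] \<otimes> ident w) \<odot> (arc x v \<otimes> ident ([- x, - x] @ w)) =
      ?S \<odot> (ident (- x # v) \<otimes> ((merge (- x) \<otimes> ident [x]) \<odot> sweep x [- x, - x]) \<otimes> ident w) \<odot>
      (arc x v \<otimes> ident ([- x, - x] @ w))"
    by (simp add: normalize del: sweep.simps)
  also have "\<dots> = ?S \<odot> ((ident (- x # v @ [x]) \<otimes> merge (- x) \<otimes> ident w) \<odot> (arc x v \<otimes> ident ([- x, - x] @ w))) +
      ?S \<odot> (ident (- x # v) \<otimes> fork (- x) \<otimes> ident w) \<odot>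
      (((ident (- x # v) \<otimes> cap x) \<odot> (arc x v \<otimes> ident [- x])) \<otimes> ident (- x # w))"
    unfolding sweep_merge by (simp add: tens_add_left tens_add_right comp_add_left comp_add_right normalize)
  also have "(ident (- x # v @ [x]) \<otimes> merge (- x) \<otimes> ident w) \<odot> (arc x v \<otimes> ident ([- x, - x] @ w)) =
      (arc x v \<otimes> ident ([x] @ w)) \<odot> (ident v \<otimes> merge (- x) \<otimes> ident w)"
    using exchange[OF Hom_arc[of x v] Hom_tens[OF Hom_elementary[of "Merge (- x)"] Hom_ident[of w]]] by simp
  finally show ?thesis
    unfolding arc_cap by (simp add: fork_sweep_def normalize)
qed

lemma merge_arc_end:
  "(ident (- x # w) \<otimes> merge x) \<odot> arc x (w @ [x]) = scale (- qint 2) (arc_merge x w)"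
proof -
  have "(ident (- x # w) \<otimes> merge x) \<odot> arc x (w @ [x]) =
      (ident (- x # w) \<otimes> ((merge x \<odot> fork (- x)) \<odot> merge x)) \<odot> (arc x w \<otimes> ident [x])"
    unfolding arc_append sweep_single crossing_same by (simp add: normalize)
  then show ?thesis
    using merge_fork[of "- x"] ident_comp[OF Hom_elementary[of "Merge x"]]
    by (simp add: comp_scale_left tens_scale_right arc_merge_def)
qed

text \<open>By \<open>sweep_merge_same\<close> either the arc merges with the first of the two
  strands and the second continues across \<open>w\<close>, or the merge reaches the bottom.\<close>

lemma merge_arc_inner_same:
  "(ident (- x # v) \<otimes> merge x \<otimes> ident (w @ [x])) \<odot> arc x (v @ [x, x] @ w) =
   (ident (- x # v @ [- x]) \<otimes> sweep x w) \<odot> (arc_merge x v \<otimes> ident (x # w)) +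
   ((ident (- x # v @ [- x]) \<otimes> sweep x w) \<odot> (ident (- x # v) \<otimes> (cup (- x) \<odot> cap x) \<otimes> ident w) \<odot>
     (arc x v \<otimes> ident (- x # w))) \<odot> (ident v \<otimes> merge x \<otimes> ident w)"
proof -
  let ?S = "ident (- x # v) \<otimes> ident [- x] \<otimes> sweep x w"
  have "(ident (- x # v) \<otimes> merge x \<otimes> ident (w @ [x])) \<odot> arc x (v @ [x, x] @ w) =
      (ident (- x # v) \<otimes> ((merge x \<otimes> ident (w @ [x])) \<odot> (ident [x, x] \<otimes> sweep x w))) \<odot>
      (ident (- x # v) \<otimes> sweep x [x, x] \<otimes> ident w) \<odot> (arc x v \<otimes> ident ([x, x] @ w))"
    unfolding arc_append sweep_append by (simp add: normalize del: sweep.simps)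
  also have "(merge x \<otimes> ident (w @ [x])) \<odot> (ident [x, x] \<otimes> sweep x w) =
      (ident [- x] \<otimes> sweep x w) \<odot> (merge x \<otimes> ident (x # w))"
    using exchange[OF Hom_elementary[of "Merge x"] Hom_sweep[of x w]] by simp
  also have "(ident (- x # v) \<otimes> ((ident [- x] \<otimes> sweep x w) \<odot> (merge x \<otimes> ident (x # w)))) \<odot>
      (ident (- x # v) \<otimes> sweep x [x, x] \<otimes> ident w) \<odot> (arc x v \<otimes> ident ([x, x] @ w)) =
      ?S \<odot> (ident (- x # v) \<otimes> ((merge x \<otimes> ident [x]) \<odot> sweep x [x, x]) \<otimes> ident w) \<odot>
      (arc x v \<otimes> ident ([x, x] @ w))"
    by (simp add: normalize del: sweep.simps)
  also have "\<dots> = ?S \<odot> (arc_merge x v \<otimes> ident (x # w)) +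
      ?S \<odot> (ident (- x # v) \<otimes> (cup (- x) \<odot> cap x) \<otimes> ident w) \<odot>
      ((ident (- x # v @ [x]) \<otimes> merge x \<otimes> ident w) \<odot> (arc x v \<otimes> ident ([x, x] @ w)))"
    unfolding sweep_merge_same
    by (simp add: tens_add_left tens_add_right comp_add_left comp_add_right normalize arc_merge_def)
  also have "(ident (- x # v @ [x]) \<otimes> merge x \<otimes> ident w) \<odot> (arc x v \<otimes> ident ([x, x] @ w)) =
      (arc x v \<otimes> ident ([- x] @ w)) \<odot> (ident v \<otimes> merge x \<otimes> ident w)"
    using exchange[OF Hom_arc[of x v] Hom_tens[OF Hom_elementary[of "Merge x"] Hom_ident[of w]]] by simp
  finally show ?thesis by (simp add: normalize)
qed

text \<open>The cap is moved to the other side by \<open>cap_slide\<close>, and the crossing left on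
  the cup closes a bigon.\<close>

lemma cap_arc_start:
  "(cap (- x) \<otimes> ident (w @ [x])) \<odot> arc x (x # w) = scale (- qint 2) (sweep x w)"
proof -
  have "(cap (- x) \<otimes> ident [x]) \<odot> arc x [x] =
      (ident [x] \<otimes> cap (- x)) \<odot> ((crossing (- x) x \<odot> cup (- x)) \<otimes> ident [x])"
    unfolding arc_def sweep_single
    using cap_slide[of x "- x", symmetric, THEN comp_reassoc] by (simp add: normalize)
  also have "\<dots> = scale (- qint 2) (ident [x])"
    using crossing_cup[of "- x"] by (simp add: tens_scale_left comp_scale_right zigzag_right)
  finally have *: "(cap (- x) \<otimes> ident [x]) \<odot> arc x [x] = scale (- qint 2) (ident [x])" .
  have "(cap (- x) \<otimes> ident (w @ [x])) \<odot> arc x ([x] @ w) =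
      ((cap (- x) \<otimes> ident (w @ [x])) \<odot> (ident [- x, x] \<otimes> sweep x w)) \<odot> (arc x [x] \<otimes> ident w)"
    unfolding arc_append by (simp add: comp_assoc)
  also have "(cap (- x) \<otimes> ident (w @ [x])) \<odot> (ident [- x, x] \<otimes> sweep x w) =
      sweep x w \<odot> (cap (- x) \<otimes> ident (x # w))"
    using exchange[OF Hom_elementary[of "Cap (- x)"] Hom_sweep[of x w]] by simp
  also have "\<dots> \<odot> (arc x [x] \<otimes> ident w) = sweep x w \<odot> (((cap (- x) \<otimes> ident [x]) \<odot> arc x [x]) \<otimes> ident w)"
    by (simp add: normalize)
  finally show ?thesis
    unfolding * using comp_ident[OF Hom_sweep[of x w]] by (simp add: tens_scale_left comp_scale_right)
qed

lemma cap_arc_end: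
  "(ident (- x # w) \<otimes> cap (- x)) \<odot> arc x (w @ [- x]) = scale (- qint 2) (sweep_left (- x) w)"
proof -
  have "(ident (- x # w) \<otimes> cap (- x)) \<odot> arc x (w @ [- x]) =
      (ident (- x # w) \<otimes> (cap (- x) \<odot> crossing x (- x))) \<odot> (arc x w \<otimes> ident [- x])"
    unfolding arc_append sweep_single by (simp add: normalize)
  then show ?thesis
    by (simp add: cap_crossing tens_scale_right comp_scale_left arc_cap)
qed

text \<open>The two terms of \<open>sweep_cap\<close>: the arc is cut at the cap, or the cap reaches
  the bottom.\<close>

lemma cap_arc_inner:
  "(ident (- x # v) \<otimes> cap (- x) \<otimes> ident (w @ [x])) \<odot> arc x (v @ [- x, x] @ w) =
   (ident (- x # v) \<otimes> sweep x w) \<odot> (sweep_left (- x) v \<otimes> ident (x # w)) +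
   ((ident (- x # v) \<otimes> sweep x w) \<odot> (arc x v \<otimes> ident w)) \<odot> (ident v \<otimes> cap (- x) \<otimes> ident w)"
proof -
  let ?S = "ident (- x # v) \<otimes> sweep x w"
  have "(ident (- x # v) \<otimes> cap (- x) \<otimes> ident (w @ [x])) \<odot> arc x (v @ [- x, x] @ w) =
      (ident (- x # v) \<otimes> ((cap (- x) \<otimes> ident (w @ [x])) \<odot> (ident [- x, x] \<otimes> sweep x w))) \<odot>
      (ident (- x # v) \<otimes> sweep x [- x, x] \<otimes> ident w) \<odot> (arc x v \<otimes> ident ([- x, x] @ w))"
    unfolding arc_append sweep_append by (simp add: normalize del: sweep.simps)
  also have "(cap (- x) \<otimes> ident (w @ [x])) \<odot> (ident [- x, x] \<otimes> sweep x w) =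
      sweep x w \<odot> (cap (- x) \<otimes> ident (x # w))"
    using exchange[OF Hom_elementary[of "Cap (- x)"] Hom_sweep[of x w]] by simp
  also have "(ident (- x # v) \<otimes> (sweep x w \<odot> (cap (- x) \<otimes> ident (x # w)))) \<odot>
      (ident (- x # v) \<otimes> sweep x [- x, x] \<otimes> ident w) \<odot> (arc x v \<otimes> ident ([- x, x] @ w)) =
      ?S \<odot> (ident (- x # v) \<otimes> ((cap (- x) \<otimes> ident [x]) \<odot> sweep x [- x, x]) \<otimes> ident w) \<odot>
      (arc x v \<otimes> ident ([- x, x] @ w))"
    by (simp add: normalize del: sweep.simps)
  also have "\<dots> = ?S \<odot> ((ident (- x # v @ [x]) \<otimes> cap (- x) \<otimes> ident w) \<odot> (arc x v \<otimes> ident ([- x, x] @ w))) +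
      ?S \<odot> (((ident (- x # v) \<otimes> cap x) \<odot> (arc x v \<otimes> ident [- x])) \<otimes> ident (x # w))"
    unfolding sweep_cap
    by (simp add: tens_add_left tens_add_right comp_add_left comp_add_right normalize)
  also have "(ident (- x # v @ [x]) \<otimes> cap (- x) \<otimes> ident w) \<odot> (arc x v \<otimes> ident ([- x, x] @ w)) =
      (arc x v \<otimes> ident w) \<odot> (ident v \<otimes> cap (- x) \<otimes> ident w)"
    using exchange[OF Hom_arc[of x v] Hom_tens[OF Hom_elementary[of "Cap (- x)"] Hom_ident[of w]]] by simp
  finally show ?thesis
    unfolding arc_cap by (simp add: normalize add.commute)
qed

section \<open>Quantum integers\<close>

lemma q_half_power: "q_half ^ n = Fract (monom 1 n) 1"
  by (induction n) (simp_all add: q_half_def One_fract_def monom_Suc)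

lemma q_half_nonzero [simp]: "q_half \<noteq> 0"
  by (simp add: q_half_def Zero_fract_def eq_fract)

lemma q_half_power_neq_1: "n > 0 \<Longrightarrow> q_half ^ n \<noteq> 1"
  by (auto simp: q_half_power One_fract_def eq_fract monom_eq_1_iff)

text \<open>Otherwise the power \<open>n + n\<close> of the indeterminate would be 1.\<close>

lemma q_half_diff_nonzero: "n > 0 \<Longrightarrow> q_half ^ n - inverse q_half ^ n \<noteq> 0"
proof
  assume n: "n > 0" and "q_half ^ n - inverse q_half ^ n = 0"
  then have "q_half ^ n = inverse (q_half ^ n)"
    by (simp add: power_inverse)
  moreover have "q_half ^ n * inverse (q_half ^ n) = 1"
    by (intro right_inverse) simp
  ultimately have "q_half ^ n * q_half ^ n = 1" by metis
  then show False
    using q_half_power_neq_1[of "n + n"] n by (simp add: power_add)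
qed

lemma qint_nonzero: "n > 0 \<Longrightarrow> qint n \<noteq> 0"
  using q_half_diff_nonzero[of n] q_half_diff_nonzero[of 1] by (simp add: qint_def)

lemma qint_0 [simp]: "qint 0 = 0"
  by (simp add: qint_def)

lemma qint_1 [simp]: "qint 1 = 1" "qint (Suc 0) = 1"
  using q_half_diff_nonzero[of 1] by (simp_all add: qint_def)

lemma qint_2: "qint 2 = q_half + inverse q_half"
proof -
  have "q_half ^ 2 - inverse q_half ^ 2 = (q_half + inverse q_half) * (q_half - inverse q_half)"
    by (simp add: power2_eq_square algebra_simps)
  then show ?thesis
    using q_half_diff_nonzero[of 1] by (simp add: qint_def)
qed

lemma qint_Suc_Suc: "qint (Suc (Suc n)) = qint 2 * qint (Suc n) - qint n"
proof -
  have cancel: "q_half * (inverse q_half * z) = z" for z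
    by (simp flip: mult.assoc)
  have "q_half ^ Suc (Suc n) - inverse q_half ^ Suc (Suc n) =
      (q_half + inverse q_half) * (q_half ^ Suc n - inverse q_half ^ Suc n) - (q_half ^ n - inverse q_half ^ n)"
    by (simp add: algebra_simps cancel)
  then show ?thesis
    unfolding qint_2 unfolding qint_def by (simp only: times_divide_eq_right flip: diff_divide_distrib)
qed

lemma qint_3: "qint 3 = qint 2 * qint 2 - 1"
  using qint_Suc_Suc[of 1] by (simp add: numeral_eq_Suc)

section \<open>The expansion is killed by lowering pieces\<close>

abbreviation minuses :: "nat \<Rightarrow> word" where "minuses n \<equiv> replicate n Minus"
abbreviation pluses :: "nat \<Rightarrow> word" where "pluses n \<equiv> replicate n Plus"

text \<open>With \<open>p = b - i\<close>, \<open>r = i - 1\<close> and \<open>l = a - j\<close> this is \<open>E i j\<close>; these parameters avoid subtraction.\<close>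

definition arc_web :: "nat \<Rightarrow> nat \<Rightarrow> nat \<Rightarrow> nat \<Rightarrow> skein" where
  "arc_web p r j l = pad (minuses p) (arc Plus (minuses r @ pluses j)) (pluses l)"

lemma Hom_arc_web: "arc_web p r j l \<in> Hom (minuses (p + r) @ pluses (j + l)) (minuses (Suc (p + r)) @ pluses (Suc (j + l)))"
  using Hom_pad[OF Hom_arc, of "minuses p" Plus "minuses r @ pluses j" "pluses l"]
  by (simp add: arc_web_def replicate_add replicate_app_Cons_same)

lemma E_web_arc_web:
  assumes "1 \<le> i" "i \<le> b" "j \<le> a"
  shows "E_web a b i j = arc_web (b - i) (i - 1) j (a - j)"
proof -
  have "pluses a = pluses j @ pluses (a - j)"
    using assms(3) by (simp flip: replicate_add)
  then show ?thesis
    by (simp add: E_web_def arc_web_def arc_def normalize)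
qed

lemma killed_merge: "killed s Q \<Longrightarrow> s = u @ [x, x] @ v \<Longrightarrow> pad u (merge x) v \<odot> Q = 0"
  unfolding killed_def by blast

lemma killed_cap: "killed s Q \<Longrightarrow> s = u @ [x, - x] @ v \<Longrightarrow> pad u (cap x) v \<odot> Q = 0"
  unfolding killed_def by blast

text \<open>A crossing of equal signs contains a merge, and the first crossing of the sweep lies at
  the bottom.\<close>

lemma killed_sweep:
  assumes "killed s Q" "s = u @ replicate (Suc (Suc k)) x @ v"
  shows "pad u (sweep x (replicate (Suc k) x)) v \<odot> Q = 0"
proof -
  have "pad u (merge x) (replicate k x @ v) \<odot> Q = 0"
    using assms by (intro killed_merge) auto
  then show ?thesis by (simp add: crossing_same normalize)
qed

lemma killed_sweep_left:
  assumes "killed s Q" "s = u @ replicate (Suc (Suc k)) x @ v"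
  shows "pad u (sweep_left x (replicate (Suc k) x)) v \<odot> Q = 0"
proof -
  have N: "replicate (Suc k) x = replicate k x @ [x]"
    by (simp add: replicate_append_same)
  have "pad (u @ replicate k x) (merge x) v \<odot> Q = 0"
    using assms by (intro killed_merge) (auto simp: replicate_app_Cons_same)
  then show ?thesis
    unfolding N sweep_left_append sweep_left_single crossing_same by (simp add: normalize)
qed

lemmas blocks = replicate_add replicate_app_Cons_same

text \<open>Here \<open>p\<close> is the position of the left end of the arc and \<open>n\<close>
  that of the merge. Three relative positions survive and give the same web, which does not depend
  on \<open>p\<close>; in the others a merge reaches \<open>Q\<close>.\<close>

lemma merge_minus_arc_web:
  assumes Q: "killed (minuses B @ pluses (j + l)) Q" "Q \<in> Hom t (minuses B @ pluses (j + l))"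
    and B: "p + r = B" "n + m + 1 = B"
  shows "pad (minuses n) (merge Minus) (minuses m @ pluses (Suc (j + l))) \<odot> arc_web p r j l \<odot> Q =
    scale ((if p = n + 1 then 1 else 0) + (if p = n then - qint 2 else 0) + (if p + 1 = n then 1 else 0))
      (pad (minuses n) (fork_sweep Plus (minuses m @ pluses j)) (pluses l) \<odot> Q)"
    (is "?D \<odot> _ = _")
proof -
  consider (1) q where "p = n + 2 + q" | (2) "p = n + 1" | (3) "p = n" | (4) "n = p + 1"
    | (5) q where "n = p + 2 + q"
  proof -
    have "(\<exists>q. p = n + 2 + q) \<or> p = n + 1 \<or> p = n \<or> n = p + 1 \<or> (\<exists>q. n = p + 2 + q)"
      by presburger
    then show ?thesis using that by blast
  qed
  then show ?thesis
  proof cases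
    \<comment> \<open>The merge lies to the left of the arc and slides down to
      \<open>Q\<close>.\<close>
    case 1
    have s: "minuses B @ pluses (j + l) = minuses n @ [Minus, Minus] @ (minuses q @ minuses r @ pluses j @ pluses l)"
      using B 1 by (auto simp: blocks)
    have D: "?D = pad (minuses n) (merge Minus) (minuses q @ (Minus # (minuses r @ pluses j) @ [Plus]) @ pluses l)"
      using B 1 by (auto simp: blocks)
    have E: "arc_web p r j l = pad (minuses n @ [Minus, Minus] @ minuses q) (arc Plus (minuses r @ pluses j)) (pluses l)"
      using 1 by (simp add: arc_web_def blocks)
    have "?D \<odot> arc_web p r j l = pad (minuses n @ [Plus] @ minuses q) (arc Plus (minuses r @ pluses j)) (pluses l) \<odot>
        pad (minuses n) (merge Minus) (minuses q @ minuses r @ pluses j @ pluses l)"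
      unfolding D E
      using pad_exchange[OF Hom_elementary[of "Merge Minus"] Hom_arc[of Plus "minuses r @ pluses j"],
          of "minuses n" "minuses q" "pluses l"] by simp
    from comp_reassoc[OF this, of Q] show ?thesis
      using killed_merge[OF Q(1) s] 1 by (simp add: comp_assoc)
  next
    case 2
    have "?D \<odot> arc_web p r j l = pad (minuses n) (fork_sweep Plus (minuses m @ pluses j)) (pluses l)"
      using pad_comp[OF merge_arc_before[of Plus "minuses m @ pluses j"], of "minuses n" "pluses l"] B 2
      by (auto simp: arc_web_def blocks tens_assoc)
    from comp_reassoc[OF this, of Q] show ?thesis using 2 by simp
  next
    case 3
    have "?D \<odot> arc_web p r j l = scale (- qint 2) (pad (minuses n) (fork_sweep Plus (minuses m @ pluses j)) (pluses l))"
      using pad_comp[OF merge_arc_start[of Plus "minuses m @ pluses j"], of "minuses n" "pluses l"] B 3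
      by (auto simp: arc_web_def blocks tens_assoc tens_scale_left tens_scale_right)
    from comp_reassoc[OF this, of Q] show ?thesis using 3 by (simp add: comp_scale_left)
  next
    case 4
    let ?w = "minuses m @ pluses j"
    have s: "minuses B @ pluses (j + l) = minuses p @ [Minus, Minus] @ (?w @ pluses l)"
      using B 4 by (auto simp: blocks)
    have "?D \<odot> arc_web p r j l =
        (pad (minuses p) ((ident [Minus, Plus] \<otimes> sweep Plus ?w) \<odot> (arc Plus [] \<otimes> ident (Plus # ?w))) (pluses l)) \<odot>
          pad (minuses p) (merge Minus) (?w @ pluses l) +
        pad (minuses n) (fork_sweep Plus ?w) (pluses l) \<odot> ident (minuses B @ pluses (j + l))"
      using pad_comp[OF merge_arc_inner[of Plus "[]" ?w], of "minuses p" "pluses l"] B 4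
      by (auto simp: arc_web_def blocks normalize tens_add_left tens_add_right)
    from comp_reassoc[OF this, of Q] show ?thesis
      using killed_merge[OF Q(1) s] 4 ident_comp[OF Q(2)]
      by (simp add: comp_add_left comp_assoc)
  next
    \<comment> \<open>At least one strand separates the arc from the merge, so the straightened part
      of the arc crosses a strand of its own sign just above \<open>Q\<close>.\<close>
    case 5
    let ?v = "minuses (Suc q)" and ?w = "minuses m @ pluses j"
    have s: "minuses B @ pluses (j + l) = (minuses p @ ?v) @ [Minus, Minus] @ (?w @ pluses l)"
      "minuses B @ pluses (j + l) = minuses p @ minuses (Suc (Suc q)) @ (Minus # ?w @ pluses l)"
      using B 5 by (auto simp: blocks numeral_3_eq_3)
    have D: "?D = pad (minuses p) (ident (Minus # ?v) \<otimes> merge Minus \<otimes> ident (?w @ [Plus])) (pluses l)"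
      using 5 by (simp add: blocks tens_assoc)
    have E: "arc_web p r j l = pad (minuses p) (arc Plus (?v @ [Minus, Minus] @ ?w)) (pluses l)"
    proof -
      have "minuses r = ?v @ [Minus, Minus] @ minuses m" using B 5 by (auto simp: blocks numeral_3_eq_3)
      then show ?thesis by (simp add: arc_web_def)
    qed
    obtain A where "?D \<odot> arc_web p r j l = A \<odot> pad (minuses p @ ?v) (merge Minus) (?w @ pluses l) +
        pad (minuses p @ Minus # ?v) (fork_sweep Plus ?w) (pluses l) \<odot>
          pad (minuses p) (sweep_left Minus ?v) (Minus # ?w @ pluses l)"
      unfolding D E pad_comp[OF merge_arc_inner[of Plus ?v ?w, simplified uminus_sign.simps]]
      by (simp add: tens_add_left tens_add_right comp_tens_ident ident_tens_comp tens_assoc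
          del: replicate.simps sweep_left.simps)
    from comp_reassoc[OF this, of Q] show ?thesis
      using killed_merge[OF Q(1) s(1)] killed_sweep_left[OF Q(1) s(2)] 5
      by (simp add: comp_add_left comp_assoc del: replicate.simps sweep_left.simps)
  qed
qed


text \<open>The analogous situation at the right end of the arc, which has position \<open>j\<close>
  among the letters \<open>Plus\<close>; the surviving web does not depend on
  \<open>j\<close>.\<close>

lemma merge_plus_arc_web:
  assumes Q: "killed (minuses (p + r) @ pluses a) Q"
    and a: "j + l = a" "n + m + 2 = a"
  shows "pad (minuses (Suc (p + r)) @ pluses n) (merge Plus) (pluses (Suc m)) \<odot> arc_web p r j l \<odot> Q =
    scale ((if j = n then 1 else 0) + (if j = n + 1 then - qint 2 else 0) + (if j = n + 2 then 1 else 0))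
      (pad (minuses p) (arc_merge Plus (minuses r @ pluses n)) (pluses (Suc m)) \<odot> Q)"
    (is "?D \<odot> _ = _")
proof -
  let ?w = "minuses r @ pluses n"
  consider (1) q where "n = j + 1 + q" | (2) "j = n" | (3) "j = n + 1" | (4) "j = n + 2"
    | (5) k where "j = n + 2 + Suc k"
  proof -
    have "(\<exists>q. n = j + 1 + q) \<or> j = n \<or> j = n + 1 \<or> j = n + 2 \<or> (\<exists>k. j = n + 2 + Suc k)"
      by presburger
    then show ?thesis using that by blast
  qed
  then show ?thesis
  proof cases
    case 1
    have l: "l = Suc (Suc (Suc (q + m)))" using a 1 by simp
    have s: "minuses (p + r) @ pluses a = (minuses p @ minuses r @ pluses j @ pluses q) @ [Plus, Plus] @ pluses (Suc m)"
      using a(1) by (auto simp: l blocks)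
    have D: "?D = pad (minuses p @ (Minus # (minuses r @ pluses j) @ [Plus]) @ pluses q) (merge Plus) (pluses (Suc m))"
      by (simp add: 1 blocks)
    have E: "arc_web p r j l = pad (minuses p) (arc Plus (minuses r @ pluses j)) (pluses q @ [Plus, Plus] @ pluses (Suc m))"
      by (simp add: arc_web_def l blocks)
    have "?D \<odot> arc_web p r j l = pad (minuses p) (arc Plus (minuses r @ pluses j)) (pluses q @ [Minus] @ pluses (Suc m)) \<odot>
        pad (minuses p @ minuses r @ pluses j @ pluses q) (merge Plus) (pluses (Suc m))"
      unfolding D E
      using pad_exchange[OF Hom_arc[of Plus "minuses r @ pluses j"] Hom_elementary[of "Merge Plus"],
          of "minuses p" "pluses q" "pluses (Suc m)"] by simp
    from comp_reassoc[OF this, of Q] show ?thesis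
      using killed_merge[OF Q s] 1 by (simp add: comp_assoc)
  next
    case 2
    have l: "l = Suc (Suc m)" using a 2 by simp
    have "?D \<odot> arc_web p r j l = pad (minuses p) (arc_merge Plus ?w) (pluses (Suc m))"
      by (simp add: arc_web_def arc_merge_def 2 l blocks normalize)
    from comp_reassoc[OF this, of Q] show ?thesis using 2 by simp
  next
    case 3
    have l: "l = Suc m" using a 3 by simp
    have "?D \<odot> arc_web p r j l = scale (- qint 2) (pad (minuses p) (arc_merge Plus ?w) (pluses (Suc m)))"
      using pad_comp[OF merge_arc_end[of Plus ?w], of "minuses p" "pluses (Suc m)"]
      by (simp add: arc_web_def 3 l blocks tens_assoc tens_scale_left tens_scale_right)
    from comp_reassoc[OF this, of Q] show ?thesis using 3 by (simp add: comp_scale_left)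
  next
    case 4
    have l: "l = m" using a 4 by simp
    have s: "minuses (p + r) @ pluses a = (minuses p @ ?w) @ [Plus, Plus] @ pluses m"
      using a(1) by (auto simp: 4 l blocks)
    have "arc_merge Plus ?w \<otimes> ident [Plus] \<in> Hom ((?w @ [Plus]) @ [Plus]) ((Minus # ?w @ [Minus]) @ [Plus])"
      using Hom_tens[OF Hom_arc_merge Hom_ident, of Plus ?w "[Plus]"] by simp
    from ident_comp[OF this] have "?D \<odot> arc_web p r j l \<odot> Q =
        pad (minuses p) (arc_merge Plus ?w) (pluses (Suc m)) \<odot> Q"
      using pad_comp[OF merge_arc_inner_same[of Plus ?w "[]"], of "minuses p" "pluses m", THEN comp_reassoc, of Q]
        killed_merge[OF Q s]
      by (simp add: arc_web_def 4 l blocks normalize tens_add_left tens_add_right comp_add_left)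
    then show ?thesis using 4 by simp
  next
    case 5
    have m: "m = Suc k + l" using a 5 by simp
    let ?v = "pluses (Suc k)"
    have s: "minuses (p + r) @ pluses a = (minuses p @ ?w) @ [Plus, Plus] @ (?v @ pluses l)"
      "minuses (p + r) @ pluses a = (minuses p @ ?w @ [Plus]) @ pluses (Suc (Suc k)) @ pluses l"
      using a(1) by (auto simp: 5 blocks numeral_3_eq_3)
    have D: "?D = pad (minuses p) (ident (Minus # ?w) \<otimes> merge Plus \<otimes> ident (?v @ [Plus])) (pluses l)"
      by (simp add: m blocks tens_assoc)
    have E: "arc_web p r j l = pad (minuses p) (arc Plus (?w @ [Plus, Plus] @ ?v)) (pluses l)"
      by (simp add: arc_web_def 5 blocks numeral_3_eq_3)
    \<comment> \<open>This brings the sweep to the bottom, where it runs across equal signs and is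
      killed by \<open>Q\<close>.\<close>
    have X: "(ident (Minus # ?w @ [Minus]) \<otimes> sweep Plus ?v) \<odot> (arc_merge Plus ?w \<otimes> ident (Plus # ?v)) =
        (arc_merge Plus ?w \<otimes> ident (?v @ [Plus])) \<odot> (ident (?w @ [Plus]) \<otimes> sweep Plus ?v)"
      using exchange[OF Hom_arc_merge[of Plus ?w] Hom_sweep[of Plus ?v]] by simp
    obtain A B where "?D \<odot> arc_web p r j l = A \<odot> pad (minuses p @ ?w @ [Plus]) (sweep Plus ?v) (pluses l) +
        B \<odot> pad (minuses p @ ?w) (merge Plus) (?v @ pluses l)"
      unfolding D E pad_comp[OF merge_arc_inner_same[of Plus ?w ?v, simplified uminus_sign.simps X]]
      by (simp add: tens_add_left tens_add_right comp_tens_ident ident_tens_comp tens_assoc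
          del: replicate.simps sweep.simps)
    from comp_reassoc[OF this, of Q] show ?thesis
      using killed_merge[OF Q s(1)] killed_sweep[OF Q s(2)] 5
      by (simp add: comp_add_left comp_assoc del: replicate.simps sweep.simps)
  qed
qed

text \<open>The values come from a loop, from a bigon on either side, and from a square when one
  strand of each sign is crossed. If the arc crosses two strands of one sign, a crossing of equal
  signs comes to lie on \<open>Q\<close>.\<close>

lemma cap_arc_web:
  assumes Q: "killed (minuses B @ pluses a) Q" "Q \<in> Hom t (minuses B @ pluses a)"
    and B: "p + r = B" and a: "j + l = a"
  shows "pad (minuses B) (cap Minus) (pluses a) \<odot> arc_web p r j l \<odot> Q =
    scale (if r = 0 \<and> j = 0 then qint 3 else if r + j = 1 then - qint 2 else if r = 1 \<and> j = 1 then 1 else 0) Q"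
    (is "?D \<odot> _ = _")
proof -
  note Q' = ident_comp[OF Q(2)]
  consider (1) "r = 0" "j = 0" | (2) k where "r = 0" "j = Suc k" | (3) k where "r = Suc k" "j = 0"
    | (4) i k where "r = Suc i" "j = Suc k"
    by (cases r; cases j) auto
  then show ?thesis
  proof cases
    case 1
    have "?D \<odot> arc_web p r j l = scale (qint 3) (ident (minuses B @ pluses a))"
      using pad_comp[OF cap_cup[of Minus], of "minuses p" "pluses l"] B a
      by (simp add: arc_web_def arc_Nil 1 tens_scale_left tens_scale_right)
    from comp_reassoc[OF this, of Q] show ?thesis using 1 Q' by (simp add: comp_scale_left)
  next
    case 2
    have E: "?D \<odot> arc_web p r j l = scale (- qint 2) (pad (minuses p) (sweep Plus (pluses k)) (pluses l))"
      using pad_comp[OF cap_arc_start[of Plus "pluses k"], of "minuses p" "pluses l"] B a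
      by (auto simp: arc_web_def 2 blocks tens_assoc tens_scale_left tens_scale_right)
    have "pad (minuses p) (sweep Plus (pluses k)) (pluses l) \<odot> Q = (if k = 0 then Q else 0)"
    proof (cases k)
      case 0
      then show ?thesis using Q' B a 2 by auto
    next
      case (Suc i)
      have "minuses B @ pluses a = minuses p @ pluses (Suc (Suc i)) @ pluses l"
        using B a 2 Suc by (auto simp: blocks)
      from killed_sweep[OF Q(1) this] show ?thesis using Suc by simp
    qed
    with comp_reassoc[OF E, of Q] show ?thesis using 2 by (simp add: comp_scale_left)
  next
    case 3
    have D: "?D = pad (minuses p) (ident (Minus # minuses k) \<otimes> cap Minus) (pluses l)"
      using B a 3 by (auto simp: blocks tens_assoc)
    have "minuses r = minuses k @ [Minus]" using 3 by (simp add: replicate_append_same)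
    then have E: "?D \<odot> arc_web p r j l = scale (- qint 2) (pad (minuses p) (sweep_left Minus (minuses k)) (pluses l))"
      using pad_comp[OF cap_arc_end[of Plus "minuses k"], of "minuses p" "pluses l"]
      by (simp add: D arc_web_def 3(2) tens_assoc tens_scale_left tens_scale_right)
    have "pad (minuses p) (sweep_left Minus (minuses k)) (pluses l) \<odot> Q = (if k = 0 then Q else 0)"
    proof (cases k)
      case 0
      then show ?thesis using Q' B a 3 by (auto simp: blocks)
    next
      case (Suc i)
      have "minuses B @ pluses a = minuses p @ minuses (Suc (Suc i)) @ pluses l"
        using B a 3 Suc by (auto simp: blocks)
      from killed_sweep_left[OF Q(1) this] show ?thesis using Suc by simp
    qed
    with comp_reassoc[OF E, of Q] show ?thesis using 3 by (simp add: comp_scale_left)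
  next
    case 4
    let ?v = "minuses i" and ?w = "pluses k"
    have r: "minuses r = ?v @ [Minus]" using 4 by (simp add: replicate_append_same)
    have j: "pluses j = [Plus] @ ?w" using 4 by simp
    have s: "minuses B @ pluses a = (minuses p @ ?v) @ [Minus, Plus] @ (?w @ pluses l)"
      using B a 4 by (auto simp: blocks)
    have D: "?D = pad (minuses p) (ident (Minus # ?v) \<otimes> cap Minus \<otimes> ident (?w @ [Plus])) (pluses l)"
      using B a 4 by (auto simp: blocks tens_assoc)
    have E: "?D \<odot> arc_web p r j l \<odot> Q =
        pad (minuses p @ Minus # ?v) (sweep Plus ?w) (pluses l) \<odot>
          pad (minuses p) (sweep_left Minus ?v) (Plus # ?w @ pluses l) \<odot> Q"
      using pad_comp[OF cap_arc_inner[of Plus ?v ?w], of "minuses p" "pluses l", THEN comp_reassoc, of Q]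
        killed_cap[OF Q(1), of "minuses p @ ?v" Minus "?w @ pluses l"] s
      unfolding D arc_web_def r j by (simp add: normalize tens_add_left tens_add_right comp_add_left)
    have "pad (minuses p @ Minus # ?v) (sweep Plus ?w) (pluses l) \<odot>
        pad (minuses p) (sweep_left Minus ?v) (Plus # ?w @ pluses l) \<odot> Q = (if i = 0 \<and> k = 0 then Q else 0)"
    proof (cases i)
      case 0
      have e: "pad (minuses p) (sweep_left Minus ?v) (Plus # ?w @ pluses l) \<odot> Q = Q"
        using Q' B a 4 0 by (auto simp: blocks)
      show ?thesis
      proof (cases k)
        case 0
        then show ?thesis unfolding e using Q' B a 4 \<open>i = 0\<close> by (auto simp: blocks)
      next
        case (Suc k')
        have "minuses B @ pluses a = (minuses p @ Minus # ?v) @ pluses (Suc (Suc k')) @ pluses l"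
          using B a 4 Suc 0 by (auto simp: blocks)
        from killed_sweep[OF Q(1) this] show ?thesis unfolding e using Suc by simp
      qed
    next
      case (Suc i')
      have "minuses B @ pluses a = minuses p @ minuses (Suc (Suc i')) @ (Plus # ?w @ pluses l)"
        using B a 4 Suc by (auto simp: blocks)
      from killed_sweep_left[OF Q(1) this] show ?thesis using Suc by simp
    qed
    then show ?thesis using E 4 by simp
  qed
qed

text \<open>Here \<open>B\<close> is \<open>b - 1\<close> and \<open>p\<close> is \<open>b - i\<close>.\<close>

definition coefficient :: "nat \<Rightarrow> nat \<Rightarrow> nat \<Rightarrow> nat \<Rightarrow> scalar" where
  "coefficient B a p j = qint (p + 1) * qint (B + j + 2) / (qint (B + 1) * qint (a + B + 2))"

definition expansion :: "nat \<Rightarrow> nat \<Rightarrow> skein \<Rightarrow> skein" where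
  "expansion B a Q =
     (\<Sum>p\<le>B. \<Sum>j\<le>a. scale (coefficient B a p j) (arc_web p (B - p) j (a - j) \<odot> Q))"

lemma scale_sum_left: "(\<Sum>i\<in>I. scale (f i) A) = scale (sum f I) A"
  by (induction I rule: infinite_finite_induct) (auto simp: scale_add_left)

lemma comp_expansion:
  "D \<odot> expansion B a Q =
     (\<Sum>p\<le>B. \<Sum>j\<le>a. scale (coefficient B a p j) (D \<odot> arc_web p (B - p) j (a - j) \<odot> Q))"
  by (simp add: expansion_def comp_sum_right comp_scale_right)

section \<open>Quantum integer identities for the coefficients\<close>

lemma mult_delta: "c * (if b then x else 0) = (if b then c * x else 0)" for c x :: scalar
  by simp

lemma sum_three_terms:
  assumes "n + 1 \<le> B"
  shows "(\<Sum>p\<le>B. qint (p + 1) * ((if p = n + 1 then 1 else 0) + (if p = n then - qint 2 else 0) +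
    (if p + 1 = n then 1 else 0))) = 0"
proof (cases n)
  case 0
  \<comment> \<open>The term \<open>p + 1 = n\<close> is missing here; it would carry the factor
    [0].\<close>
  then show ?thesis
    using assms qint_Suc_Suc[of 0] by (simp add: distrib_left sum.distrib mult_delta)
next
  case (Suc k)
  then show ?thesis
    using assms qint_Suc_Suc[of "Suc k"]
    by (simp add: distrib_left sum.distrib mult_delta)
qed

lemma sum_three_terms':
  assumes "n + 2 \<le> a"
  shows "(\<Sum>j\<le>a. qint (b + j) * ((if j = n then 1 else 0) + (if j = n + 1 then - qint 2 else 0) +
    (if j = n + 2 then 1 else 0))) = 0"
  using assms qint_Suc_Suc[of "b + n"]
  by (simp add: distrib_left sum.distrib mult_delta)

text \<open>Only the rows \<open>p = B\<close> and \<open>p = B - 1\<close> with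
  \<open>j = 0\<close> and \<open>j = 1\<close> contribute. The recurrences for [B + 3] and [B + 2]
  together with [3] = [2]^2 - 1 make these four terms cancel.\<close>

lemma sum_cap_terms:
  assumes "a \<ge> 1"
  shows "(\<Sum>p\<le>B. \<Sum>j\<le>a. qint (p + 1) * qint (B + j + 2) *
    (if B - p = 0 \<and> j = 0 then qint 3 else if B - p + j = 1 then - qint 2
     else if B - p = 1 \<and> j = 1 then 1 else 0)) = 0"
    (is "(\<Sum>p\<le>B. \<Sum>j\<le>a. ?q p j * ?d p j) = 0")
proof -
  have zero: "(\<Sum>j\<le>a. ?q B j * ?d B j) = qint (B + 1) * (qint 3 * qint (B + 2) - qint 2 * qint (B + 3))"
  proof -
    have "(\<Sum>j\<le>a. ?q B j * ?d B j) = (\<Sum>j\<in>{0, 1}. ?q B j * ?d B j)"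
      using assms by (intro sum.mono_neutral_right) auto
    then show ?thesis by (simp add: algebra_simps numeral_3_eq_3 numeral_2_eq_2)
  qed
  show ?thesis
  proof (cases B)
    \<comment> \<open>Only the row \<open>p = B\<close> exists; the other one would carry the factor
      [0].\<close>
    case 0
    have "(\<Sum>p\<le>B. \<Sum>j\<le>a. ?q p j * ?d p j) = (\<Sum>j\<le>a. ?q B j * ?d B j)"
      by (subst sum.remove[of _ B]) (auto simp: 0 simp del: One_nat_def)
    also note zero
    also have "qint (B + 1) * (qint 3 * qint (B + 2) - qint 2 * qint (B + 3)) = 0"
      unfolding 0 by (simp add: numeral_2_eq_2)
    finally show ?thesis .
  next
    case (Suc A)
    have 1: "(\<Sum>j\<le>a. ?q A j * ?d A j) = qint (A + 1) * (qint (B + 3) - qint 2 * qint (B + 2))"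
    proof -
      have "(\<Sum>j\<le>a. ?q A j * ?d A j) = (\<Sum>j\<in>{0, 1}. ?q A j * ?d A j)"
        using assms by (intro sum.mono_neutral_right) (auto simp: Suc)
      then show ?thesis by (simp add: Suc algebra_simps numeral_3_eq_3 numeral_2_eq_2)
    qed
    have two: "sum F {A, B} = F A + F B" for F :: "nat \<Rightarrow> scalar"
      using Suc by simp
    have "(\<Sum>p\<le>B. \<Sum>j\<le>a. ?q p j * ?d p j) = (\<Sum>p\<in>{A, B}. \<Sum>j\<le>a. ?q p j * ?d p j)"
      using Suc by (intro sum.mono_neutral_right) (auto intro!: sum.neutral)
    also have "\<dots> = qint (A + 1) * (qint (B + 3) - qint 2 * qint (B + 2)) +
        qint (B + 1) * (qint 3 * qint (B + 2) - qint 2 * qint (B + 3))"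
      unfolding two zero 1 ..
    also have "\<dots> = 0"
    proof -
      have q: "qint (B + 3) = qint 2 * qint (B + 2) - qint (B + 1)"
        "qint (B + 2) = qint 2 * qint (B + 1) - qint (A + 1)"
        using qint_Suc_Suc[of "B + 1"] qint_Suc_Suc[of "A + 1"] by (simp_all add: Suc numeral_3_eq_3)
      show ?thesis unfolding q qint_3 by (simp add: algebra_simps)
    qed
    finally show ?thesis .
  qed
qed

text \<open>The coefficient is a function of \<open>p\<close> times a function of \<open>j\<close>,
  and the surviving web depends on \<open>j\<close> only. So the sum over \<open>p\<close> splits
  off and is the three-term relation.\<close>

lemma merge_minus_expansion:
  assumes Q: "killed (minuses B @ pluses a) Q" "Q \<in> Hom t (minuses B @ pluses a)" and B: "n + m + 1 = B"
  shows "pad (minuses n) (merge Minus) (minuses m @ pluses (Suc a)) \<odot> expansion B a Q = 0"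
proof -
  let ?d = "\<lambda>p. (if p = n + 1 then 1 else 0) + (if p = n then - qint 2 else 0) + (if p + 1 = n then 1 else 0)"
  let ?Z = "\<lambda>j. pad (minuses n) (fork_sweep Plus (minuses m @ pluses j)) (pluses (a - j)) \<odot> Q"
  let ?k = "\<lambda>j. qint (B + j + 2) / (qint (B + 1) * qint (a + B + 2))"
  have "pad (minuses n) (merge Minus) (minuses m @ pluses (Suc a)) \<odot> expansion B a Q =
      (\<Sum>p\<le>B. \<Sum>j\<le>a. scale (coefficient B a p j) (scale (?d p) (?Z j)))"
    unfolding comp_expansion
  proof (intro sum.cong refl arg_cong[of _ _ "scale _"])
    fix p j assume "p \<in> {..B}" "j \<in> {..a}"
    then have a: "j + (a - j) = a" and p: "p + (B - p) = B" by auto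
    show "pad (minuses n) (merge Minus) (minuses m @ pluses (Suc a)) \<odot> arc_web p (B - p) j (a - j) \<odot> Q =
        scale (?d p) (?Z j)"
      using merge_minus_arc_web[of B j "a - j" Q t p "B - p" n m, unfolded a, OF Q p B] .
  qed
  also have "\<dots> = (\<Sum>j\<le>a. scale (?k j * (\<Sum>p\<le>B. qint (p + 1) * ?d p)) (?Z j))"
    unfolding sum_distrib_left scale_sum_left[symmetric]
    by (subst sum.swap) (simp add: coefficient_def mult_ac)
  also have "\<dots> = 0"
    using B by (subst sum_three_terms) simp_all
  finally show ?thesis .
qed

lemma merge_plus_expansion:
  assumes Q: "killed (minuses B @ pluses a) Q" and a: "n + m + 2 = a"
  shows "pad (minuses (Suc B) @ pluses n) (merge Plus) (pluses (Suc m)) \<odot> expansion B a Q = 0"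
proof -
  let ?d = "\<lambda>j. (if j = n then 1 else 0) + (if j = n + 1 then - qint 2 else 0) + (if j = n + 2 then 1 else 0)"
  let ?Z = "\<lambda>p. pad (minuses p) (arc_merge Plus (minuses (B - p) @ pluses n)) (pluses (Suc m)) \<odot> Q"
  let ?k = "\<lambda>p. qint (p + 1) / (qint (B + 1) * qint (a + B + 2))"
  have "pad (minuses (Suc B) @ pluses n) (merge Plus) (pluses (Suc m)) \<odot> expansion B a Q =
      (\<Sum>p\<le>B. \<Sum>j\<le>a. scale (coefficient B a p j) (scale (?d j) (?Z p)))"
    unfolding comp_expansion
  proof (intro sum.cong refl arg_cong[of _ _ "scale _"])
    fix p j assume "p \<in> {..B}" "j \<in> {..a}"
    then have j: "j + (a - j) = a" and p: "p + (B - p) = B" by auto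
    show "pad (minuses (Suc B) @ pluses n) (merge Plus) (pluses (Suc m)) \<odot> arc_web p (B - p) j (a - j) \<odot> Q =
        scale (?d j) (?Z p)"
      using merge_plus_arc_web[of p "B - p" a Q j "a - j" n m, unfolded p, OF Q j a] .
  qed
  also have "\<dots> = (\<Sum>p\<le>B. scale (?k p * (\<Sum>j\<le>a. qint (B + 2 + j) * ?d j)) (?Z p))"
    unfolding sum_distrib_left scale_sum_left[symmetric]
    by (simp add: coefficient_def mult_ac add_ac)
  also have "\<dots> = 0"
    using a by (subst sum_three_terms') simp_all
  finally show ?thesis .
qed

lemma cap_expansion:
  assumes Q: "killed (minuses B @ pluses a) Q" "Q \<in> Hom t (minuses B @ pluses a)" and a: "a \<ge> 1"
  shows "pad (minuses B) (cap Minus) (pluses a) \<odot> expansion B a Q = 0"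
proof -
  let ?d = "\<lambda>p j. if B - p = 0 \<and> j = 0 then qint 3 else if B - p + j = 1 then - qint 2
     else if B - p = 1 \<and> j = 1 then 1 else 0"
  have "pad (minuses B) (cap Minus) (pluses a) \<odot> expansion B a Q =
      (\<Sum>p\<le>B. \<Sum>j\<le>a. scale (coefficient B a p j) (scale (?d p j) Q))"
    unfolding comp_expansion
  proof (intro sum.cong refl arg_cong[of _ _ "scale _"])
    fix p j assume "p \<in> {..B}" "j \<in> {..a}"
    then have j: "j + (a - j) = a" and p: "p + (B - p) = B" by auto
    show "pad (minuses B) (cap Minus) (pluses a) \<odot> arc_web p (B - p) j (a - j) \<odot> Q = scale (?d p j) Q"
      by (rule cap_arc_web[OF Q p j])
  qed
  also have "\<dots> = scale (inverse (qint (B + 1) * qint (a + B + 2)) *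
      (\<Sum>p\<le>B. \<Sum>j\<le>a. qint (p + 1) * qint (B + j + 2) * ?d p j)) Q"
    unfolding sum_distrib_left scale_sum_left[symmetric] scale_scale coefficient_def divide_inverse
    by (simp only: mult_ac)
  also have "\<dots> = 0"
    unfolding sum_cap_terms[OF a] by simp
  finally show ?thesis .
qed

section \<open>Bending the last strand\<close>

text \<open>Equal letters will face a merge, and the mixed pair at the border will face the
  cap.\<close>

lemma segregated_pair:
  assumes "minuses b @ pluses a = u @ [y, z] @ v"
  obtains (minus) n m where "y = Minus" "z = Minus" "u = minuses n" "v = minuses m @ pluses a" "n + m + 2 = b"
  | (plus) n m where "y = Plus" "z = Plus" "u = minuses b @ pluses n" "v = pluses m" "n + m + 2 = a"
  | (mixed) n m where "y = Minus" "z = Plus" "u = minuses n" "v = pluses m" "b = Suc n" "a = Suc m"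
proof -
  consider (1) w where "minuses b = u @ w" "w @ pluses a = [y, z] @ v"
    | (2) w where "u = minuses b @ w" "pluses a = w @ [y, z] @ v"
    using assms unfolding append_eq_append_conv2 by metis
  then show ?thesis
  proof cases
    case 1
    show ?thesis
    proof (cases w)
      case Nil
      then have "pluses a = [y, z] @ v" "u = minuses b" using 1 by simp_all
      moreover have "y = Plus" "z = Plus" "v = pluses (length v)" "a = 2 + length v"
        using replicate_eq_append[OF \<open>pluses a = [y, z] @ v\<close>] by simp_all
      ultimately show ?thesis
        using plus[of 0 "length v"] by (simp add: numeral_2_eq_2)
    next
      case (Cons c w')
      show ?thesis
      proof (cases w')
        case Nil
        have "minuses b = u @ [y]" "pluses a = [z] @ v" using 1 Cons Nil by auto
        from replicate_eq_append[OF this(1)] replicate_eq_append[OF this(2)]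
        show ?thesis using mixed[of "length u" "length v"] by simp
      next
        case (Cons d w'')
        have "minuses b = u @ [y, z] @ w''" "v = w'' @ pluses a" using 1 Cons \<open>w = c # w'\<close> by auto
        from replicate_eq_append[OF this(1)] this(2)
          replicate_eq_append[of "length ([y, z] @ w'')" Minus "[y, z]" w'']
        show ?thesis using minus[of "length u" "length w''"] by simp
      qed
    qed
  next
    case 2
    from replicate_eq_append[OF 2(2)]
      replicate_eq_append[of "length ([y, z] @ v)" Plus "[y, z]" v]
    show ?thesis using 2(1) plus[of "length w" "length v"] by simp
  qed
qed

text \<open>The bent strand is the last one, so \<open>D\<close> slides past the cap. Annihilation
  of a bent web can thus be tested before bending.\<close>

lemma bend_comp:
  assumes "D \<in> Hom s d"
  shows "D \<odot> (ident s \<otimes> cap Plus) \<odot> (Y \<otimes> ident [Minus]) =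
    (ident d \<otimes> cap Plus) \<odot> (((D \<otimes> ident [Plus]) \<odot> Y) \<otimes> ident [Minus])"
  using exchange[OF assms Hom_elementary[of "Cap Plus"], symmetric, THEN comp_reassoc, of "Y \<otimes> ident [Minus]"]
  by (simp add: normalize)

text \<open>The bent strand is straightened by \<open>zigzag_left\<close>, so bending loses no
  information.\<close>

lemma unbend:
  assumes "Y \<in> Hom r (s @ [Plus])"
  shows "(((ident s \<otimes> cap Plus) \<odot> (Y \<otimes> ident [Minus])) \<otimes> ident [Plus]) \<odot> (ident r \<otimes> cup Minus) = Y"
proof -
  have "(((ident s \<otimes> cap Plus) \<odot> (Y \<otimes> ident [Minus])) \<otimes> ident [Plus]) \<odot> (ident r \<otimes> cup Minus) =
      (ident s \<otimes> cap Plus \<otimes> ident [Plus]) \<odot> ((Y \<otimes> ident [Minus, Plus]) \<odot> (ident r \<otimes> cup Minus))"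
    by (simp add: normalize)
  also have "(Y \<otimes> ident [Minus, Plus]) \<odot> (ident r \<otimes> cup Minus) = (ident (s @ [Plus]) \<otimes> cup Minus) \<odot> Y"
    using exchange[OF assms Hom_elementary[of "Cup Minus"]] by simp
  also have "(ident s \<otimes> cap Plus \<otimes> ident [Plus]) \<odot> (ident (s @ [Plus]) \<otimes> cup Minus) \<odot> Y =
      (ident s \<otimes> ((cap Plus \<otimes> ident [Plus]) \<odot> (ident [Plus] \<otimes> cup Minus))) \<odot> Y"
    by (simp add: normalize)
  also have "\<dots> = Y"
    using zigzag_left[of Plus] ident_comp[OF assms] by simp
  finally show ?thesis .
qed

definition bent_arc :: "nat \<Rightarrow> nat \<Rightarrow> nat \<Rightarrow> nat \<Rightarrow> skein" where
  "bent_arc p r j l = (ident (minuses (Suc (p + r)) @ pluses (j + l)) \<otimes> cap Plus) \<odot> (arc_web p r j l \<otimes> ident [Minus])"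

text \<open>With \<open>l = 0\<close> the bent strand is the right end of the arc itself, and
  \<open>arc_cap\<close> pulls it straight.\<close>

lemma bent_arc_0: "bent_arc p r j 0 = ident (minuses p) \<otimes> sweep_left Minus (minuses r @ pluses j)"
proof -
  have "bent_arc p r j 0 = ident (minuses p) \<otimes>
      ((ident (Minus # minuses r @ pluses j) \<otimes> cap Plus) \<odot> (arc Plus (minuses r @ pluses j) \<otimes> ident [Minus]))"
    by (simp add: bent_arc_def arc_web_def blocks normalize)
  then show ?thesis using arc_cap[of Plus "minuses r @ pluses j"] by simp
qed

text \<open>For \<open>r = 0\<close> the straightened strand meets letters \<open>Plus\<close> only,
  so all its crossings are between opposite signs.\<close>

lemma flat_bent_arc: "flat (minuses p @ pluses j @ [Minus]) (minuses (Suc p) @ pluses j) (bent_arc p 0 j 0)"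
  using flat_tens_left[OF flat_sweep_left[of j Minus], of "minuses p"]
  by (simp add: bent_arc_0 replicate_app_Cons_same)

lemma lower_pad_cap: "lower (weight (u @ [x, - x] @ v)) (u @ [x, - x] @ v) (u @ v) (pad u (cap x) v)"
  using lower.factor[OF Hom_pad_cap Hom_ident weight_cap] ident_comp[OF Hom_pad_cap] by simp

lemma lower_pad_merge: "lower (weight (u @ [x, x] @ v)) (u @ [x, x] @ v) (u @ [- x] @ v) (pad u (merge x) v)"
proof -
  have M: "pad u (merge x) v \<in> Hom (u @ [x, x] @ v) (u @ [- x] @ v)"
    using Hom_pad[OF Hom_elementary[of "Merge x"]] by simp
  show ?thesis
    using lower.factor[OF M Hom_ident] weight_wide_merge[of u x 0 v] ident_comp[OF M] by simp
qed

text \<open>If \<open>l\<close> is positive, the bent strand is a vertical one and the cap falls to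
  the bottom. If \<open>l = 0\<close> and \<open>r\<close> is positive, the arc crosses a strand of
  its own sign, and that crossing contains a merge.\<close>

lemma lower_bent_arc:
  assumes "r \<noteq> 0 \<or> l \<noteq> 0"
  shows "lower (weight (minuses (p + r) @ pluses (j + l) @ [Minus])) (minuses (p + r) @ pluses (j + l) @ [Minus])
    (minuses (Suc (p + r)) @ pluses (j + l)) (bent_arc p r j l)"
proof (cases l)
  case (Suc k)
  have E: "arc_web p r j l = arc_web p r j k \<otimes> ident [Plus]"
    by (simp add: arc_web_def Suc replicate_append_same tens_assoc)
  have "bent_arc p r j l = arc_web p r j k \<odot> pad (minuses (p + r) @ pluses (j + k)) (cap Plus) []"
    using exchange[OF Hom_arc_web[of p r j k] Hom_elementary[of "Cap Plus"]]
    unfolding bent_arc_def E by (simp add: Suc normalize)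
  moreover have "lower (weight (minuses (p + r) @ pluses (j + k) @ [Plus, Minus]))
      (minuses (p + r) @ pluses (j + k) @ [Plus, Minus]) (minuses (p + r) @ pluses (j + k))
      (pad (minuses (p + r) @ pluses (j + k)) (cap Plus) [])"
    using lower_pad_cap[of "minuses (p + r) @ pluses (j + k)" Plus "[]"] by simp
  from lower_comp_left[OF this Hom_arc_web] have "lower (weight (minuses (p + r) @ pluses (j + k) @ [Plus, Minus]))
      (minuses (p + r) @ pluses (j + k) @ [Plus, Minus]) (minuses (Suc (p + r)) @ pluses (Suc (j + k)))
      (arc_web p r j k \<odot> pad (minuses (p + r) @ pluses (j + k)) (cap Plus) [])" .
  ultimately show ?thesis by (simp add: Suc blocks)
next
  case 0
  then obtain k where r: "r = Suc k" using assms by (cases r) auto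
  have N: "minuses r = minuses k @ [Minus]" by (simp add: r replicate_append_same)
  let ?u = "minuses (p + k)" and ?v = "pluses j"
  let ?A = "ident (minuses p) \<otimes> (sweep_left Minus (minuses k) \<otimes> ident [Minus]) \<otimes> ident ?v"
  have "bent_arc p r j l = ?A \<odot> pad ?u (fork Plus) ?v \<odot> pad ?u (merge Minus) ?v \<odot>
      (ident (minuses (p + r)) \<otimes> sweep_left Minus ?v)"
    unfolding 0 bent_arc_0 sweep_left_append N sweep_left_single
    by (simp add: crossing_same r blocks replicate_append_same normalize)
  moreover have "lower (weight (?u @ [Minus, Minus] @ ?v)) (minuses (p + r) @ ?v @ [Minus])
      (minuses p @ Minus # minuses k @ [Minus] @ ?v)
      (?A \<odot> pad ?u (fork Plus) ?v \<odot> pad ?u (merge Minus) ?v \<odot> (ident (minuses (p + r)) \<otimes> sweep_left Minus ?v))"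
  proof -
    have 1: "lower (weight (?u @ [Minus, Minus] @ ?v)) (minuses (p + r) @ ?v @ [Minus]) (?u @ [Plus] @ ?v)
        (pad ?u (merge Minus) ?v \<odot> (ident (minuses (p + r)) \<otimes> sweep_left Minus ?v))"
    proof (rule lower_comp_right)
      show "lower (weight (?u @ [Minus, Minus] @ ?v)) (?u @ [Minus, Minus] @ ?v) (?u @ [Plus] @ ?v) (pad ?u (merge Minus) ?v)"
        using lower_pad_merge[of ?u Minus ?v] by simp
      show "ident (minuses (p + r)) \<otimes> sweep_left Minus ?v \<in> Hom (minuses (p + r) @ ?v @ [Minus]) (?u @ [Minus, Minus] @ ?v)"
        using Hom_tens[OF Hom_ident Hom_sweep_left[of Minus ?v], of "minuses (p + r)"] by (simp add: r blocks)
    qed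
    have 2: "pad ?u (fork Plus) ?v \<in> Hom (?u @ [Plus] @ ?v) (?u @ [Minus, Minus] @ ?v)"
      using Hom_pad[OF Hom_elementary[of "Split Plus"]] by simp
    have 3: "?A \<in> Hom (?u @ [Minus, Minus] @ ?v) (minuses p @ Minus # minuses k @ [Minus] @ ?v)"
      by (rule Hom_intros Hom_sweep_left refl | simp add: blocks)+
    show ?thesis by (rule lower_comp_left[OF lower_comp_left[OF 1 2] 3])
  qed
  ultimately show ?thesis
    using 0 by (simp add: r blocks weight_def)
qed


lemma Hom_expansion:
  assumes "Q \<in> Hom s (minuses B @ pluses a)"
  shows "expansion B a Q \<in> Hom s ((minuses (Suc B) @ pluses a) @ [Plus])"
  unfolding expansion_def
proof (intro Hom_sum Hom_scale Hom_comp[OF assms])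
  fix p j assume "p \<in> {..B}" "j \<in> {..a}"
  then show "arc_web p (B - p) j (a - j) \<in> Hom (minuses B @ pluses a) ((minuses (Suc B) @ pluses a) @ [Plus])"
    using Hom_arc_web[of p "B - p" j "a - j"] by (simp add: replicate_append_same)
qed

lemma clasp_expansion:
  assumes a: "a \<ge> 1"
    and s: "count_list s Plus = a" "count_list s Minus = B"
    and P: "is_nonseg_clasp (s @ [Minus]) (minuses (Suc B) @ pluses a) P"
    and Q: "is_nonseg_clasp s (minuses B @ pluses a) Q"
  shows "(P \<otimes> ident [Plus]) \<odot> (ident s \<otimes> cup Minus) = expansion B a Q"
proof -
  let ?s = "minuses B @ pluses a" and ?t = "minuses (Suc B) @ pluses a"
  obtain f C where f: "flat s ?s f" and C: "is_clasp s C" and Qf: "Q = f \<odot> C"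
    using nonseg_clasp_flat[OF Q] by blast
  have C': "C \<in> Hom s s" using C by (simp add: is_clasp_def)
  note f' = flat_Hom[OF f]
  have HQ: "Q \<in> Hom s ?s" unfolding Qf by (rule Hom_comp[OF C' f'])
  have w: "weight ?s = weight s" by (rule flat_weight[OF f])
  \<comment> \<open>A merge or cap over the chain \<open>f\<close> leads to a smaller weight than
    that of \<open>s\<close>, so \<open>C\<close> kills it.\<close>
  have kQ: "killed ?s Q"
    unfolding killed_def Qf
  proof (intro allI conjI impI)
    fix u v x assume e: "?s = u @ [x, x] @ v"
    have "lower (weight s) s (u @ [- x] @ v) (pad u (merge x) v \<odot> f)"
      using lower_comp_right[OF lower_pad_merge[of u x v, folded e] f'] w by simp
    from clasp_lower(1)[OF C this] show "pad u (merge x) v \<odot> f \<odot> C = 0"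
      by (simp add: comp_assoc)
  next
    fix u v x assume e: "?s = u @ [x, - x] @ v"
    have "lower (weight s) s (u @ v) (pad u (cap x) v \<odot> f)"
      using lower_comp_right[OF lower_pad_cap[of u x v, folded e] f'] w by simp
    from clasp_lower(1)[OF C this] show "pad u (cap x) v \<odot> f \<odot> C = 0"
      by (simp add: comp_assoc)
  qed
  define Y where "Y = expansion B a Q"
  \<comment> \<open>The right-hand side with its last strand bent down; \<open>unbend\<close>
    recovers it once \<open>R = P\<close> is known.\<close>
  define R where "R = (ident ?t \<otimes> cap Plus) \<odot> (Y \<otimes> ident [Minus])"
  have HY: "Y \<in> Hom s (?t @ [Plus])"
    unfolding Y_def by (rule Hom_expansion[OF HQ])
  have HR: "R \<in> Hom (s @ [Minus]) ?t"
  proof -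
    have "ident ?t \<otimes> cap Plus \<in> Hom ((?t @ [Plus]) @ [Minus]) ?t"
      using Hom_tens[OF Hom_ident[of ?t] Hom_elementary[of "Cap Plus"]] by simp
    then show ?thesis
      unfolding R_def by (rule Hom_comp[OF Hom_tens[OF HY Hom_ident]])
  qed
  have bend: "D \<odot> R = 0" if "D \<in> Hom ?t d" "(D \<otimes> ident [Plus]) \<odot> Y = 0" for D d
    using bend_comp[OF that(1), of Y] that(2) by (simp add: R_def)
  have kR: "killed ?t R"
    unfolding killed_def
  proof (intro allI conjI impI)
    fix u v x assume e: "?t = u @ [x, x] @ v"
    have H: "pad u (merge x) v \<in> Hom ?t (u @ [- x] @ v)"
      unfolding e using Hom_pad[OF Hom_elementary[of "Merge x"]] by simp
    show "pad u (merge x) v \<odot> R = 0"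
    proof (rule bend[OF H])
      from e show "(pad u (merge x) v \<otimes> ident [Plus]) \<odot> Y = 0"
      proof (cases rule: segregated_pair)
        case (minus n m)
        then show ?thesis
          using merge_minus_expansion[OF kQ HQ, of n m]
          by (simp add: Y_def tens_assoc replicate_append_same)
      next
        case (plus n m)
        then show ?thesis
          using merge_plus_expansion[OF kQ, of n m]
          by (simp add: Y_def tens_assoc replicate_append_same)
      qed simp
    qed
  next
    fix u v x assume e: "?t = u @ [x, - x] @ v"
    show "pad u (cap x) v \<odot> R = 0"
    proof (rule bend)
      show "pad u (cap x) v \<in> Hom ?t (u @ v)"
        unfolding e by (rule Hom_pad_cap)
      from e show "(pad u (cap x) v \<otimes> ident [Plus]) \<odot> Y = 0"
      proof (cases rule: segregated_pair)
        case (mixed n m)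
        then show ?thesis
          using cap_expansion[OF kQ HQ a]
          by (simp add: Y_def tens_assoc replicate_append_same)
      qed simp_all
    qed
  qed
  let ?w = "weight (s @ [Minus])" and ?b = "\<lambda>p j. bent_arc p (B - p) j (a - j)"
  \<comment> \<open>The one summand that is a chain of crossings, with the clasp inside
    \<open>Q\<close> replaced by the identity.\<close>
  define A where "A = ?b B a \<odot> (f \<otimes> ident [Minus])"
  have fm: "flat (s @ [Minus]) (?s @ [Minus]) (f \<otimes> ident [Minus])"
    by (rule flat_tens_right[OF f])
  have b: "flat (?s @ [Minus]) ?t (?b B a)"
    using flat_bent_arc[of B a] by simp
  have fA: "flat (s @ [Minus]) ?t A"
    unfolding A_def by (rule flat_comp[OF b fm])
  have R: "R = (\<Sum>p\<le>B. \<Sum>j\<le>a. scale (coefficient B a p j) (?b p j \<odot> (Q \<otimes> ident [Minus])))"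
    unfolding R_def Y_def expansion_def tens_sum_left comp_sum_right tens_scale_left comp_scale_right comp_tens_ident
    by (intro sum.cong refl arg_cong[of _ _ "scale _"]) (simp add: bent_arc_def comp_assoc)
  have "lower ?w (s @ [Minus]) ?t (R - A)"
  proof -
    \<comment> \<open>The nested conditionals make the double sum of subtracted terms collapse to
      the single \<open>A\<close>.\<close>
    have "lower ?w (s @ [Minus]) ?t
        (scale (coefficient B a p j) (?b p j \<odot> (Q \<otimes> ident [Minus])) - (if j = a then if p = B then A else 0 else 0))"
      if "p \<le> B" "j \<le> a" for p j
    proof (cases "p = B \<and> j = a")
      case True
      have c: "coefficient B a B a = 1"
        using qint_nonzero[of "B + 1"] qint_nonzero[of "a + B + 2"] by (simp add: coefficient_def add_ac)
      have "lower (weight s) s ?s (f \<odot> (C - ident s))"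
        by (rule lower_comp_left[OF clasp_cong_ident[OF C] f'])
      then have "lower (weight s) s ?s (Q - f)"
        using comp_ident[OF f'] by (simp add: Qf comp_diff_right)
      from lower_comp_left[OF lower_tens_right[OF this] flat_Hom[OF b]]
      show ?thesis
        using True c by (simp add: A_def tens_diff_left comp_diff_right)
    next
      case False
      then have "B - p \<noteq> 0 \<or> a - j \<noteq> 0" using that by auto
      from lower_bent_arc[OF this, of p j]
      have "lower (weight (?s @ [Minus])) (?s @ [Minus]) ?t (?b p j)"
        using that by simp
      moreover have "weight (?s @ [Minus]) = ?w"
        using w by (simp add: weight_append prod_eq_iff)
      ultimately have "lower ?w (s @ [Minus]) ?t (?b p j \<odot> (Q \<otimes> ident [Minus]))"
        using lower_comp_right[OF _ Hom_tens[OF HQ Hom_ident]] by simp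
      then show ?thesis using False by (auto intro: lower.scale)
    qed
    then have "lower ?w (s @ [Minus]) ?t (\<Sum>p\<le>B. \<Sum>j\<le>a.
        scale (coefficient B a p j) (?b p j \<odot> (Q \<otimes> ident [Minus])) - (if j = a then if p = B then A else 0 else 0))"
      by (intro lower_sum) auto
    then show ?thesis
      by (simp add: sum_subtractf R)
  qed
  then have "R = P"
    by (rule nonseg_clasp_unique[OF P refl HR kR fA])
  then show ?thesis
    using unbend[OF HY] by (simp add: R_def Y_def)
qed

theorem theorem3p2:
  fixes a b :: nat and eps :: word and P Q :: skein
  assumes "a \<ge> 1" and "b \<ge> 1"
    and "count_list eps Plus = a" and "count_list eps Minus = b - 1"
    and "is_nonseg_clasp (eps @ [Minus]) (replicate b Minus @ replicate a Plus) P"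
    and "is_nonseg_clasp eps (replicate (b - 1) Minus @ replicate a Plus) Q"
  shows "(P \<otimes> ident [Plus]) \<odot> (ident eps \<otimes> elementary (Cup Minus)) =
    (\<Sum>i = 1..b. \<Sum>j = 0..a.
       scale (qint (b - i + 1) * qint (b + j + 1) / (qint b * qint (a + b + 1)))
         (E_web a b i j \<odot> Q))"
proof -
  obtain B where b: "b = Suc B" using assms(2) by (cases b) auto
  have "(P \<otimes> ident [Plus]) \<odot> (ident eps \<otimes> cup Minus) = expansion B a Q"
    using assms(5,6) unfolding b
    by (intro clasp_expansion[OF assms(1,3)]) (simp_all add: assms(4) b)
  \<comment> \<open>Substitution of \<open>p = b - i\<close>, under which \<open>i = b\<close> is
    the row \<open>p = 0\<close> and \<open>i = 1\<close> the row \<open>p = B\<close>.\<close>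
  also have "\<dots> = (\<Sum>i = 1..b. \<Sum>j = 0..a. scale (coefficient B a (b - i) j) (arc_web (b - i) (i - 1) j (a - j) \<odot> Q))"
    unfolding expansion_def atLeast0AtMost
    by (rule sum.reindex_bij_witness[of _ "\<lambda>i. b - i" "\<lambda>p. b - p"]) (auto simp: b intro!: sum.cong)
  also have "\<dots> = (\<Sum>i = 1..b. \<Sum>j = 0..a.
       scale (qint (b - i + 1) * qint (b + j + 1) / (qint b * qint (a + b + 1))) (E_web a b i j \<odot> Q))"
    by (intro sum.cong refl) (simp add: E_web_arc_web coefficient_def b)
  finally show ?thesis .
qed

end
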